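(* Let $\Phi$ and $\Psi$ be $\mathcal A$-localized frames for $\mathcal H$ satisfying $\Phi\sim_{\mathcal A}\Psi$, let $w_1,w_2$ be $\mathcal A$-admissible weights and $1\le p\le\infty$. Let $O:\mathcal H^p_{w_1}\to\mathcal H^p_{w_2}$ be a bounded linear operator. Then $O$ is bijective if and only if $\mathcal M_{(\Phi,\Psi)}(O)$ is bijective as an operator from $\operatorname{ran}(C_\Psi^{p,w_1})$ to $\operatorname{ran}(C_\Phi^{p,w_2})$. In this case the matrix associated to the inverse is given by $$\big(\mathcal M_{(\Phi,\Psi)}(O)\big)^\dagger:=\big(\mathcal M_{(\Phi,\Psi)}(O)|_{\operatorname{ran}(C_\Psi)}\big)^{-1}=\mathcal M_{(\tilde\Psi,\tilde\Phi)}(O^{-1}),$$ where the second equality is understood on $\operatorname{ran}(C_\Phi^{p,w_2})$.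
   Context: $\mathcal H$ is a separable Hilbert space and $K\subseteq\mathbb R^d$ a countable separated index set; sequences and matrices are indexed by $K$. $\ell^{00}$ denotes the finitely supported sequences. A weight is a sequence $w=(w_k)$ with $w_k>0$; $\ell^p_w=\{c:(w_kc_k)\in\ell^p\}$ with $\|c\|_{\ell^p_w}=\|(w_kc_k)\|_{\ell^p}$. A frame $\Psi=(\psi_k)_{k\in K}$ satisfies $A\|f\|^2\le\sum_k|\langle f,\psi_k\rangle|^2\le B\|f\|^2$ for all $f\in\mathcal H$ with some $A,B>0$; $C_\Psi f=(\langle f,\psi_k\rangle)_k$, $D_\Psi c=\sum_kc_k\psi_k$, $S_\Psi=D_\Psi C_\Psi$; the canonical dual frame is $\tilde\Psi=(\tilde\psi_k)$, $\tilde\psi_k=S_\Psi^{-1}\psi_k$. Cross-Gram matrix: $(G_{\Psi,\Phi})_{k,l}=\langle\phi_l,\psi_k\rangle$, $G_\Psi=G_{\Psi,\Psi}$. $\mathcal A$ is a fixed solid spectral matrix algebra: a Banach $*$-algebra of matrices over $K$ such that (i) $\mathcal A\subseteq\mathcal B(\ell^2)$; (ii) $A\in\mathcal A$ invertible on $\ell^2$ implies $A^{-1}\in\mathcal A$; (iii) $A\in\mathcal A$ and $|b_{k,l}|\le|a_{k,l}|$ for all $k,l$ imply $B=(b_{k,l})\in\mathcal A$ and $\|B\|_{\mathcal A}\le\|A\|_{\mathcal A}$. Write $\Psi\sim_{\mathcal A}\Phi$ if $G_{\Psi,\Phi}\in\mathcal A$; $\Psi$ is $\mathcal A$-localized if $\Psi\sim_{\mathcal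 A}\Psi$ (it is known that then $\Psi\sim_{\mathcal A}\tilde\Psi$ and $\tilde\Psi\sim_{\mathcal A}\tilde\Psi$). A weight $w$ is $\mathcal A$-admissible if every $A\in\mathcal A$ defines a bounded operator on $\ell^p_w$ for all $1\le p\le\infty$ (then $1/w$ is admissible too). Coorbit spaces: $\mathcal H^{00}=\{\sum_kc_k\psi_k:c\in\ell^{00}\}$. For $1\le p<\infty$, $\mathcal H^p_w$ is the completion of $\mathcal H^{00}$ in the norm $\|f\|_{\mathcal H^p_w}=\|C_{\tilde\Psi}f\|_{\ell^p_w}$. $\mathcal H^\infty_w$ is the set of equivalence classes $f=[f_n]$ of sequences $f_n\in\mathcal H$ such that $\alpha_k=\lim_n\langle f_n,\tilde\psi_k\rangle$ exists for all $k$ and $\sup_n\|C_{\tilde\Psi}f_n\|_{\ell^\infty_w}<\infty$, where $(f_n)\sim(g_n)$ iff $\langle f_n-g_n,\tilde\psi_k\rangle\to0$ for all $k$; $C_{\tilde\Psi}f=\alpha$, $\|f\|_{\mathcal H^\infty_w}=\|\alpha\|_{\ell^\infty_w}$. Via coefficient sequences $C_{\tilde\Psi}f$, $\mathcal H^p_w\subseteq\mathcal H^\infty_w$. The pairing (for $1/p+1/q=1$) is $\langle f,h\rangle_{\mathcal H^p_w,\mathcal H^q_{1/w}}=\sum_k(C_{\tilde\Psi}f)_k\overline{(C_\Psi h)_k}$, where $C_\Psi h=G_\Psi C_{\tilde\Psi}h$. Any frame $\Phi\sim_{\mathcal A}\Psi$ gives the same spaces with equivalent norms. For such $\Phi$ (and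 for $\tilde\Phi$): $C_\Phi^{p,w}:\mathcal H^p_w\to\ell^p_w$, $C^{p,w}_\Phi f=(\langle f,\phi_k\rangle)_k$ (pairing), and $D_\Phi c=\sum_kc_k\phi_k$ on $\ell^p_w$ (weak-$*$ convergent, i.e. in $\sigma(\mathcal H^\infty_w,\mathcal H^1_{1/w})$, if $p=\infty$). The superscripts are dropped when clear. The Galerkin matrix of a bounded operator $O:\mathcal H^{p_1}_{w_1}\to\mathcal H^{p_2}_{w_2}$ with respect to frames $\Phi,\Xi\sim_{\mathcal A}\Psi$ is $(\mathcal M_{(\Phi,\Xi)}(O))_{k,l}=\langle O\xi_l,\phi_k\rangle$ (pairing of $\mathcal H^{p_2}_{w_2}$ and $\mathcal H^{q_2}_{1/w_2}$), regarded as the operator $C_\Phi\circ O\circ D_\Xi:\ell^{p_1}_{w_1}\to\ell^{p_2}_{w_2}$.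
   Formalization: The solid spectral matrix algebra is additionally assumed to contain the identity matrix (the usual convention for inverse-closed algebras); without it condition (ii) can hold vacuously and the claim fails. *)

theory Defs
  imports "HOL-Analysis.Analysis"
begin

section \<open>Complex Hilbert spaces\<close>

text \<open>The inner product is linear in the first argument; the real inner product, norm and
  topology are those of the class \<^class>\<open>real_inner\<close>.\<close>

class complex_inner = real_inner +
  fixes scaleC :: "complex \<Rightarrow> 'a \<Rightarrow> 'a" (infixr \<open>*\<^sub>C\<close> 75)
    and cinner :: "'a \<Rightarrow> 'a \<Rightarrow> complex"
  assumes scaleC_add_right: "a *\<^sub>C (x + y) = a *\<^sub>C x + a *\<^sub>C y"
    and scaleC_add_left: "(a + b) *\<^sub>C x = a *\<^sub>C x + b *\<^sub>C x"
    and scaleC_scaleC: "a *\<^sub>C b *\<^sub>C x = (a * b) *\<^sub>C x"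
    and scaleC_of_real: "complex_of_real r *\<^sub>C x = r *\<^sub>R x"
    and cinner_commute: "cinner x y = cnj (cinner y x)"
    and cinner_add_left: "cinner (x + y) z = cinner x z + cinner y z"
    and cinner_scaleC_left: "cinner (a *\<^sub>C x) y = a * cinner x y"
    and Re_cinner: "Re (cinner x y) = inner x y"

class chilbert_space = complex_inner + complete_space

instantiation complex :: chilbert_space
begin

definition scaleC_complex :: "complex \<Rightarrow> complex \<Rightarrow> complex"
  where "scaleC_complex a x = a * x"

definition cinner_complex :: "complex \<Rightarrow> complex \<Rightarrow> complex"
  where "cinner_complex x y = x * cnj y"

instance
  by standard
    (auto simp: scaleC_complex_def cinner_complex_def algebra_simps scaleR_conv_of_real
      inner_complex_def)

end


section \<open>Sequences and matrices over an index set\<close>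

text \<open>Sequences over \<open>K\<close> are functions vanishing off \<open>K\<close>, and matrices over \<open>K\<close> are
  functions vanishing off \<open>K \<times> K\<close>; thus equality of functions is equality over \<open>K\<close>.
  Exponents range over \<open>[1, \<infinity>]\<close> as a subset of \<^typ>\<open>ennreal\<close>.\<close>

definition seqs_on :: "'k set \<Rightarrow> ('k \<Rightarrow> complex) set"
  where "seqs_on K = {c. \<forall>k. k \<notin> K \<longrightarrow> c k = 0}"

definition mats_on :: "'k set \<Rightarrow> ('k \<Rightarrow> 'k \<Rightarrow> complex) set"
  where "mats_on K = {A. \<forall>k l. k \<notin> K \<or> l \<notin> K \<longrightarrow> A k l = 0}"

definition fin_seqs :: "'k set \<Rightarrow> ('k \<Rightarrow> complex) set"
  where "fin_seqs K = {c \<in> seqs_on K. finite {k. c k \<noteq> 0}}"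

definition weight_on :: "'k set \<Rightarrow> ('k \<Rightarrow> real) \<Rightarrow> bool"
  where "weight_on K w \<longleftrightarrow> (\<forall>k\<in>K. 0 < w k)"

definition ell :: "'k set \<Rightarrow> ennreal \<Rightarrow> ('k \<Rightarrow> real) \<Rightarrow> ('k \<Rightarrow> complex) set"
  where "ell K p w =
    {c \<in> seqs_on K.
       if p = \<infinity> then bdd_above ((\<lambda>k. w k * cmod (c k)) ` K)
       else (\<lambda>k. (w k * cmod (c k)) powr enn2real p) summable_on K}"

text \<open>The \<open>0\<close> below only matters for \<open>K = {}\<close>.\<close>

definition ell_norm :: "'k set \<Rightarrow> ennreal \<Rightarrow> ('k \<Rightarrow> real) \<Rightarrow> ('k \<Rightarrow> complex) \<Rightarrow> real"
  where "ell_norm K p w c =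
    (if p = \<infinity> then Sup (insert 0 ((\<lambda>k. w k * cmod (c k)) ` K))
     else (\<Sum>\<^sub>\<infinity>k\<in>K. (w k * cmod (c k)) powr enn2real p) powr (1 / enn2real p))"

definition conj_exp :: "ennreal \<Rightarrow> ennreal"
  where "conj_exp p = inverse (1 - inverse p)"

lemma conj_exp:
  assumes "1 \<le> p"
  shows "inverse p + inverse (conj_exp p) = 1"
proof -
  have inv: "inverse (inverse x) = x" for x :: ennreal
    by (cases x rule: ennreal_cases; cases "x = 0") (auto simp: inverse_ennreal less_le)
  have "inverse p \<le> (1::ennreal)"
    using assms
    by (cases p rule: ennreal_cases)
      (auto simp: inverse_ennreal inverse_le_1_iff simp flip: ennreal_1)
  then show ?thesis
    unfolding conj_exp_def inv by (simp add: add_diff_inverse_ennreal)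
qed

definition mat_id :: "'k set \<Rightarrow> 'k \<Rightarrow> 'k \<Rightarrow> complex"
  where "mat_id K k l = (if k \<in> K \<and> k = l then 1 else 0)"

definition mat_mult ::
    "'k set \<Rightarrow> ('k \<Rightarrow> 'k \<Rightarrow> complex) \<Rightarrow> ('k \<Rightarrow> 'k \<Rightarrow> complex) \<Rightarrow> 'k \<Rightarrow> 'k \<Rightarrow> complex"
  where "mat_mult K A B k l = (\<Sum>\<^sub>\<infinity>m\<in>K. A k m * B m l)"

definition mat_adj :: "('k \<Rightarrow> 'k \<Rightarrow> complex) \<Rightarrow> 'k \<Rightarrow> 'k \<Rightarrow> complex"
  where "mat_adj A k l = cnj (A l k)"

definition mat_vec :: "'k set \<Rightarrow> ('k \<Rightarrow> 'k \<Rightarrow> complex) \<Rightarrow> ('k \<Rightarrow> complex) \<Rightarrow> 'k \<Rightarrow> complex"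
  where "mat_vec K A c k = (if k \<in> K then \<Sum>\<^sub>\<infinity>l\<in>K. A k l * c l else 0)"

definition mat_bounded ::
    "'k set \<Rightarrow> ennreal \<Rightarrow> ('k \<Rightarrow> real) \<Rightarrow> ('k \<Rightarrow> 'k \<Rightarrow> complex) \<Rightarrow> bool"
  where "mat_bounded K p w A \<longleftrightarrow>
    (\<forall>c\<in>ell K p w. (\<forall>k\<in>K. (\<lambda>l. A k l * c l) summable_on K) \<and> mat_vec K A c \<in> ell K p w) \<and>
    (\<exists>C. \<forall>c\<in>ell K p w. ell_norm K p w (mat_vec K A c) \<le> C * ell_norm K p w c)"


section \<open>Solid spectral matrix algebras\<close>

text \<open>As usual for inverse-closed subalgebras, the algebra contains the identity matrix.
  Otherwise \<open>inverse_closed\<close> could hold vacuously: take any solid algebra and enlarge the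
  index set by a point whose row and column vanish in all members.\<close>

locale solid_spectral_matrix_algebra =
  fixes K :: "'k set"
    and \<A> :: "('k \<Rightarrow> 'k \<Rightarrow> complex) set"
    and nrm :: "('k \<Rightarrow> 'k \<Rightarrow> complex) \<Rightarrow> real"
  assumes mats: "\<A> \<subseteq> mats_on K"
    and id_mem: "mat_id K \<in> \<A>"
    and add_mem: "\<lbrakk>A \<in> \<A>; B \<in> \<A>\<rbrakk> \<Longrightarrow> (\<lambda>k l. A k l + B k l) \<in> \<A>"
    and scale_mem: "A \<in> \<A> \<Longrightarrow> (\<lambda>k l. a * A k l) \<in> \<A>"
    and mult_mem: "\<lbrakk>A \<in> \<A>; B \<in> \<A>\<rbrakk> \<Longrightarrow> mat_mult K A B \<in> \<A>"
    and adj_mem: "A \<in> \<A> \<Longrightarrow> mat_adj A \<in> \<A>"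
    and nrm_nonneg: "A \<in> \<A> \<Longrightarrow> 0 \<le> nrm A"
    and nrm_eq_0: "A \<in> \<A> \<Longrightarrow> nrm A = 0 \<longleftrightarrow> A = (\<lambda>k l. 0)"
    and nrm_triangle: "\<lbrakk>A \<in> \<A>; B \<in> \<A>\<rbrakk> \<Longrightarrow> nrm (\<lambda>k l. A k l + B k l) \<le> nrm A + nrm B"
    and nrm_scale: "A \<in> \<A> \<Longrightarrow> nrm (\<lambda>k l. a * A k l) = cmod a * nrm A"
    and nrm_mult: "\<lbrakk>A \<in> \<A>; B \<in> \<A>\<rbrakk> \<Longrightarrow> nrm (mat_mult K A B) \<le> nrm A * nrm B"
    and nrm_adj: "A \<in> \<A> \<Longrightarrow> nrm (mat_adj A) = nrm A"
    and nrm_complete: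
      "\<lbrakk>\<And>n. X n \<in> \<A>; \<And>e. 0 < e \<Longrightarrow> \<exists>N. \<forall>m\<ge>N. \<forall>n\<ge>N. nrm (\<lambda>k l. X m k l - X n k l) < e\<rbrakk>
        \<Longrightarrow> \<exists>A\<in>\<A>. (\<lambda>n. nrm (\<lambda>k l. X n k l - A k l)) \<longlonglongrightarrow> 0"
    and bounded_ell2: "A \<in> \<A> \<Longrightarrow> mat_bounded K 2 (\<lambda>_. 1) A"
    and inverse_closed:
      "\<lbrakk>A \<in> \<A>; bij_betw (mat_vec K A) (ell K 2 (\<lambda>_. 1)) (ell K 2 (\<lambda>_. 1))\<rbrakk>
        \<Longrightarrow> \<exists>B\<in>\<A>. \<forall>c\<in>ell K 2 (\<lambda>_. 1). mat_vec K B (mat_vec K A c) = c"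
    and solid:
      "\<lbrakk>A \<in> \<A>; B \<in> mats_on K; \<And>k l. \<lbrakk>k \<in> K; l \<in> K\<rbrakk> \<Longrightarrow> cmod (B k l) \<le> cmod (A k l)\<rbrakk>
        \<Longrightarrow> B \<in> \<A> \<and> nrm B \<le> nrm A"

definition admissible :: "'k set \<Rightarrow> ('k \<Rightarrow> 'k \<Rightarrow> complex) set \<Rightarrow> ('k \<Rightarrow> real) \<Rightarrow> bool"
  where "admissible K \<A> w \<longleftrightarrow>
    weight_on K w \<and> (\<forall>A\<in>\<A>. \<forall>p. 1 \<le> p \<longrightarrow> mat_bounded K p w A)"


section \<open>Frames and localization\<close>

definition is_frame :: "'k set \<Rightarrow> ('k \<Rightarrow> 'h::chilbert_space) \<Rightarrow> bool"
  where "is_frame K \<psi> \<longleftrightarrow>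
    (\<exists>A>0. \<exists>B>0. \<forall>f.
       (\<lambda>k. (cmod (cinner f (\<psi> k)))\<^sup>2) summable_on K \<and>
       A * (norm f)\<^sup>2 \<le> (\<Sum>\<^sub>\<infinity>k\<in>K. (cmod (cinner f (\<psi> k)))\<^sup>2) \<and>
       (\<Sum>\<^sub>\<infinity>k\<in>K. (cmod (cinner f (\<psi> k)))\<^sup>2) \<le> B * (norm f)\<^sup>2)"

definition analysis :: "'k set \<Rightarrow> ('k \<Rightarrow> 'h::chilbert_space) \<Rightarrow> 'h \<Rightarrow> 'k \<Rightarrow> complex"
  where "analysis K \<psi> f k = (if k \<in> K then cinner f (\<psi> k) else 0)"

definition synthesis :: "'k set \<Rightarrow> ('k \<Rightarrow> 'h::chilbert_space) \<Rightarrow> ('k \<Rightarrow> complex) \<Rightarrow> 'h"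
  where "synthesis K \<psi> c = (\<Sum>\<^sub>\<infinity>k\<in>K. c k *\<^sub>C \<psi> k)"

definition frame_operator :: "'k set \<Rightarrow> ('k \<Rightarrow> 'h::chilbert_space) \<Rightarrow> 'h \<Rightarrow> 'h"
  where "frame_operator K \<psi> f = synthesis K \<psi> (analysis K \<psi> f)"

definition dual_frame :: "'k set \<Rightarrow> ('k \<Rightarrow> 'h::chilbert_space) \<Rightarrow> 'k \<Rightarrow> 'h"
  where "dual_frame K \<psi> k = inv (frame_operator K \<psi>) (\<psi> k)"

definition gram ::
    "'k set \<Rightarrow> ('k \<Rightarrow> 'h::chilbert_space) \<Rightarrow> ('k \<Rightarrow> 'h) \<Rightarrow> 'k \<Rightarrow> 'k \<Rightarrow> complex"
  where "gram K \<psi> \<phi> k l = (if k \<in> K \<and> l \<in> K then cinner (\<phi> l) (\<psi> k) else 0)"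

definition mutually_localized ::
    "'k set \<Rightarrow> ('k \<Rightarrow> 'k \<Rightarrow> complex) set \<Rightarrow> ('k \<Rightarrow> 'h::chilbert_space) \<Rightarrow> ('k \<Rightarrow> 'h) \<Rightarrow> bool"
  where "mutually_localized K \<A> \<psi> \<phi> \<longleftrightarrow> gram K \<psi> \<phi> \<in> \<A>"

definition localized :: "'k set \<Rightarrow> ('k \<Rightarrow> 'k \<Rightarrow> complex) set \<Rightarrow> ('k \<Rightarrow> 'h::chilbert_space) \<Rightarrow> bool"
  where "localized K \<A> \<psi> \<longleftrightarrow> mutually_localized K \<A> \<psi> \<psi>"


section \<open>Coorbit spaces\<close>

text \<open>Throughout, \<open>\<psi>\<close> is the frame defining the spaces. Elements of \<open>\<H>\<^sup>p\<^sub>w\<close> are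
  equivalence classes of sequences in the Hilbert space: for finite \<open>p\<close> the completion of
  \<open>\<H>\<^sup>0\<^sup>0\<close> is built from Cauchy sequences modulo null sequences.\<close>

definition H00 :: "'k set \<Rightarrow> ('k \<Rightarrow> 'h::chilbert_space) \<Rightarrow> 'h set"
  where "H00 K \<psi> = {\<Sum>k\<in>{k. c k \<noteq> 0}. c k *\<^sub>C \<psi> k | c. c \<in> fin_seqs K}"

definition coorbit_seqs ::
    "'k set \<Rightarrow> ('k \<Rightarrow> 'h::chilbert_space) \<Rightarrow> ennreal \<Rightarrow> ('k \<Rightarrow> real) \<Rightarrow> (nat \<Rightarrow> 'h) set"
  where "coorbit_seqs K \<psi> p w =
    (if p = \<infinity> then
       {f. (\<forall>k\<in>K. convergent (\<lambda>n. cinner (f n) (dual_frame K \<psi> k))) \<and>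
           (\<forall>n. analysis K (dual_frame K \<psi>) (f n) \<in> ell K \<infinity> w) \<and>
           bdd_above (range (\<lambda>n. ell_norm K \<infinity> w (analysis K (dual_frame K \<psi>) (f n))))}
     else
       {f. (\<forall>n. f n \<in> H00 K \<psi>) \<and>
           (\<forall>e>0. \<exists>N. \<forall>m\<ge>N. \<forall>n\<ge>N.
              ell_norm K p w (analysis K (dual_frame K \<psi>) (f m - f n)) < e)})"

definition coorbit_rel ::
    "'k set \<Rightarrow> ('k \<Rightarrow> 'h::chilbert_space) \<Rightarrow> ennreal \<Rightarrow> ('k \<Rightarrow> real)
      \<Rightarrow> ((nat \<Rightarrow> 'h) \<times> (nat \<Rightarrow> 'h)) set"
  where "coorbit_rel K \<psi> p w =
    {(f, g). f \<in> coorbit_seqs K \<psi> p w \<and> g \<in> coorbit_seqs K \<psi> p w \<and>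
       (if p = \<infinity> then
          \<forall>k\<in>K. (\<lambda>n. cinner (f n - g n) (dual_frame K \<psi> k)) \<longlonglongrightarrow> 0
        else
          (\<lambda>n. ell_norm K p w (analysis K (dual_frame K \<psi>) (f n - g n))) \<longlonglongrightarrow> 0)}"

definition coorbit ::
    "'k set \<Rightarrow> ('k \<Rightarrow> 'h::chilbert_space) \<Rightarrow> ennreal \<Rightarrow> ('k \<Rightarrow> real) \<Rightarrow> (nat \<Rightarrow> 'h) set set"
  where "coorbit K \<psi> p w = coorbit_seqs K \<psi> p w // coorbit_rel K \<psi> p w"

definition rep :: "(nat \<Rightarrow> 'h) set \<Rightarrow> nat \<Rightarrow> 'h"
  where "rep F = (SOME f. f \<in> F)"

definition coorbit_add ::
    "'k set \<Rightarrow> ('k \<Rightarrow> 'h::chilbert_space) \<Rightarrow> ennreal \<Rightarrow> ('k \<Rightarrow> real)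
      \<Rightarrow> (nat \<Rightarrow> 'h) set \<Rightarrow> (nat \<Rightarrow> 'h) set \<Rightarrow> (nat \<Rightarrow> 'h) set"
  where "coorbit_add K \<psi> p w F G = coorbit_rel K \<psi> p w `` {\<lambda>n. rep F n + rep G n}"

definition coorbit_scale ::
    "'k set \<Rightarrow> ('k \<Rightarrow> 'h::chilbert_space) \<Rightarrow> ennreal \<Rightarrow> ('k \<Rightarrow> real)
      \<Rightarrow> complex \<Rightarrow> (nat \<Rightarrow> 'h) set \<Rightarrow> (nat \<Rightarrow> 'h) set"
  where "coorbit_scale K \<psi> p w a F = coorbit_rel K \<psi> p w `` {\<lambda>n. a *\<^sub>C rep F n}"

definition coorbit_diff ::
    "'k set \<Rightarrow> ('k \<Rightarrow> 'h::chilbert_space) \<Rightarrow> ennreal \<Rightarrow> ('k \<Rightarrow> real)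
      \<Rightarrow> (nat \<Rightarrow> 'h) set \<Rightarrow> (nat \<Rightarrow> 'h) set \<Rightarrow> (nat \<Rightarrow> 'h) set"
  where "coorbit_diff K \<psi> p w F G = coorbit_add K \<psi> p w F (coorbit_scale K \<psi> p w (-1) G)"

text \<open>The extension of the coefficient map of the dual frame to classes.\<close>

definition coef ::
    "'k set \<Rightarrow> ('k \<Rightarrow> 'h::chilbert_space) \<Rightarrow> (nat \<Rightarrow> 'h) set \<Rightarrow> 'k \<Rightarrow> complex"
  where "coef K \<psi> F k = (if k \<in> K then lim (\<lambda>n. cinner (rep F n) (dual_frame K \<psi> k)) else 0)"

definition coorbit_norm ::
    "'k set \<Rightarrow> ('k \<Rightarrow> 'h::chilbert_space) \<Rightarrow> ennreal \<Rightarrow> ('k \<Rightarrow> real) \<Rightarrow> (nat \<Rightarrow> 'h) set \<Rightarrow> real"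
  where "coorbit_norm K \<psi> p w F =
    (if p = \<infinity> then ell_norm K \<infinity> w (coef K \<psi> F)
     else lim (\<lambda>n. ell_norm K p w (analysis K (dual_frame K \<psi>) (rep F n))))"

text \<open>A vector \<open>h\<close> of the Hilbert space, viewed as the element of \<open>\<H>\<^sup>p\<^sub>w\<close> that has the same
  coefficient sequence. This is only used for frame elements and their finite linear
  combinations. Constant sequences do not suffice, because for finite \<open>p\<close> the vector \<open>h\<close>
  need not lie in \<open>\<H>\<^sup>0\<^sup>0\<close>.\<close>

definition coorbit_embed ::
    "'k set \<Rightarrow> ('k \<Rightarrow> 'h::chilbert_space) \<Rightarrow> ennreal \<Rightarrow> ('k \<Rightarrow> real) \<Rightarrow> 'h \<Rightarrow> (nat \<Rightarrow> 'h) set"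
  where "coorbit_embed K \<psi> p w h =
    (THE F. F \<in> coorbit K \<psi> p w \<and> coef K \<psi> F = analysis K (dual_frame K \<psi>) h)"

text \<open>The pairing of \<open>F \<in> \<H>\<^sup>p\<^sub>w\<close> with \<open>G \<in> \<H>\<^sup>q\<^bsub>1/w\<^esub>\<close>; the formula does not involve
  \<open>p\<close>, \<open>q\<close> and \<open>w\<close>.\<close>

definition pairing ::
    "'k set \<Rightarrow> ('k \<Rightarrow> 'h::chilbert_space) \<Rightarrow> (nat \<Rightarrow> 'h) set \<Rightarrow> (nat \<Rightarrow> 'h) set \<Rightarrow> complex"
  where "pairing K \<psi> F G =
    (\<Sum>\<^sub>\<infinity>k\<in>K. coef K \<psi> F k * cnj (mat_vec K (gram K \<psi> \<psi>) (coef K \<psi> G) k))"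


section \<open>Analysis, synthesis and Galerkin operators\<close>

definition coorbit_analysis ::
    "'k set \<Rightarrow> ('k \<Rightarrow> 'h::chilbert_space) \<Rightarrow> ennreal \<Rightarrow> ('k \<Rightarrow> real) \<Rightarrow> ('k \<Rightarrow> 'h)
      \<Rightarrow> (nat \<Rightarrow> 'h) set \<Rightarrow> 'k \<Rightarrow> complex"
  where "coorbit_analysis K \<psi> p w \<phi> F k =
    (if k \<in> K then
       pairing K \<psi> F (coorbit_embed K \<psi> (conj_exp p) (\<lambda>j. 1 / w j) (\<phi> k))
     else 0)"

definition coorbit_ran ::
    "'k set \<Rightarrow> ('k \<Rightarrow> 'h::chilbert_space) \<Rightarrow> ennreal \<Rightarrow> ('k \<Rightarrow> real) \<Rightarrow> ('k \<Rightarrow> 'h)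
      \<Rightarrow> ('k \<Rightarrow> complex) set"
  where "coorbit_ran K \<psi> p w \<phi> = coorbit_analysis K \<psi> p w \<phi> ` coorbit K \<psi> p w"

text \<open>The sum of \<open>c k *\<^sub>C \<phi> k\<close> over \<open>K\<close>, convergent in norm for finite \<open>p\<close> and in the topology
  \<open>\<sigma>(\<H>\<^sup>\<infinity>\<^sub>w, \<H>\<^sup>1\<^bsub>1/w\<^esub>)\<close> for \<open>p = \<infinity>\<close>.\<close>

definition coorbit_synthesis ::
    "'k set \<Rightarrow> ('k \<Rightarrow> 'h::chilbert_space) \<Rightarrow> ennreal \<Rightarrow> ('k \<Rightarrow> real) \<Rightarrow> ('k \<Rightarrow> 'h)
      \<Rightarrow> ('k \<Rightarrow> complex) \<Rightarrow> (nat \<Rightarrow> 'h) set"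
  where "coorbit_synthesis K \<psi> p w \<phi> c =
    (THE F. F \<in> coorbit K \<psi> p w \<and>
       (if p = \<infinity> then
          \<forall>G\<in>coorbit K \<psi> 1 (\<lambda>j. 1 / w j).
            ((\<lambda>S. pairing K \<psi> (coorbit_embed K \<psi> p w (\<Sum>k\<in>S. c k *\<^sub>C \<phi> k)) G)
              \<longlongrightarrow> pairing K \<psi> F G) (finite_subsets_at_top K)
        else
          ((\<lambda>S. coorbit_norm K \<psi> p w
                 (coorbit_diff K \<psi> p w F (coorbit_embed K \<psi> p w (\<Sum>k\<in>S. c k *\<^sub>C \<phi> k))))
            \<longlongrightarrow> 0) (finite_subsets_at_top K)))"

definition coorbit_bounded_linear ::
    "'k set \<Rightarrow> ('k \<Rightarrow> 'h::chilbert_space) \<Rightarrow> ennreal \<Rightarrow> ('k \<Rightarrow> real) \<Rightarrow> ennreal \<Rightarrow> ('k \<Rightarrow> real)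
      \<Rightarrow> ((nat \<Rightarrow> 'h) set \<Rightarrow> (nat \<Rightarrow> 'h) set) \<Rightarrow> bool"
  where "coorbit_bounded_linear K \<psi> p1 w1 p2 w2 T \<longleftrightarrow>
    (\<forall>F\<in>coorbit K \<psi> p1 w1. T F \<in> coorbit K \<psi> p2 w2) \<and>
    (\<forall>F\<in>coorbit K \<psi> p1 w1. \<forall>G\<in>coorbit K \<psi> p1 w1.
       T (coorbit_add K \<psi> p1 w1 F G) = coorbit_add K \<psi> p2 w2 (T F) (T G)) \<and>
    (\<forall>a. \<forall>F\<in>coorbit K \<psi> p1 w1.
       T (coorbit_scale K \<psi> p1 w1 a F) = coorbit_scale K \<psi> p2 w2 a (T F)) \<and>
    (\<exists>C. \<forall>F\<in>coorbit K \<psi> p1 w1. coorbit_norm K \<psi> p2 w2 (T F) \<le> C * coorbit_norm K \<psi> p1 w1 F)"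

text \<open>The entries of the Galerkin matrix are pairings of \<open>\<H>\<^sup>p\<^sub>w\<close> and \<open>\<H>\<^sup>q\<^bsub>1/w\<^esub>\<close> for
  \<open>(p, w) = (p2, w2)\<close>. The matrix is regarded as the operator \<open>galerkin\<close> defined below, that is,
  \<open>C\<^sub>\<phi> \<circ> T \<circ> D\<^sub>\<xi>\<close>. For \<open>p1 = \<infinity>\<close> this need not be multiplication by the matrix, because \<open>T\<close>
  need not be weak-* continuous.\<close>

definition galerkin_matrix ::
    "'k set \<Rightarrow> ('k \<Rightarrow> 'h::chilbert_space) \<Rightarrow> ennreal \<Rightarrow> ('k \<Rightarrow> real) \<Rightarrow> ennreal \<Rightarrow> ('k \<Rightarrow> real)
      \<Rightarrow> ('k \<Rightarrow> 'h) \<Rightarrow> ('k \<Rightarrow> 'h) \<Rightarrow> ((nat \<Rightarrow> 'h) set \<Rightarrow> (nat \<Rightarrow> 'h) set)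
      \<Rightarrow> 'k \<Rightarrow> 'k \<Rightarrow> complex"
  where "galerkin_matrix K \<psi> p1 w1 p2 w2 \<phi> \<xi> T k l =
    (if k \<in> K \<and> l \<in> K then
       pairing K \<psi> (T (coorbit_embed K \<psi> p1 w1 (\<xi> l)))
         (coorbit_embed K \<psi> (conj_exp p2) (\<lambda>j. 1 / w2 j) (\<phi> k))
     else 0)"

definition galerkin ::
    "'k set \<Rightarrow> ('k \<Rightarrow> 'h::chilbert_space) \<Rightarrow> ennreal \<Rightarrow> ('k \<Rightarrow> real) \<Rightarrow> ennreal \<Rightarrow> ('k \<Rightarrow> real)
      \<Rightarrow> ('k \<Rightarrow> 'h) \<Rightarrow> ('k \<Rightarrow> 'h) \<Rightarrow> ((nat \<Rightarrow> 'h) set \<Rightarrow> (nat \<Rightarrow> 'h) set)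
      \<Rightarrow> ('k \<Rightarrow> complex) \<Rightarrow> 'k \<Rightarrow> complex"
  where "galerkin K \<psi> p1 w1 p2 w2 \<phi> \<xi> T =
    coorbit_analysis K \<psi> p2 w2 \<phi> \<circ> T \<circ> coorbit_synthesis K \<psi> p1 w1 \<xi>"

lemma galerkin_unit_sequence:
  assumes "coorbit_synthesis K \<psi> p1 w1 \<xi> (\<lambda>j. mat_id K j l) = coorbit_embed K \<psi> p1 w1 (\<xi> l)"
    and "l \<in> K"
  shows "galerkin K \<psi> p1 w1 p2 w2 \<phi> \<xi> T (\<lambda>j. mat_id K j l) =
    (\<lambda>k. galerkin_matrix K \<psi> p1 w1 p2 w2 \<phi> \<xi> T k l)"
  using assms by (auto simp: galerkin_def galerkin_matrix_def coorbit_analysis_def)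

end

theory Submission
  imports Defs
begin

text \<open>
  Taking coefficients identifies \<open>\<H>\<^sup>p\<^sub>w\<close> with \<open>V = {c \<in> \<ell>\<^sup>p\<^sub>w. P c = c}\<close>, where
  \<open>P = G\<^bsub>\<psi>',\<psi>\<^esub>\<close> and \<open>\<psi>'\<close> is the canonical dual frame. Under this identification
  synthesis and analysis become multiplication by cross-Gram matrices, and all identities between them
  reduce to \<open>G\<^bsub>\<xi>,\<psi>\<^esub> G\<^bsub>\<psi>',\<eta>\<^esub> = G\<^bsub>\<xi>,\<eta>\<^esub>\<close>. Thus \<open>D\<^bsub>\<Psi>\<^esub>\<close> is a bijection
  from \<open>ran C\<^bsub>\<Psi>\<^esub> = V\<close> onto the coorbit space, and \<open>C\<^bsub>\<Phi>\<^esub>\<close> is one onto its range with inverse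
  \<open>D\<^bsub>\<Phi>'\<^esub>\<close>, so \<open>C\<^bsub>\<Phi>\<^esub> \<circ> T \<circ> D\<^bsub>\<Psi>\<^esub>\<close> is bijective exactly if \<open>T\<close> is.

  For the matrices to act on \<open>\<ell>\<^sup>p\<^sub>w\<close>, the Gram matrices of the dual frames must lie in the
  algebra. The projection \<open>P\<close> is obtained as a Riesz projection: averages of resolvents over roots
  of unity lie in the algebra by inverse closedness, and they converge to \<open>P\<close> in its norm. On
  \<open>\<ell>\<^sup>p\<^sub>w\<close> and on the dual space \<open>\<ell>\<^sup>q\<^bsub>1/w\<^esub>\<close> the matrices are bounded by Schur's test, whose
  row and column conditions follow from admissibility at \<open>p = \<infinity>\<close> and \<open>p = 1\<close> and are
  interchanged by taking adjoints and reciprocal weights.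
\<close>

section \<open>Complex inner product spaces\<close>

text \<open>Inverse closedness says nothing about the Gram matrix G of \<open>\<psi>\<close> itself:
  it annihilates the kernel of \<open>D\<close> and so is not invertible on ell^2 unless that kernel
  is trivial. What helps is a spectral gap. For a suitable t > 0 the matrix R = 1 - t G is the
  identity on the kernel of \<open>D\<close>, and on the range of \<open>C\<close> it corresponds to
  1 - t S, a contraction with factor r < 1. If rho lies strictly between 1 and 1/r, then 1 - z R is
  invertible whenever |z| = rho, and as N grows the inverse of 1 - rho^N R^N tends to 0 on the
  kernel of \<open>D\<close> and to the identity on the range of \<open>C\<close>. These inverses
  are finite averages of resolvents; doubling N at each stage gives increments that decay
  geometrically in the norm of the algebra.

  Schur's test is used instead of the bare operator bounds because sums have to be interchanged and
  bounded entrywise limits have to be taken, in particular for p = \<infinity>, where finite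
  sequences need not be dense. Absolute row and column sums justify both.\<close>

lemma cinner_scaleC_right: "cinner x (a *\<^sub>C y) = cnj a * cinner x y"
  by (metis cinner_commute cinner_scaleC_left complex_cnj_mult)

lemma cinner_scaleR_left: "cinner (r *\<^sub>R x) y = of_real r * cinner x y"
  by (metis cinner_scaleC_left scaleC_of_real)

lemma cinner_minus_left: "cinner (- x) y = - cinner x y"
  using cinner_scaleR_left[of "-1" x y] by simp

lemma cinner_diff_left: "cinner (x - y) z = cinner x z - cinner y z"
  by (metis cinner_add_left cinner_minus_left diff_conv_add_uminus)

lemma cinner_zero_left [simp]: "cinner 0 x = 0"
  using cinner_scaleR_left[of 0 x] by simp

lemma cinner_self: "cinner x x = of_real ((norm x)\<^sup>2)"
proof (rule complex_eqI)
  have "Im (cinner x x) = - Im (cinner x x)"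
    by (metis cinner_commute cnj.simps(2))
  then show "Im (cinner x x) = Im (complex_of_real ((norm x)\<^sup>2))" by simp
qed (simp add: Re_cinner power2_norm_eq_inner)

lemma scaleC_0_left [simp]: "0 *\<^sub>C x = 0"
  using scaleC_of_real[of 0 x] by simp

lemma scaleC_1_left [simp]: "1 *\<^sub>C x = x"
  using scaleC_of_real[of 1 x] by simp

lemma scaleC_minus1_left: "(-1) *\<^sub>C x = - x"
  using scaleC_of_real[of "-1" x] by simp

lemma scaleC_minus_right: "a *\<^sub>C (- x) = - (a *\<^sub>C x)"
  by (metis scaleC_minus1_left scaleC_scaleC mult.commute)

lemma scaleC_diff_right: "a *\<^sub>C (x - y) = a *\<^sub>C x - a *\<^sub>C y"
  by (metis diff_conv_add_uminus scaleC_add_right scaleC_minus_right)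

lemma scaleC_diff_left: "(a - b) *\<^sub>C x = a *\<^sub>C x - b *\<^sub>C x"
  by (metis add_diff_cancel_right' diff_add_cancel scaleC_add_left)

lemma norm_scaleC [simp]: "norm (a *\<^sub>C x) = cmod a * norm x"
proof -
  have "complex_of_real ((norm (a *\<^sub>C x))\<^sup>2) = of_real ((cmod a * norm x)\<^sup>2)"
    unfolding cinner_self[symmetric] cinner_scaleC_left cinner_scaleC_right
    by (simp add: cinner_self power_mult_distrib complex_norm_square[of a, symmetric] mult_ac)
  then have "(norm (a *\<^sub>C x))\<^sup>2 = (cmod a * norm x)\<^sup>2"
    using of_real_eq_iff by blast
  then show ?thesis
    by (simp add: power2_eq_iff_nonneg)
qed

text \<open>Multiplying \<open>x\<close> by a unimodular constant makes the complex inner product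
  real and nonnegative, so the Cauchy-Schwarz inequality of the real inner product applies.\<close>

lemma cmod_cinner_le: "cmod (cinner x y) \<le> norm x * norm y"
proof (cases "cinner x y = 0")
  case False
  define a where "a = cnj (cinner x y) / cmod (cinner x y)"
  have "cinner (a *\<^sub>C x) y = cmod (cinner x y)"
    using False complex_norm_square[of "cinner x y"]
    by (simp add: cinner_scaleC_left a_def divide_simps mult_ac power2_eq_square)
  then have "cmod (cinner x y) = inner (a *\<^sub>C x) y"
    by (metis Re_cinner Re_complex_of_real)
  also have "\<dots> \<le> norm (a *\<^sub>C x) * norm y"
    by (rule norm_cauchy_schwarz)
  also have "\<dots> = norm x * norm y"
    using False by (simp add: a_def norm_divide)
  finally show ?thesis .
qed simp

lemma cinner_sum_left: "cinner (sum f S) y = (\<Sum>x\<in>S. cinner (f x) y)"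
  by (induction S rule: infinite_finite_induct) (auto simp: cinner_add_left)

lemma cinner_right_eqI: "(\<And>g. cinner x g = cinner y g) \<Longrightarrow> x = y"
  by (metis cinner_diff_left cinner_self eq_iff_diff_eq_0 norm_eq_zero of_real_eq_0_iff
      zero_eq_power2)

lemma bounded_linear_cinner_left: "bounded_linear (\<lambda>x::'a::complex_inner. cinner x y)"
  by (rule bounded_linear_intro[where K = "norm y"])
    (auto simp: cinner_add_left cinner_scaleR_left scaleR_conv_of_real cmod_cinner_le)

instance chilbert_space \<subseteq> banach ..

text \<open>Cauchy criterion for unconditional sums: outside a large finite set every finite piece
  of \<open>f\<close> is small because the matching piece of the convergent series \<open>g\<close>
  is. Only finite sums are estimated, which is what the Bessel bound for synthesis delivers before
  convergence is known.\<close>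

lemma summable_on_square_bound:
  fixes f :: "'k \<Rightarrow> 'a::banach" and g :: "'k \<Rightarrow> real"
  assumes g: "g summable_on A" "\<And>x. 0 \<le> g x"
    and le: "\<And>S. \<lbrakk>finite S; S \<subseteq> A\<rbrakk> \<Longrightarrow> (norm (sum f S))\<^sup>2 \<le> b * sum g S"
  shows "f summable_on A"
proof -
  have "\<exists>P. eventually P (finite_subsets_at_top A) \<and>
              (\<forall>F F'. P F \<and> P F' \<longrightarrow> dist (sum f F) (sum f F') < e)" if "e > 0" for e
  proof -
    \<comment> \<open>Chosen so that \<open>(\<bar>b\<bar> + 1) * d\<close> equals
      \<open>(e / 2)\<^sup>2\<close>; the sign of \<open>b\<close> is unknown.\<close>
    define d where "d = (e / 2)\<^sup>2 / (\<bar>b\<bar> + 1)"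
    have d: "d > 0" using that by (auto simp: d_def)
    obtain F0 where F0: "finite F0" "F0 \<subseteq> A" "dist (sum g F0) (infsum g A) < d / 2"
      using infsum_finite_approximation[OF g(1), of "d / 3"] d by force
    have *: "dist (sum f F) (sum f F0) < e / 2" if F: "finite F" "F0 \<subseteq> F" "F \<subseteq> A" for F
    proof -
      have "sum g F \<le> infsum g A"
        using F g by (intro finite_sum_le_infsum) auto
      then have "sum g (F - F0) < d"
        using F0 F d by (subst sum_diff) (auto simp: dist_real_def abs_if split: if_splits)
      then have "(\<bar>b\<bar> + 1) * sum g (F - F0) < (\<bar>b\<bar> + 1) * d"
        by (intro mult_strict_left_mono) auto
      moreover have "b * sum g (F - F0) \<le> (\<bar>b\<bar> + 1) * sum g (F - F0)"
        using g(2) by (intro mult_right_mono sum_nonneg) auto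
      moreover have "(norm (sum f (F - F0)))\<^sup>2 \<le> b * sum g (F - F0)"
        using F by (intro le) auto
      ultimately have "(norm (sum f (F - F0)))\<^sup>2 < (e / 2)\<^sup>2"
        unfolding d_def by simp
      then have "norm (sum f (F - F0)) < e / 2"
        by (rule power2_less_imp_less) (use \<open>e > 0\<close> in auto)
      moreover have "sum f (F - F0) = sum f F - sum f F0"
        using F F0 by (intro sum_diff) auto
      ultimately show ?thesis
        by (simp add: dist_norm)
    qed
    show ?thesis
    proof (intro exI conjI allI impI)
      show "\<forall>\<^sub>F F in finite_subsets_at_top A. finite F \<and> F0 \<subseteq> F \<and> F \<subseteq> A"
        using F0 by (auto simp: eventually_finite_subsets_at_top)
      fix F F' assume "(finite F \<and> F0 \<subseteq> F \<and> F \<subseteq> A) \<and> (finite F' \<and> F0 \<subseteq> F' \<and> F' \<subseteq> A)"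
      then show "dist (sum f F) (sum f F') < e"
        using *[of F] *[of F'] dist_triangle2[of "sum f F" "sum f F'" "sum f F0"] by auto
    qed
  qed
  then have "cauchy_filter (filtermap (sum f) (finite_subsets_at_top A))"
    by (simp add: cauchy_filter_metric_filtermap)
  moreover have "complete (UNIV :: 'a set)"
    by (meson Cauchy_convergent UNIV_I complete_def convergent_def)
  ultimately obtain L where "(sum f \<longlongrightarrow> L) (finite_subsets_at_top A)"
    using complete_uniform[where S = UNIV] by (force simp add: filterlim_def)
  then show ?thesis
    using summable_on_def has_sum_def by blast
qed

section \<open>Square summable sequences\<close>

abbreviation ell2 :: "'k set \<Rightarrow> ('k \<Rightarrow> complex) set"
  where "ell2 K \<equiv> ell K 2 (\<lambda>_. 1)"

lemma ell2_iff: "c \<in> ell2 K \<longleftrightarrow> c \<in> seqs_on K \<and> (\<lambda>k. (cmod (c k))\<^sup>2) summable_on K"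
  by (simp add: ell_def)

lemma ell2_add:
  assumes "c \<in> ell2 K" "d \<in> ell2 K"
  shows "(\<lambda>k. c k + d k) \<in> ell2 K"
proof -
  have "(\<lambda>k. 2 * (cmod (c k))\<^sup>2 + 2 * (cmod (d k))\<^sup>2) summable_on K"
    using assms by (intro summable_on_add summable_on_cmult_right) (auto simp: ell2_iff)
  then have "(\<lambda>k. (cmod (c k + d k))\<^sup>2) summable_on K"
  proof (rule summable_on_comparison_test)
    fix k
    have "(cmod (c k + d k))\<^sup>2 \<le> (cmod (c k) + cmod (d k))\<^sup>2"
      by (intro power_mono norm_triangle_ineq) auto
    also have "\<dots> \<le> 2 * (cmod (c k))\<^sup>2 + 2 * (cmod (d k))\<^sup>2"
      using sum_squares_bound[of "cmod (c k)" "cmod (d k)"] by (simp add: power2_sum)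
    finally show "(cmod (c k + d k))\<^sup>2 \<le> 2 * (cmod (c k))\<^sup>2 + 2 * (cmod (d k))\<^sup>2" .
  qed auto
  then show ?thesis using assms by (auto simp: ell2_iff seqs_on_def)
qed

lemma ell2_scale: "c \<in> ell2 K \<Longrightarrow> (\<lambda>k. a * c k) \<in> ell2 K"
  by (auto simp: ell2_iff seqs_on_def norm_mult power_mult_distrib intro!: summable_on_cmult_right)

lemma ell2_diff: "c \<in> ell2 K \<Longrightarrow> d \<in> ell2 K \<Longrightarrow> (\<lambda>k. c k - d k) \<in> ell2 K"
  using ell2_add[of c K "\<lambda>k. (-1) * d k"] ell2_scale[of d K "-1"] by simp

definition unit_seq :: "'k \<Rightarrow> 'k \<Rightarrow> complex"
  where "unit_seq l k = (if k = l then 1 else 0)"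

lemma unit_seq_fin: "l \<in> K \<Longrightarrow> unit_seq l \<in> fin_seqs K"
  by (auto simp: fin_seqs_def seqs_on_def unit_seq_def)

lemma fin_seqs_ell2: "c \<in> fin_seqs K \<Longrightarrow> c \<in> ell2 K"
proof -
  assume c: "c \<in> fin_seqs K"
  have "finite {k\<in>K. (cmod (c k))\<^sup>2 \<noteq> 0}"
    using c by (auto simp: fin_seqs_def intro: finite_subset[rotated])
  then show ?thesis
    using c by (auto simp: ell2_iff fin_seqs_def intro: finite_nonzero_values_imp_summable_on)
qed

lemma mat_vec_unit_seq:
  assumes "l \<in> K" "A \<in> mats_on K"
  shows "mat_vec K A (unit_seq l) = (\<lambda>k. A k l)"
proof
  fix k
  have "(\<Sum>\<^sub>\<infinity>j\<in>K. A k j * unit_seq l j) = (\<Sum>\<^sub>\<infinity>j\<in>{l}. A k j * unit_seq l j)"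
    using assms by (intro infsum_cong_neutral) (auto simp: unit_seq_def)
  then show "mat_vec K A (unit_seq l) k = A k l"
    using assms by (auto simp: mat_vec_def unit_seq_def mats_on_def)
qed

section \<open>Frames\<close>

locale frame =
  fixes K :: "'k set" and \<psi> :: "'k \<Rightarrow> 'h::chilbert_space"
  assumes is_frame: "is_frame K \<psi>"
begin

abbreviation "S \<equiv> frame_operator K \<psi>"
abbreviation "\<psi>' \<equiv> dual_frame K \<psi>"
abbreviation "D \<equiv> synthesis K \<psi>"
abbreviation "C \<equiv> analysis K \<psi>"

lemma analysis_ell2: "C f \<in> ell2 K"
proof -
  have "(\<lambda>k. (cmod (cinner f (\<psi> k)))\<^sup>2) summable_on K"
    using is_frame by (auto simp: is_frame_def)
  then have "(\<lambda>k. (cmod (C f k))\<^sup>2) summable_on K"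
    by (rule summable_on_cong[THEN iffD1, rotated]) (auto simp: analysis_def)
  then show ?thesis by (auto simp: ell2_iff seqs_on_def analysis_def)
qed

lemma frame_bounds:
  obtains a b where "0 < a" "a < b"
    "\<And>f. a * (norm f)\<^sup>2 \<le> (\<Sum>\<^sub>\<infinity>k\<in>K. (cmod (C f k))\<^sup>2)"
    "\<And>f. (\<Sum>\<^sub>\<infinity>k\<in>K. (cmod (C f k))\<^sup>2) \<le> b * (norm f)\<^sup>2"
proof -
  have C: "(\<Sum>\<^sub>\<infinity>k\<in>K. (cmod (C f k))\<^sup>2) = (\<Sum>\<^sub>\<infinity>k\<in>K. (cmod (cinner f (\<psi> k)))\<^sup>2)" for f
    by (intro infsum_cong) (auto simp: analysis_def)
  obtain a b where ab: "0 < a" "0 < b"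
    "\<And>f. a * (norm f)\<^sup>2 \<le> (\<Sum>\<^sub>\<infinity>k\<in>K. (cmod (cinner f (\<psi> k)))\<^sup>2)"
    "\<And>f. (\<Sum>\<^sub>\<infinity>k\<in>K. (cmod (cinner f (\<psi> k)))\<^sup>2) \<le> b * (norm f)\<^sup>2"
    using is_frame unfolding is_frame_def by blast
  have "b * (norm f)\<^sup>2 \<le> (a + b) * (norm f)\<^sup>2" for f :: 'h
    using ab by (intro mult_right_mono) auto
  then show thesis
    using ab by (intro that[of a "a + b"]) (auto simp: C intro: order_trans)
qed

text \<open>Duality with the Bessel bound: a finite sum \<open>v\<close> is paired with itself, and
  Cauchy-Schwarz bounds the square of its norm by the norms of \<open>c\<close> and
  \<open>C v\<close>. As \<open>C v\<close> is controlled by \<open>norm v\<close>, this factor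
  cancels.\<close>

lemma synthesis_bound_ex:
  "\<exists>b>0. \<forall>c\<in>ell2 K. (\<lambda>k. c k *\<^sub>C \<psi> k) summable_on K \<and>
     (norm (D c))\<^sup>2 \<le> b * (\<Sum>\<^sub>\<infinity>k\<in>K. (cmod (c k))\<^sup>2)"
proof -
  obtain b where b: "0 < b" "\<And>f. (\<Sum>\<^sub>\<infinity>k\<in>K. (cmod (C f k))\<^sup>2) \<le> b * (norm f)\<^sup>2"
    by (metis frame_bounds less_trans)
  have fin: "(norm (\<Sum>k\<in>F. c k *\<^sub>C \<psi> k))\<^sup>2 \<le> b * (\<Sum>k\<in>F. (cmod (c k))\<^sup>2)"
    if F: "finite F" "F \<subseteq> K" for F c
  proof -
    define v where "v = (\<Sum>k\<in>F. c k *\<^sub>C \<psi> k)"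
    have "(norm v)\<^sup>2 = cmod (cinner v v)"
      by (simp add: cinner_self norm_power)
    also have "cinner v v = (\<Sum>k\<in>F. c k * cinner (\<psi> k) v)"
      by (subst (1) v_def) (simp add: cinner_sum_left cinner_scaleC_left)
    also have "cmod \<dots> \<le> (\<Sum>k\<in>F. cmod (c k) * cmod (C v k))"
    proof (rule sum_norm_le)
      fix k assume "k \<in> F"
      then show "cmod (c k * cinner (\<psi> k) v) \<le> cmod (c k) * cmod (C v k)"
        using F by (subst cinner_commute) (auto simp: analysis_def norm_mult)
    qed
    finally have "((norm v)\<^sup>2)\<^sup>2 \<le> (\<Sum>k\<in>F. cmod (c k) * cmod (C v k))\<^sup>2"
      by (rule power_mono) auto
    also have "\<dots> \<le> (\<Sum>k\<in>F. (cmod (c k))\<^sup>2) * (\<Sum>k\<in>F. (cmod (C v k))\<^sup>2)"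
      by (rule Cauchy_Schwarz_ineq_sum)
    also have "\<dots> \<le> (\<Sum>k\<in>F. (cmod (c k))\<^sup>2) * (b * (norm v)\<^sup>2)"
    proof (intro mult_left_mono sum_nonneg)
      have "(\<Sum>k\<in>F. (cmod (C v k))\<^sup>2) \<le> (\<Sum>\<^sub>\<infinity>k\<in>K. (cmod (C v k))\<^sup>2)"
        using F analysis_ell2 by (intro finite_sum_le_infsum) (auto simp: ell2_iff)
      then show "(\<Sum>k\<in>F. (cmod (C v k))\<^sup>2) \<le> b * (norm v)\<^sup>2"
        using b(2) order_trans by blast
    qed auto
    finally have *: "(norm v)\<^sup>2 * (norm v)\<^sup>2 \<le> (norm v)\<^sup>2 * (b * (\<Sum>k\<in>F. (cmod (c k))\<^sup>2))"
      by (simp add: power2_eq_square mult_ac)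
    show ?thesis
    proof (cases "v = 0")
      case False
      then show ?thesis using * unfolding v_def[symmetric]
        by (subst (asm) mult_le_cancel_left_pos) auto
    qed (use b in \<open>auto simp: v_def[symmetric] intro!: mult_nonneg_nonneg sum_nonneg\<close>)
  qed
  have "(\<lambda>k. c k *\<^sub>C \<psi> k) summable_on K \<and> (norm (D c))\<^sup>2 \<le> b * (\<Sum>\<^sub>\<infinity>k\<in>K. (cmod (c k))\<^sup>2)"
    if c: "c \<in> ell2 K" for c
  proof
    show *: "(\<lambda>k. c k *\<^sub>C \<psi> k) summable_on K"
      by (rule summable_on_square_bound[where g = "\<lambda>k. (cmod (c k))\<^sup>2"])
        (use c fin in \<open>auto simp: ell2_iff\<close>)
    have "((\<lambda>F. (norm (\<Sum>k\<in>F. c k *\<^sub>C \<psi> k))\<^sup>2) \<longlongrightarrow> (norm (D c))\<^sup>2) (finite_subsets_at_top K)"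
      unfolding synthesis_def by (intro tendsto_intros infsum_tendsto *)
    then show "(norm (D c))\<^sup>2 \<le> b * (\<Sum>\<^sub>\<infinity>k\<in>K. (cmod (c k))\<^sup>2)"
    proof (rule tendsto_upperbound)
      show "\<forall>\<^sub>F F in finite_subsets_at_top K.
          (norm (\<Sum>k\<in>F. c k *\<^sub>C \<psi> k))\<^sup>2 \<le> b * (\<Sum>\<^sub>\<infinity>k\<in>K. (cmod (c k))\<^sup>2)"
      proof (rule eventually_finite_subsets_at_top_weakI)
        fix F assume F: "finite F" "F \<subseteq> K"
        have "(\<Sum>k\<in>F. (cmod (c k))\<^sup>2) \<le> (\<Sum>\<^sub>\<infinity>k\<in>K. (cmod (c k))\<^sup>2)"
          using F c by (intro finite_sum_le_infsum) (auto simp: ell2_iff)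
        then show "(norm (\<Sum>k\<in>F. c k *\<^sub>C \<psi> k))\<^sup>2 \<le> b * (\<Sum>\<^sub>\<infinity>k\<in>K. (cmod (c k))\<^sup>2)"
          using fin[OF F, of c] mult_left_mono[of "\<Sum>k\<in>F. (cmod (c k))\<^sup>2" _ b] b(1)
          by (meson less_imp_le order_trans)
      qed
    qed simp
  qed
  with b show ?thesis by blast
qed

lemma synthesis_has_sum: "c \<in> ell2 K \<Longrightarrow> ((\<lambda>k. c k *\<^sub>C \<psi> k) has_sum D c) K"
  using synthesis_bound_ex unfolding synthesis_def by (metis has_sum_infsum)

lemma cinner_synthesis_has_sum:
  assumes "c \<in> ell2 K"
  shows "((\<lambda>k. c k * cinner (\<psi> k) g) has_sum cinner (D c) g) K"
  using has_sum_bounded_linear[OF bounded_linear_cinner_left synthesis_has_sum[OF assms], of g]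
  by (simp add: cinner_scaleC_left)

text \<open>A weak characterization, by which linearity of \<open>D\<close> follows from linearity
  of scalar sums.\<close>

lemma synthesis_unique:
  assumes "c \<in> ell2 K" "\<And>g. ((\<lambda>k. c k * cinner (\<psi> k) g) has_sum cinner x g) K"
  shows "D c = x"
  by (rule cinner_right_eqI, rule has_sum_unique[OF cinner_synthesis_has_sum[OF assms(1)] assms(2)])

lemma synthesis_add:
  "c \<in> ell2 K \<Longrightarrow> d \<in> ell2 K \<Longrightarrow> D (\<lambda>k. c k + d k) = D c + D d"
  by (intro synthesis_unique ell2_add)
    (auto simp: cinner_add_left algebra_simps intro!: has_sum_add cinner_synthesis_has_sum)

lemma synthesis_scale: "c \<in> ell2 K \<Longrightarrow> D (\<lambda>k. a * c k) = a *\<^sub>C D c"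
  by (intro synthesis_unique ell2_scale)
    (auto simp: cinner_scaleC_left mult.assoc intro!: has_sum_cmult_right cinner_synthesis_has_sum)

lemma synthesis_diff:
  assumes "c \<in> ell2 K" "d \<in> ell2 K"
  shows "D (\<lambda>k. c k - d k) = D c - D d"
  using synthesis_add[OF assms(1) ell2_scale[OF assms(2), of "-1"]]
    synthesis_scale[OF assms(2), of "-1"]
  by (simp add: scaleC_minus1_left)

lemma analysis_diff: "C (f - g) = (\<lambda>k. C f k - C g k)"
  by (auto simp: analysis_def cinner_diff_left)

lemma analysis_scale: "C (a *\<^sub>C f) = (\<lambda>k. a * C f k)"
  by (auto simp: analysis_def cinner_scaleC_left)

lemma frame_operator_diff: "S (f - g) = S f - S g"
  by (simp add: frame_operator_def analysis_diff synthesis_diff analysis_ell2)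

lemma cinner_frame_operator_has_sum:
  "((\<lambda>k. cinner f (\<psi> k) * cinner (\<psi> k) g) has_sum cinner (S f) g) K"
  unfolding frame_operator_def
  by (rule has_sum_cong[THEN iffD1, OF _ cinner_synthesis_has_sum[OF analysis_ell2]])
    (auto simp: analysis_def)

lemma frame_operator_self_adjoint: "cinner (S f) g = cinner f (S g)"
proof -
  have "((\<lambda>k. cnj (cinner g (\<psi> k) * cinner (\<psi> k) f)) has_sum cnj (cinner (S g) f)) K"
    using cinner_frame_operator_has_sum by (simp only: has_sum_cnj_iff)
  then have "((\<lambda>k. cinner f (\<psi> k) * cinner (\<psi> k) g) has_sum cinner f (S g)) K"
    by (simp add: cinner_commute[symmetric] mult.commute)
  then show ?thesis using cinner_frame_operator_has_sum has_sum_unique by blast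
qed

text \<open>The bound \<open>\<parallel>f - t S f\<parallel>\<^sup>2 \<le> (1 - 2 t a + t\<^sup>2 b\<^sup>2) \<parallel>f\<parallel>\<^sup>2\<close> is less than \<open>\<parallel>f\<parallel>\<^sup>2\<close> for small \<open>t\<close>.\<close>

lemma frame_operator_contraction:
  obtains t r where "0 < t" "0 < r" "r < 1" "\<And>f. norm (f - t *\<^sub>R S f) \<le> r * norm f"
proof -
  obtain a a' where a: "0 < a" "a < a'" "\<And>f. a * (norm f)\<^sup>2 \<le> (\<Sum>\<^sub>\<infinity>k\<in>K. (cmod (C f k))\<^sup>2)"
    "\<And>f. (\<Sum>\<^sub>\<infinity>k\<in>K. (cmod (C f k))\<^sup>2) \<le> a' * (norm f)\<^sup>2"
    by (rule frame_bounds) blast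
  obtain b' where b': "0 < b'"
    "\<And>c. c \<in> ell2 K \<Longrightarrow> (norm (D c))\<^sup>2 \<le> b' * (\<Sum>\<^sub>\<infinity>k\<in>K. (cmod (c k))\<^sup>2)"
    using synthesis_bound_ex by blast
  \<comment> \<open>\<open>b' * a'\<close> bounds the square of the norm of \<open>S\<close>; the
    second term of the maximum ensures \<open>a\<^sup>2 < b\<close>, so that the root
    \<open>r\<close> below is positive.\<close>
  define b where "b = max (b' * a') (a\<^sup>2 + 1)"
  have S: "(norm (S f))\<^sup>2 \<le> b * (norm f)\<^sup>2" for f
  proof -
    have "(norm (S f))\<^sup>2 \<le> b' * (\<Sum>\<^sub>\<infinity>k\<in>K. (cmod (C f k))\<^sup>2)"
      unfolding frame_operator_def by (intro b' analysis_ell2)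
    also have "\<dots> \<le> b' * (a' * (norm f)\<^sup>2)"
      using b' a by (intro mult_left_mono) auto
    also have "\<dots> \<le> b * (norm f)\<^sup>2"
      by (simp add: b_def mult.assoc[symmetric] mult_right_mono)
    finally show ?thesis .
  qed
  have inner_S: "a * (norm f)\<^sup>2 \<le> inner f (S f)" for f
  proof -
    have "cinner f (\<psi> k) * cinner (\<psi> k) f = of_real ((cmod (C f k))\<^sup>2)" if "k \<in> K" for k
    proof -
      have "cinner (\<psi> k) f = cnj (cinner f (\<psi> k))" by (rule cinner_commute)
      then show ?thesis using that by (simp add: analysis_def complex_norm_square[symmetric])
    qed
    then have "((\<lambda>k. complex_of_real ((cmod (C f k))\<^sup>2)) has_sum cinner (S f) f) K"
      by (rule has_sum_cong[THEN iffD1, OF _ cinner_frame_operator_has_sum])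
    then have "((\<lambda>k. (cmod (C f k))\<^sup>2) has_sum inner (S f) f) K"
      using has_sum_Re by (fastforce simp: Re_cinner)
    then show ?thesis
      using a(3)[of f] by (simp add: infsumI inner_commute)
  qed
  \<comment> \<open>The minimizer of 1 - 2 t a + t^2 b, where \<open>b\<close> already bounds a
    square; the minimum is 1 - a^2 / b.\<close>
  define t where "t = a / b"
  have "0 \<le> a\<^sup>2" "a\<^sup>2 + 1 \<le> b" by (auto simp: b_def)
  then have b: "0 < b" "a\<^sup>2 < b" by linarith+
  define r where "r = sqrt (1 - a\<^sup>2 / b)"
  have t: "0 < t" using a b by (simp add: t_def)
  have r: "0 < r" "r < 1" using a b by (auto simp: r_def divide_simps)
  have "norm (f - t *\<^sub>R S f) \<le> r * norm f" for f
  proof (rule power2_le_imp_le)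
    have "(norm (f - t *\<^sub>R S f))\<^sup>2 = (norm f)\<^sup>2 - 2 * t * inner f (S f) + t\<^sup>2 * (norm (S f))\<^sup>2"
      unfolding power2_norm_eq_inner
      by (simp add: inner_diff_left inner_diff_right algebra_simps power2_eq_square inner_commute)
    also have "\<dots> \<le> (norm f)\<^sup>2 - 2 * t * (a * (norm f)\<^sup>2) + t\<^sup>2 * (b * (norm f)\<^sup>2)"
      using t S[of f] inner_S[of f] by (intro add_mono diff_mono mult_left_mono) auto
    also have "\<dots> = (1 - a\<^sup>2 / b) * (norm f)\<^sup>2"
      using b by (simp add: t_def field_simps power2_eq_square)
    also have "\<dots> = (r * norm f)\<^sup>2"
      using b by (simp add: r_def power_mult_distrib)
    finally show "(norm (f - t *\<^sub>R S f))\<^sup>2 \<le> (r * norm f)\<^sup>2" .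
  qed (use r in auto)
  with t r show thesis by (intro that)
qed

text \<open>Takes the place of the Neumann series: solutions of \<open>f - U f = h\<close> are the
  fixed points of the contraction sending \<open>f\<close> to \<open>h + U f\<close>.\<close>

lemma contraction_fixed_point:
  fixes U :: "'h \<Rightarrow> 'h"
  assumes "0 \<le> q" "q < 1" "\<And>f. norm (U f) \<le> q * norm f" "\<And>f g. U (f - g) = U f - U g"
  shows "\<exists>!f. f - U f = h"
proof -
  have "\<exists>!f. h + U f = f"
    using assms by (intro banach_fix_type[of q]) (auto simp: dist_norm assms(4)[symmetric])
  then show ?thesis by (metis diff_add_cancel add.commute add_diff_cancel_left')
qed

text \<open>Up to the factor \<open>t\<close>, the frame operator is the identity minus a
  contraction.\<close>

lemma bij_frame_operator: "bij S"
proof -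
  obtain t r where t: "0 < t" "0 < r" "r < 1" "\<And>f. norm (f - t *\<^sub>R S f) \<le> r * norm f"
    by (rule frame_operator_contraction) blast
  have "\<exists>!f. f - (f - t *\<^sub>R S f) = t *\<^sub>R h" for h
    by (rule contraction_fixed_point[where q = r])
      (use t in \<open>auto simp: frame_operator_diff algebra_simps\<close>)
  then have "\<exists>!f. S f = h" for h
    using t(1) by simp
  then show ?thesis by (metis bij_iff)
qed

lemma frame_operator_inv [simp]: "S (inv S f) = f" "inv S (S f) = f"
  using bij_frame_operator by (simp_all add: bij_is_inj bij_is_surj surj_f_inv_f)

lemma inv_frame_operator_self_adjoint: "cinner (inv S f) g = cinner f (inv S g)"
  using frame_operator_self_adjoint[of "inv S f" "inv S g"] by simp

lemma analysis_dual: "analysis K \<psi>' f = C (inv S f)"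
  by (auto simp: analysis_def dual_frame_def inv_frame_operator_self_adjoint)

lemma analysis_dual_ell2: "analysis K \<psi>' f \<in> ell2 K"
  by (simp add: analysis_dual analysis_ell2)

lemma synthesis_analysis_dual: "D (analysis K \<psi>' f) = f"
  by (simp add: analysis_dual flip: frame_operator_def)

text \<open>A Gram matrix is analysis after synthesis. On square summable sequences this turns
  matrix identities into operator identities on the Hilbert space.\<close>

lemma mat_vec_gram:
  assumes "c \<in> ell2 K"
  shows "mat_vec K (gram K \<xi> \<psi>) c = analysis K \<xi> (D c)"
proof
  fix k
  have "(\<Sum>\<^sub>\<infinity>l\<in>K. cinner (\<psi> l) (\<xi> k) * c l) = cinner (D c) (\<xi> k)"
    using cinner_synthesis_has_sum[OF assms] by (simp add: infsumI mult.commute)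
  then show "mat_vec K (gram K \<xi> \<psi>) c k = analysis K \<xi> (D c) k"
    by (auto simp: mat_vec_def gram_def analysis_def intro: infsum_cong[THEN trans])
qed

lemma mat_vec_gram_analysis_dual:
  "mat_vec K (gram K \<xi> \<psi>) (analysis K \<psi>' h) = analysis K \<xi> h"
  by (simp add: mat_vec_gram analysis_dual_ell2 synthesis_analysis_dual)

lemma gram_column: "l \<in> K \<Longrightarrow> (\<lambda>k. gram K \<xi> \<eta> k l) = analysis K \<xi> (\<eta> l)"
  by (auto simp: gram_def analysis_def)

text \<open>The columns of the right factor are the dual coefficients of the vectors
  \<open>\<eta> l\<close>, and synthesis with \<open>\<psi>\<close> recovers these vectors.\<close>

lemma gram_mult: "mat_mult K (gram K \<xi> \<psi>) (gram K \<psi>' \<eta>) = gram K \<xi> \<eta>"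
proof (intro ext)
  fix k l
  show "mat_mult K (gram K \<xi> \<psi>) (gram K \<psi>' \<eta>) k l = gram K \<xi> \<eta> k l"
  proof (cases "k \<in> K \<and> l \<in> K")
    case True
    then have "mat_mult K (gram K \<xi> \<psi>) (gram K \<psi>' \<eta>) k l =
        mat_vec K (gram K \<xi> \<psi>) (\<lambda>m. gram K \<psi>' \<eta> m l) k"
      by (simp add: mat_mult_def mat_vec_def)
    also have "\<dots> = gram K \<xi> \<eta> k l"
      using True by (simp add: gram_column mat_vec_gram_analysis_dual)
        (simp add: analysis_def gram_def)
    finally show ?thesis .
  next
    case False
    then show ?thesis by (auto simp: mat_mult_def gram_def)
  qed
qed

text \<open>Both sides are the matrix of the orthogonal projection onto the range of
  \<open>C\<close>; the equality is self-adjointness of the inverse frame operator.\<close>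

lemma gram_dual_commute: "gram K \<psi> \<psi>' = gram K \<psi>' \<psi>"
  by (auto simp: gram_def fun_eq_iff dual_frame_def inv_frame_operator_self_adjoint)

end

lemma gram_mats: "gram K \<xi> \<eta> \<in> mats_on K"
  by (auto simp: gram_def mats_on_def)

lemma gram_adjoint: "mat_adj (gram K \<xi> \<eta>) = gram K \<eta> \<xi>"
  by (auto simp: mat_adj_def gram_def fun_eq_iff cinner_commute[symmetric])

section \<open>Solid spectral matrix algebras\<close>

lemma mat_vec_scale: "mat_vec K A (\<lambda>k. a * c k) = (\<lambda>k. a * mat_vec K A c k)"
  by (auto simp: mat_vec_def fun_eq_iff mult.left_commute[of _ a] infsum_cmult_right')

lemma mat_vec_mat_scale: "mat_vec K (\<lambda>k l. a * A k l) c = (\<lambda>k. a * mat_vec K A c k)"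
  by (auto simp: mat_vec_def fun_eq_iff mult.assoc infsum_cmult_right')

lemma mat_vec_id: "c \<in> seqs_on K \<Longrightarrow> mat_vec K (mat_id K) c = c"
proof
  fix k assume c: "c \<in> seqs_on K"
  have "(\<Sum>\<^sub>\<infinity>l\<in>K. mat_id K k l * c l) = c k" if "k \<in> K"
  proof -
    have "(\<Sum>\<^sub>\<infinity>l\<in>K. mat_id K k l * c l) = (\<Sum>\<^sub>\<infinity>l\<in>{k}. mat_id K k l * c l)"
      using that by (intro infsum_cong_neutral) (auto simp: mat_id_def)
    then show ?thesis using that by (simp add: mat_id_def)
  qed
  then show "mat_vec K (mat_id K) c k = c k"
    using c by (auto simp: mat_vec_def seqs_on_def)
qed

context solid_spectral_matrix_algebra
begin

lemma diff_mem: "A \<in> \<A> \<Longrightarrow> B \<in> \<A> \<Longrightarrow> (\<lambda>k l. A k l - B k l) \<in> \<A>"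
  using add_mem[of A "\<lambda>k l. (-1) * B k l"] scale_mem[of B "-1"] by simp

lemma row_summable: "A \<in> \<A> \<Longrightarrow> c \<in> ell2 K \<Longrightarrow> k \<in> K \<Longrightarrow> (\<lambda>l. A k l * c l) summable_on K"
  using bounded_ell2 by (auto simp: mat_bounded_def)

lemma mat_vec_ell2: "A \<in> \<A> \<Longrightarrow> c \<in> ell2 K \<Longrightarrow> mat_vec K A c \<in> ell2 K"
  using bounded_ell2 by (auto simp: mat_bounded_def)

lemma mat_vec_add:
  "A \<in> \<A> \<Longrightarrow> c \<in> ell2 K \<Longrightarrow> d \<in> ell2 K \<Longrightarrow>
    mat_vec K A (\<lambda>k. c k + d k) = (\<lambda>k. mat_vec K A c k + mat_vec K A d k)"
  by (auto simp: mat_vec_def fun_eq_iff distrib_left infsum_add row_summable)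

lemma mat_vec_diff:
  assumes "A \<in> \<A>" "c \<in> ell2 K" "d \<in> ell2 K"
  shows "mat_vec K A (\<lambda>k. c k - d k) = (\<lambda>k. mat_vec K A c k - mat_vec K A d k)"
  using mat_vec_add[OF assms(1,2) ell2_scale[OF assms(3), of "-1"]]
  unfolding mat_vec_scale by simp

lemma mat_vec_mat_add:
  "A \<in> \<A> \<Longrightarrow> B \<in> \<A> \<Longrightarrow> c \<in> ell2 K \<Longrightarrow>
    mat_vec K (\<lambda>k l. A k l + B k l) c = (\<lambda>k. mat_vec K A c k + mat_vec K B c k)"
  by (auto simp: mat_vec_def fun_eq_iff distrib_right infsum_add row_summable)

lemma mat_vec_mat_diff:
  assumes "A \<in> \<A>" "B \<in> \<A>" "c \<in> ell2 K"
  shows "mat_vec K (\<lambda>k l. A k l - B k l) c = (\<lambda>k. mat_vec K A c k - mat_vec K B c k)"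
  using mat_vec_mat_add[OF assms(1) scale_mem[OF assms(2), of "-1"] assms(3)]
  unfolding mat_vec_mat_scale by simp

lemma column: "A \<in> \<A> \<Longrightarrow> l \<in> K \<Longrightarrow> mat_vec K A (unit_seq l) = (\<lambda>k. A k l)"
  using mats by (intro mat_vec_unit_seq) auto

lemma column_ell2: "A \<in> \<A> \<Longrightarrow> l \<in> K \<Longrightarrow> (\<lambda>k. A k l) \<in> ell2 K"
  using mat_vec_ell2[of A "unit_seq l"] column[of A l] by (simp add: fin_seqs_ell2 unit_seq_fin)

lemma zero_outside: "A \<in> \<A> \<Longrightarrow> k \<notin> K \<or> l \<notin> K \<Longrightarrow> A k l = 0"
  using mats by (auto simp: mats_on_def)

lemma column_mat_mult:
  assumes "A \<in> \<A>" "l \<in> K"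
  shows "(\<lambda>k. mat_mult K A B k l) = mat_vec K A (\<lambda>k. B k l)"
  using assms by (auto simp: mat_mult_def mat_vec_def fun_eq_iff zero_outside)

lemma mat_eqI:
  assumes "A \<in> \<A>" "B \<in> \<A>" "\<And>l. l \<in> K \<Longrightarrow> (\<lambda>k. A k l) = (\<lambda>k. B k l)"
  shows "A = B"
proof (intro ext)
  show "A k l = B k l" for k l
    using assms(3)[of l] zero_outside[OF assms(1), of k l] zero_outside[OF assms(2), of k l]
    by (cases "l \<in> K") (auto dest: fun_cong)
qed

lemma nrm_diff_commute:
  assumes "A \<in> \<A>" "B \<in> \<A>"
  shows "nrm (\<lambda>k l. A k l - B k l) = nrm (\<lambda>k l. B k l - A k l)"
  using nrm_scale[OF diff_mem[OF assms], of "-1"] by simp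

lemma nrm_triangle_diff:
  assumes "A \<in> \<A>" "B \<in> \<A>" "D \<in> \<A>"
  shows "nrm (\<lambda>k l. A k l - D k l) \<le> nrm (\<lambda>k l. A k l - B k l) + nrm (\<lambda>k l. B k l - D k l)"
  using nrm_triangle[OF diff_mem[OF assms(1,2)] diff_mem[OF assms(2,3)]] by simp

lemma nrm_diff_bound:
  assumes "A \<in> \<A>" "B \<in> \<A>"
  shows "\<bar>nrm A - nrm B\<bar> \<le> nrm (\<lambda>k l. A k l - B k l)"
  using nrm_triangle[OF assms(1) diff_mem[OF assms(2,1)]] nrm_triangle[OF assms(2) diff_mem[OF assms]]
    nrm_diff_commute[OF assms] by simp

text \<open>By solidity the norm controls every entry.\<close>

lemma entry_tendsto:
  assumes X: "\<And>n. X n \<in> \<A>" and A: "A \<in> \<A>"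
    and lim: "((\<lambda>n. nrm (\<lambda>k l. X n k l - A k l)) \<longlongrightarrow> 0) F"
  shows "((\<lambda>n. X n k l) \<longlongrightarrow> A k l) F"
proof (cases "k \<in> K \<and> l \<in> K")
  case False
  then have "X n k l = A k l" for n using zero_outside[OF X] zero_outside[OF A] by metis
  then show ?thesis by simp
next
  case True
  \<comment> \<open>The matrix unit at (k, l). If it belongs to the algebra, its multiple by the
    entry of a member is dominated by that member.\<close>
  define E :: "'k \<Rightarrow> 'k \<Rightarrow> complex" where "E = (\<lambda>i j. if i = k \<and> j = l then 1 else 0)"
  have E_mats: "E \<in> mats_on K" using True by (auto simp: E_def mats_on_def)
  show ?thesis
  proof (cases "E \<in> \<A>")
    case E: True
    have "E \<noteq> (\<lambda>i j. 0)" by (auto simp: E_def fun_eq_iff)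
    then have pos: "nrm E > 0"
      using nrm_eq_0[OF E] nrm_nonneg[OF E] by linarith
    have le: "cmod (X n k l - A k l) \<le> nrm (\<lambda>k l. X n k l - A k l) / nrm E" for n
    proof -
      have "nrm (\<lambda>i j. (X n k l - A k l) * E i j) \<le> nrm (\<lambda>k l. X n k l - A k l)"
        using scale_mem[OF E] mats
        by (intro solid[OF diff_mem[OF X A], THEN conjunct2]) (auto simp: E_def)
      then show ?thesis using pos by (simp add: nrm_scale[OF E] divide_simps)
    qed
    have "((\<lambda>n. nrm (\<lambda>k l. X n k l - A k l) / nrm E) \<longlongrightarrow> 0) F"
      using tendsto_divide[OF lim tendsto_const[of "nrm E"]] pos by simp
    then have "((\<lambda>n. X n k l - A k l) \<longlongrightarrow> 0) F"
      by (rule Lim_null_comparison[rotated]) (simp add: le)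
    then show ?thesis by (simp add: LIM_zero_iff)
  next
    case False
    \<comment> \<open>A member with a nonzero entry here could be rescaled to dominate the matrix
      unit, which solidity would then put into the algebra.\<close>
    have "Y k l = 0" if "Y \<in> \<A>" for Y
    proof (rule ccontr)
      assume "Y k l \<noteq> 0"
      then have "E \<in> \<A>"
        by (intro solid[OF scale_mem[OF that, of "1 / Y k l"] E_mats, THEN conjunct1])
          (auto simp: E_def)
      then show False using False by simp
    qed
    then have "X n k l = 0" "A k l = 0" for n using X A by auto
    then show ?thesis by simp
  qed
qed

end

section \<open>Averages of resolvents and their convergence in the algebra\<close>

lemma norm_cis_minus_1_le: "cmod (cis t - 1) \<le> 2 * \<bar>t\<bar>"
proof -
  have "\<bar>cos t - 1\<bar> = 2 * (\<bar>sin (t / 2)\<bar> * \<bar>sin (t / 2)\<bar>)"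
    using cos_double_sin[of "t / 2"] by (simp add: power2_eq_square flip: abs_mult)
  also have "\<dots> \<le> 2 * (\<bar>t / 2\<bar> * 1)"
    by (intro mult_left_mono mult_mono abs_sin_x_le_abs_x) auto
  finally show ?thesis
    using cmod_le[of "cis t - 1"] abs_sin_x_le_abs_x[of t] by simp
qed

text \<open>The mean of \<open>f\<close> over the \<open>2 ^ m\<close> points obtained from
  \<open>z\<close> by multiplication with roots of unity. The recursion adds a copy turned by half
  the current angular step, which suits both the doubling identity and the comparison of successive
  means.\<close>

primrec dyadic_mean ::
    "(complex \<Rightarrow> 'k \<Rightarrow> 'k \<Rightarrow> complex) \<Rightarrow> nat \<Rightarrow> complex \<Rightarrow> 'k \<Rightarrow> 'k \<Rightarrow> complex"
  where
    "dyadic_mean f 0 = f"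
  | "dyadic_mean f (Suc m) = (\<lambda>z k l. (1/2) *
      (dyadic_mean f m z k l + dyadic_mean f m (cis (pi / 2 ^ m) * z) k l))"

context solid_spectral_matrix_algebra
begin

text \<open>The resolvent identity bounds increments of \<open>f\<close> by a product that contains
  \<open>nrm (f w)\<close> itself. Near a fixed \<open>z\<close> that term can be absorbed, which
  gives local boundedness; compactness of the circle makes the bound uniform, and the identity then
  yields a Lipschitz constant.\<close>

lemma resolvent_bounded:
  assumes R: "R \<in> \<A>" and f: "\<And>z. cmod z = \<rho> \<Longrightarrow> f z \<in> \<A>"
    and lip: "\<And>z w. cmod z = \<rho> \<Longrightarrow> cmod w = \<rho> \<Longrightarrow>
      nrm (\<lambda>k l. f w k l - f z k l) \<le> cmod (w - z) * (nrm (f z) * nrm R * nrm (f w))"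
  obtains L where "0 \<le> L" "\<And>z w. cmod z = \<rho> \<Longrightarrow> cmod w = \<rho> \<Longrightarrow>
      nrm (\<lambda>k l. f w k l - f z k l) \<le> L * cmod (w - z)"
proof -
  \<comment> \<open>Within this distance of \<open>z\<close> the factor in front of
    \<open>nrm (f w)\<close> is at most one half.\<close>
  define \<delta> where "\<delta> z = 1 / (2 * (1 + nrm (f z) * nrm R))" for z
  have pos: "\<delta> z > 0" if "cmod z = \<rho>" for z
    using nrm_nonneg[OF R] nrm_nonneg[OF f[OF that]] by (simp add: \<delta>_def add_pos_nonneg)
  have loc: "nrm (f w) \<le> 2 * nrm (f z)" if "cmod z = \<rho>" "cmod w = \<rho>" "dist z w < \<delta> z" for z w
  proof -
    have nn: "0 \<le> nrm (f z)" "0 \<le> nrm R" "0 \<le> nrm (f w)"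
      using nrm_nonneg[OF R] nrm_nonneg[OF f] that by auto
    have "cmod (w - z) * (nrm (f z) * nrm R) \<le> \<delta> z * (1 + nrm (f z) * nrm R)"
      using that nn pos[of z] by (intro mult_mono) (auto simp: dist_norm norm_minus_commute)
    also have "\<dots> = 1/2"
    proof -
      have "1 + nrm (f z) * nrm R > 0" using nn by (simp add: add_pos_nonneg)
      then show ?thesis by (simp add: \<delta>_def divide_simps)
    qed
    finally have "cmod (w - z) * (nrm (f z) * nrm R) * nrm (f w) \<le> 1/2 * nrm (f w)"
      using nn by (intro mult_right_mono)
    then show ?thesis
      using lip[OF that(1,2)] nrm_diff_bound[OF f[OF that(2)] f[OF that(1)]] by (simp add: mult.assoc)
  qed
  obtain Z where Z: "Z \<subseteq> sphere 0 \<rho>" "finite Z" "sphere 0 \<rho> \<subseteq> (\<Union>z\<in>Z. ball z (\<delta> z))"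
  proof (rule compactE_image[OF compact_sphere, of "sphere 0 \<rho>" "\<lambda>z. ball z (\<delta> z)" "0::complex" \<rho>])
    show "sphere 0 \<rho> \<subseteq> (\<Union>z\<in>sphere 0 \<rho>. ball z (\<delta> z))"
      using pos by force
  qed auto
  define M where "M = Max (insert 0 ((\<lambda>z. 2 * nrm (f z)) ` Z))"
  have M: "0 \<le> M" using Z by (auto simp: M_def)
  have bd: "nrm (f w) \<le> M" if w: "cmod w = \<rho>" for w
  proof -
    have "w \<in> sphere 0 \<rho>" using w by simp
    then obtain z where z: "z \<in> Z" "dist z w < \<delta> z" using Z(3) by auto
    then have "nrm (f w) \<le> 2 * nrm (f z)" using Z(1) w by (intro loc) auto
    also have "\<dots> \<le> M" using z Z by (auto simp: M_def intro!: Max_ge)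
    finally show ?thesis .
  qed
  show thesis
  proof (rule that[of "M * nrm R * M"])
    fix z w assume *: "cmod z = \<rho>" "cmod w = \<rho>"
    have "nrm (f z) * nrm R * nrm (f w) \<le> M * nrm R * M"
      using * M bd nrm_nonneg[OF R] nrm_nonneg[OF f] by (intro mult_mono mult_nonneg_nonneg) auto
    then have "cmod (w - z) * (nrm (f z) * nrm R * nrm (f w)) \<le> cmod (w - z) * (M * nrm R * M)"
      by (rule mult_left_mono) simp
    then show "nrm (\<lambda>k l. f w k l - f z k l) \<le> M * nrm R * M * cmod (w - z)"
      using lip[OF *] by (simp add: mult.commute)
  qed (use M nrm_nonneg[OF R] in auto)
qed

lemma dyadic_mean_mem:
  assumes "\<And>z. cmod z = \<rho> \<Longrightarrow> f z \<in> \<A>" "cmod z = \<rho>"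
  shows "dyadic_mean f m z \<in> \<A>"
  using assms(2)
proof (induction m arbitrary: z)
  case (Suc m)
  have "cmod (cis (pi / 2 ^ m) * z) = \<rho>" using Suc.prems by (simp add: norm_mult)
  then show ?case
    unfolding dyadic_mean.simps by (intro scale_mem add_mem Suc)
qed (use assms in auto)

text \<open>Rotations are isometries and averaging does not increase a Lipschitz constant, so the
  same \<open>L\<close> serves every stage.\<close>

lemma dyadic_mean_lipschitz:
  assumes f: "\<And>z. cmod z = \<rho> \<Longrightarrow> f z \<in> \<A>"
    and L: "\<And>z w. cmod z = \<rho> \<Longrightarrow> cmod w = \<rho> \<Longrightarrow>
      nrm (\<lambda>k l. f w k l - f z k l) \<le> L * cmod (w - z)"
    and z: "cmod z = \<rho>" and w: "cmod w = \<rho>"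
  shows "nrm (\<lambda>k l. dyadic_mean f m w k l - dyadic_mean f m z k l) \<le> L * cmod (w - z)"
  using z w
proof (induction m arbitrary: z w)
  case (Suc m)
  define u where "u = cis (pi / 2 ^ m)"
  let ?f = "dyadic_mean f m"
  have u: "cmod (u * z) = \<rho>" "cmod (u * w) = \<rho>"
    using Suc.prems by (auto simp: u_def norm_mult)
  have mem: "?f z \<in> \<A>" "?f w \<in> \<A>" "?f (u * z) \<in> \<A>" "?f (u * w) \<in> \<A>"
    using f u Suc.prems by (auto intro!: dyadic_mean_mem)
  have "nrm (\<lambda>k l. dyadic_mean f (Suc m) w k l - dyadic_mean f (Suc m) z k l) =
     nrm (\<lambda>k l. (1/2) * ((?f w k l - ?f z k l) + (?f (u * w) k l - ?f (u * z) k l)))"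
    unfolding dyadic_mean.simps u_def by (simp add: algebra_simps add_divide_distrib diff_divide_distrib)
  also have "\<dots> = 1/2 * nrm (\<lambda>k l. (?f w k l - ?f z k l) + (?f (u * w) k l - ?f (u * z) k l))"
    by (subst nrm_scale) (auto intro!: add_mem diff_mem mem)
  also have "\<dots> \<le> 1/2 * (nrm (\<lambda>k l. ?f w k l - ?f z k l) + nrm (\<lambda>k l. ?f (u * w) k l - ?f (u * z) k l))"
    by (intro mult_left_mono nrm_triangle diff_mem mem) auto
  also have "\<dots> \<le> 1/2 * (L * cmod (w - z) + L * cmod (u * w - u * z))"
    by (intro mult_left_mono add_mono Suc.IH Suc.prems u) auto
  also have "cmod (u * w - u * z) = cmod (w - z)"
    by (simp add: u_def norm_mult flip: right_diff_distrib)
  finally show ?case by simp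
qed (use L in auto)

lemma nrm_geometric_convergent:
  assumes X: "\<And>n. X n \<in> \<A>" and B: "0 \<le> B"
    and step: "\<And>n. nrm (\<lambda>k l. X (Suc n) k l - X n k l) \<le> B / 2 ^ n"
  shows "\<exists>A\<in>\<A>. (\<lambda>n. nrm (\<lambda>k l. X n k l - A k l)) \<longlonglongrightarrow> 0"
proof (rule nrm_complete[OF X])
  have le: "nrm (\<lambda>k l. X (n + j) k l - X n k l) \<le> 2 * B / 2 ^ n * (1 - 1 / 2 ^ j)" for n j
  proof (induction j)
    case 0
    have "nrm (\<lambda>k l. X n k l - X n k l) = 0"
      using nrm_eq_0[OF diff_mem[OF X[of n] X[of n]]] by simp
    then show ?case by simp
  next
    case (Suc j)
    have "nrm (\<lambda>k l. X (n + Suc j) k l - X n k l)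
        \<le> nrm (\<lambda>k l. X (Suc (n + j)) k l - X (n + j) k l) + nrm (\<lambda>k l. X (n + j) k l - X n k l)"
      using nrm_triangle_diff X by simp
    also have "\<dots> \<le> B / 2 ^ (n + j) + 2 * B / 2 ^ n * (1 - 1 / 2 ^ j)"
      by (intro add_mono step Suc.IH)
    also have "\<dots> = 2 * B / 2 ^ n * (1 - 1 / 2 ^ Suc j)"
      by (simp add: field_simps power_add)
    finally show ?case .
  qed
  fix e :: real assume e: "0 < e"
  have "(\<lambda>n. 2 * B * (1/2) ^ n) \<longlonglongrightarrow> 2 * B * 0"
    by (intro tendsto_intros LIMSEQ_power_zero) auto
  then have "\<forall>\<^sub>F n in sequentially. 2 * B * (1/2) ^ n < e"
    using e by (intro order_tendstoD) auto
  then obtain N where N: "\<And>n. n \<ge> N \<Longrightarrow> 2 * B / 2 ^ n < e"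
    by (auto simp: eventually_sequentially power_divide)
  have ordered: "nrm (\<lambda>k l. X m k l - X n k l) < e" if "n \<ge> N" "m \<ge> n" for m n
  proof -
    have "nrm (\<lambda>k l. X m k l - X n k l) \<le> 2 * B / 2 ^ n * (1 - 1 / 2 ^ (m - n))"
      using le[of n "m - n"] that by simp
    also have "\<dots> \<le> 2 * B / 2 ^ n * 1"
      using B by (intro mult_left_mono) auto
    finally show ?thesis using N[OF that(1)] by simp
  qed
  show "\<exists>N. \<forall>m\<ge>N. \<forall>n\<ge>N. nrm (\<lambda>k l. X m k l - X n k l) < e"
  proof (intro exI allI impI)
    fix m n assume "m \<ge> N" "n \<ge> N"
    then show "nrm (\<lambda>k l. X m k l - X n k l) < e"
      using ordered[of n m] ordered[of m n] nrm_diff_commute[OF X X, of m n]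
      by (cases "m \<ge> n") auto
  qed
qed

lemma funpow_ell2:
  assumes "R \<in> \<A>" "c \<in> ell2 K"
  shows "(mat_vec K R ^^ n) c \<in> ell2 K"
  by (induction n) (auto intro: mat_vec_ell2 assms)

lemma funpow_add_scale:
  assumes "R \<in> \<A>" "c \<in> ell2 K" "d \<in> ell2 K"
  shows "(mat_vec K R ^^ n) (\<lambda>k. c k + a * d k) =
    (\<lambda>k. (mat_vec K R ^^ n) c k + a * (mat_vec K R ^^ n) d k)"
  by (induction n) (auto simp: mat_vec_add mat_vec_scale funpow_ell2 assms ell2_scale)

text \<open>The dyadic mean of the resolvents \<open>(1 - z R)\<^sup>-\<^sup>1\<close> is \<open>(1 - z\<^sup>N R\<^sup>N)\<^sup>-\<^sup>1\<close> for \<open>N = 2 ^ m\<close>, because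
  \<open>(1 - X)\<^sup>-\<^sup>1 + (1 + X)\<^sup>-\<^sup>1 = 2 (1 - X\<^sup>2)\<^sup>-\<^sup>1\<close>. These Riemann sums for the contour integral of the
  resolvent converge in the algebra, since the resolvent is Lipschitz on the circle.\<close>

lemma dyadic_resolvents:
  assumes R: "R \<in> \<A>" and \<rho>: "0 < \<rho>"
    and bij: "\<And>z. cmod z = \<rho> \<Longrightarrow>
      bij_betw (\<lambda>c k. c k - z * mat_vec K R c k) (ell2 K) (ell2 K)"
  obtains X Q where "\<And>m. X m \<in> \<A>" "Q \<in> \<A>" "\<And>k l. (\<lambda>m. X m k l) \<longlonglongrightarrow> Q k l"
    "\<And>m c. c \<in> ell2 K \<Longrightarrow>
      mat_vec K (X m) (\<lambda>k. c k - \<rho> ^ (2 ^ m) * (mat_vec K R ^^ (2 ^ m)) c k) = c"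
proof -
  define M where "M z = (\<lambda>k l. mat_id K k l - z * R k l)" for z
  have M: "M z \<in> \<A>" for z
    unfolding M_def by (intro diff_mem scale_mem id_mem R)
  have M_vec: "mat_vec K (M z) c = (\<lambda>k. c k - z * mat_vec K R c k)" if "c \<in> ell2 K" for z c
    unfolding M_def using that
    by (subst mat_vec_mat_diff) (auto simp: R id_mem scale_mem mat_vec_id mat_vec_mat_scale ell2_iff)
  \<comment> \<open>Inverse closedness supplies left inverses; surjectivity upgrades them to
    two-sided ones in \<open>f_right\<close>.\<close>
  have "\<forall>z. \<exists>B. cmod z = \<rho> \<longrightarrow> B \<in> \<A> \<and> (\<forall>c\<in>ell2 K. mat_vec K B (mat_vec K (M z) c) = c)"
  proof (intro allI)
    fix z
    have "cmod z = \<rho> \<Longrightarrow> bij_betw (mat_vec K (M z)) (ell2 K) (ell2 K)"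
      by (rule bij_betw_cong[THEN iffD2, OF _ bij]) (auto simp: M_vec)
    then show "\<exists>B. cmod z = \<rho> \<longrightarrow> B \<in> \<A> \<and> (\<forall>c\<in>ell2 K. mat_vec K B (mat_vec K (M z) c) = c)"
      using inverse_closed[OF M] by blast
  qed
  then obtain f where f: "\<And>z. cmod z = \<rho> \<Longrightarrow> f z \<in> \<A>"
    and f_left: "\<And>z c. \<lbrakk>cmod z = \<rho>; c \<in> ell2 K\<rbrakk> \<Longrightarrow> mat_vec K (f z) (mat_vec K (M z) c) = c"
    by metis
  have f_right: "mat_vec K (M z) (mat_vec K (f z) c) = c" if "cmod z = \<rho>" "c \<in> ell2 K" for z c
  proof -
    have "c \<in> (\<lambda>c k. c k - z * mat_vec K R c k) ` ell2 K"
      using bij[OF that(1)] that(2) by (auto simp: bij_betw_def)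
    then obtain d where "d \<in> ell2 K" "c = mat_vec K (M z) d" using M_vec by force
    then show ?thesis using f_left that by simp
  qed
  \<comment> \<open>The resolvent identity f(w) - f(z) = (w - z) f(z) R f(w). It is checked column
    by column, where both sides become vectors of ell^2 and M(w) = M(z) - (w - z) R can be
    applied.\<close>
  have identity: "(\<lambda>k l. f w k l - f z k l) =
      (\<lambda>k l. (w - z) * mat_mult K (f z) (mat_mult K R (f w)) k l)"
    if z: "cmod z = \<rho>" and w: "cmod w = \<rho>" for z w
  proof (rule mat_eqI)
    show "(\<lambda>k l. f w k l - f z k l) \<in> \<A>" by (intro diff_mem f z w)
    show "(\<lambda>k l. (w - z) * mat_mult K (f z) (mat_mult K R (f w)) k l) \<in> \<A>"
      by (intro scale_mem mult_mem f z w R)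
    fix l assume l: "l \<in> K"
    define e where "e = (\<lambda>k. f w k l)"
    have e: "e \<in> ell2 K" "e = mat_vec K (f w) (unit_seq l)"
      using f[OF w] l by (simp_all add: e_def column_ell2 column)
    have e_l: "unit_seq l = mat_vec K (M w) e"
      using f_right[OF w] l by (simp add: e fin_seqs_ell2 unit_seq_fin)
    have "(\<lambda>k. f z k l) = mat_vec K (f z) (mat_vec K (M w) e)"
      using f[OF z] l by (simp add: column flip: e_l)
    also have "mat_vec K (M w) e = (\<lambda>k. mat_vec K (M z) e k - (w - z) * mat_vec K R e k)"
      using e(1) by (simp add: M_vec algebra_simps)
    also have "mat_vec K (f z) \<dots> = (\<lambda>k. e k - (w - z) * mat_vec K (f z) (mat_vec K R e) k)"
      using f[OF z] R M e(1)
      by (simp add: mat_vec_diff mat_vec_ell2 ell2_scale mat_vec_scale f_left z)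
    finally have "(\<lambda>k. e k - f z k l) = (\<lambda>k. (w - z) * mat_vec K (f z) (mat_vec K R e) k)"
      by (auto simp: fun_eq_iff)
    moreover have "(\<lambda>k. mat_mult K (f z) (mat_mult K R (f w)) k l) = mat_vec K (f z) (mat_vec K R e)"
      using f[OF z] R l by (simp add: column_mat_mult e_def)
    ultimately show "(\<lambda>k. f w k l - f z k l) = (\<lambda>k. (w - z) * mat_mult K (f z) (mat_mult K R (f w)) k l)"
      by (simp add: e_def fun_eq_iff)
  qed
  have lip: "nrm (\<lambda>k l. f w k l - f z k l) \<le> cmod (w - z) * (nrm (f z) * nrm R * nrm (f w))"
    if "cmod z = \<rho>" "cmod w = \<rho>" for z w
  proof -
    have "nrm (mat_mult K (f z) (mat_mult K R (f w))) \<le> nrm (f z) * (nrm R * nrm (f w))"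
      using that
      by (intro order_trans[OF nrm_mult] mult_left_mono nrm_mult nrm_nonneg mult_mem f R)
    then show ?thesis
      unfolding identity[OF that] using that
      by (subst nrm_scale) (auto simp: mult.assoc intro!: mult_left_mono mult_mem f R)
  qed
  obtain L where L: "0 \<le> L" "\<And>z w. cmod z = \<rho> \<Longrightarrow> cmod w = \<rho> \<Longrightarrow>
      nrm (\<lambda>k l. f w k l - f z k l) \<le> L * cmod (w - z)"
    using resolvent_bounded[OF R f lip] by blast
  define X where "X m = dyadic_mean f m \<rho>" for m
  have X: "X m \<in> \<A>" for m
    unfolding X_def using f \<rho> by (intro dyadic_mean_mem[of \<rho>]) auto
  \<comment> \<open>Successive means differ by half the increment of stage \<open>m\<close> under
    rotation by pi / 2^m, so the Lipschitz bound makes the differences geometric.\<close>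
  have "nrm (\<lambda>k l. X (Suc m) k l - X m k l) \<le> L * \<rho> * pi / 2 ^ m" for m
  proof -
    define u where "u = cis (pi / 2 ^ m)"
    let ?f = "dyadic_mean f m"
    have norms: "cmod (complex_of_real \<rho>) = \<rho>" "cmod (u * \<rho>) = \<rho>"
      using \<rho> by (auto simp: u_def norm_mult)
    have mem: "?f \<rho> \<in> \<A>" "?f (u * \<rho>) \<in> \<A>"
      using f norms by (auto intro!: dyadic_mean_mem)
    have "nrm (\<lambda>k l. X (Suc m) k l - X m k l) = nrm (\<lambda>k l. (1/2) * (?f (u * \<rho>) k l - ?f \<rho> k l))"
      unfolding X_def dyadic_mean.simps u_def by (simp add: algebra_simps)
    also have "\<dots> = 1/2 * nrm (\<lambda>k l. ?f (u * \<rho>) k l - ?f \<rho> k l)"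
      by (subst nrm_scale) (auto intro!: diff_mem mem)
    also have "\<dots> \<le> 1/2 * (L * cmod (u * \<rho> - \<rho>))"
      using norms by (intro mult_left_mono dyadic_mean_lipschitz[OF f L(2)]) auto
    also have "cmod (u * \<rho> - \<rho>) = \<rho> * cmod (u - 1)"
    proof -
      have "u * \<rho> - \<rho> = \<rho> * (u - 1)" by (simp add: algebra_simps)
      then show ?thesis using \<rho> by (simp only: norm_mult) simp
    qed
    also have "1/2 * (L * (\<rho> * cmod (u - 1))) \<le> 1/2 * (L * (\<rho> * (2 * \<bar>pi / 2 ^ m\<bar>)))"
      unfolding u_def using L \<rho> by (intro mult_left_mono norm_cis_minus_1_le) auto
    finally show ?thesis
      by simp
  qed
  then obtain Q where Q: "Q \<in> \<A>" "(\<lambda>n. nrm (\<lambda>k l. X n k l - Q k l)) \<longlonglongrightarrow> 0"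
    using nrm_geometric_convergent[OF X, of "L * \<rho> * pi"] L(1) \<rho> by (meson less_imp_le mult_nonneg_nonneg pi_ge_zero)
  have inv: "mat_vec K (dyadic_mean f m z)
      (\<lambda>k. c k - z ^ (2 ^ m) * (mat_vec K R ^^ (2 ^ m)) c k) = c"
    if "cmod z = \<rho>" "c \<in> ell2 K" for m z c
    using that
  proof (induction m arbitrary: z c)
    case 0
    then show ?case using f_left[of z c] by (simp add: M_vec)
  next
    case (Suc m)
    define u where "u = cis (pi / 2 ^ m)"
    define a where "a = z ^ (2 ^ m)"
    define W where "W = mat_vec K R ^^ (2 ^ m)"
    have uz: "cmod (u * z) = \<rho>" using Suc.prems by (simp add: u_def norm_mult)
    \<comment> \<open>Write N = 2^m and X = z^N R^N. Rotating \<open>z\<close> by the half step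
      replaces X by -X, so by induction the two means invert 1 - X and 1 + X.\<close>
    have "u ^ (2 ^ m) = cis pi" by (simp add: u_def Complex.DeMoivre)
    then have ua: "(u * z) ^ (2 ^ m) = - a" by (simp add: a_def power_mult_distrib)
    have W: "W c \<in> ell2 K" unfolding W_def by (intro funpow_ell2 R Suc.prems)
    \<comment> \<open>This is (1 - X^2) c, which is both 1 - X applied to (1 + X) c and 1 + X
      applied to (1 - X) c. The two means therefore send it to (1 + X) c and (1 - X) c, whose
      average is \<open>c\<close>.\<close>
    define d where "d = (\<lambda>k. c k - z ^ (2 ^ Suc m) * (mat_vec K R ^^ (2 ^ Suc m)) c k)"
    have pow: "z ^ (2 ^ Suc m) = a * a" "(mat_vec K R ^^ (2 ^ Suc m)) c = W (W c)"
      by (auto simp: a_def W_def mult_2 power_add funpow_add)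
    have d: "d \<in> ell2 K"
      unfolding d_def by (intro ell2_diff ell2_scale funpow_ell2 R Suc.prems)
    have Wb: "W (\<lambda>k. c k + b * W c k) = (\<lambda>k. W c k + b * W (W c) k)" for b
      unfolding W_def by (rule funpow_add_scale[OF R Suc.prems(2) W[unfolded W_def]])
    have e: "(\<lambda>k. c k + b * W c k) \<in> ell2 K" for b
      by (intro ell2_add ell2_scale W Suc.prems)
    have "d = (\<lambda>k. (c k + a * W c k) - a * W (\<lambda>k. c k + a * W c k) k)"
      unfolding d_def pow Wb by (simp add: algebra_simps)
    then have 1: "mat_vec K (dyadic_mean f m z) d = (\<lambda>k. c k + a * W c k)"
      using Suc.IH[OF Suc.prems(1) e[of a]] by (simp add: a_def W_def)
    have "d = (\<lambda>k. (c k + (-a) * W c k) - (-a) * W (\<lambda>k. c k + (-a) * W c k) k)"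
      unfolding d_def pow Wb by (simp add: algebra_simps)
    then have 2: "mat_vec K (dyadic_mean f m (u * z)) d = (\<lambda>k. c k + (-a) * W c k)"
      using Suc.IH[OF uz e[of "-a"]] unfolding ua W_def by metis
    have "mat_vec K (dyadic_mean f (Suc m) z) d =
        (\<lambda>k. 1/2 * (mat_vec K (dyadic_mean f m z) d k + mat_vec K (dyadic_mean f m (u * z)) d k))"
      unfolding dyadic_mean.simps u_def[symmetric] mat_vec_mat_scale
      using f Suc.prems uz d by (subst mat_vec_mat_add) (auto intro: dyadic_mean_mem)
    then show ?case unfolding 1 2 d_def[symmetric] by simp
  qed
  show thesis
  proof (rule that[of X Q])
    show "(\<lambda>m. X m k l) \<longlonglongrightarrow> Q k l" for k l
      using X Q by (intro entry_tendsto)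
  qed (use X Q inv[of "of_real \<rho>"] \<rho> in \<open>auto simp: X_def\<close>)
qed

end

section \<open>Gram matrices of the canonical dual frame\<close>

locale localized_frame = solid_spectral_matrix_algebra K \<A> nrm + frame K \<psi>
  for K :: "'k set" and \<A> nrm and \<psi> :: "'k \<Rightarrow> 'h::chilbert_space" +
  assumes localized: "gram K \<psi> \<psi> \<in> \<A>"
begin

lemma gram_mem_via_dual:
  assumes "gram K \<xi> \<psi> \<in> \<A>" "gram K \<psi>' \<eta> \<in> \<A>"
  shows "gram K \<xi> \<eta> \<in> \<A>"
  using mult_mem[OF assms] by (simp add: gram_mult)

lemma synthesis_unit_seq: "l \<in> K \<Longrightarrow> D (unit_seq l) = \<psi> l"
  by (rule synthesis_unique[OF fin_seqs_ell2[OF unit_seq_fin]])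
    (auto simp: unit_seq_def split: if_splits intro!: has_sum_finite_neutralI[where B = "{l}"])

text \<open>On the kernel of \<open>D\<close> the map is multiplication by 1 - z, which is nonzero.
  Moreover \<open>D\<close> intertwines it with 1 - z (1 - t S) on the Hilbert space, which is
  invertible because \<open>cmod z * r < 1\<close>.\<close>

lemma bij_resolvent:
  fixes z :: complex
  assumes t: "0 < t" "\<And>f. norm (f - t *\<^sub>R S f) \<le> r * norm f" and z: "z \<noteq> 1" "cmod z * r < 1" "0 \<le> r"
    and V: "\<And>c. c \<in> ell2 K \<Longrightarrow> V c = (\<lambda>k. c k - of_real t * C (D c) k)"
  shows "bij_betw (\<lambda>c k. c k - z * V c k) (ell2 K) (ell2 K)"
proof -
  define U where "U f = z *\<^sub>C (f - t *\<^sub>R S f)" for f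
  have U_diff: "U (f - g) = U f - U g" for f g
    by (simp add: U_def frame_operator_diff scaleC_diff_right scaleR_diff_right)
  have fixed: "\<exists>!f. f - U f = h" for h
  proof (rule contraction_fixed_point)
    fix f
    have "cmod z * norm (f - t *\<^sub>R S f) \<le> cmod z * (r * norm f)"
      by (intro mult_left_mono t) auto
    then show "norm (U f) \<le> (cmod z * r) * norm f"
      by (simp add: U_def mult.assoc)
  qed (use z U_diff in auto)
  have U_eq: "f - U f = (1 - z) *\<^sub>C f + (z * of_real t) *\<^sub>C S f" for f
    by (simp add: U_def scaleC_diff_right scaleC_diff_left scaleC_scaleC algebra_simps
        flip: scaleC_of_real)
  have V': "(\<lambda>k. c k - z * V c k) = (\<lambda>k. (1 - z) * c k + z * of_real t * C (D c) k)"
    if "c \<in> ell2 K" for c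
    using that by (simp add: V algebra_simps)
  have U_0: "U 0 = 0" using U_diff[of 0 0] by simp
  show ?thesis
    unfolding bij_betw_def
  proof (intro conjI equalityI subsetI)
    show "inj_on (\<lambda>c k. c k - z * V c k) (ell2 K)"
    proof (rule inj_onI)
      fix c d assume c: "c \<in> ell2 K" and d: "d \<in> ell2 K"
        and eq: "(\<lambda>k. c k - z * V c k) = (\<lambda>k. d k - z * V d k)"
      define e where "e = (\<lambda>k. c k - d k)"
      have e: "e \<in> ell2 K" unfolding e_def by (intro ell2_diff c d)
      have "D e = D c - D d" unfolding e_def by (intro synthesis_diff c d)
      then have e0: "(\<lambda>k. (1 - z) * e k + z * of_real t * C (D e) k) = (\<lambda>k. 0)"
        using eq unfolding V'[OF c] V'[OF d]
        by (simp add: analysis_diff) (simp add: e_def fun_eq_iff algebra_simps)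
      have "D (\<lambda>k. (1 - z) * e k + z * of_real t * C (D e) k) =
          (1 - z) *\<^sub>C D e + (z * of_real t) *\<^sub>C S (D e)"
        by (simp add: synthesis_add synthesis_scale ell2_scale e analysis_ell2 frame_operator_def)
      moreover have "D (\<lambda>k. 0) = 0"
        by (simp add: synthesis_def)
      ultimately have "D e - U (D e) = 0" by (simp add: e0 U_eq)
      moreover have "0 - U 0 = 0" by (simp add: U_0)
      ultimately have "D e = 0" using fixed by blast
      then have "(1 - z) * e k = 0" for k
        using fun_cong[OF e0, of k] by (cases "k \<in> K") (simp_all add: analysis_def)
      then show "c = d" using z by (auto simp: e_def fun_eq_iff)
    qed
    show "y \<in> ell2 K" if y: "y \<in> (\<lambda>c k. c k - z * V c k) ` ell2 K" for y
    proof -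
      obtain c where c: "c \<in> ell2 K" "y = (\<lambda>k. c k - z * V c k)" using y by blast
      show ?thesis
        unfolding c(2) V'[OF c(1)] by (intro ell2_add ell2_scale c analysis_ell2)
    qed
    show "y \<in> (\<lambda>c k. c k - z * V c k) ` ell2 K" if y: "y \<in> ell2 K" for y
    proof -
      obtain h where h: "h - U h = D y" using fixed by blast
      \<comment> \<open>Solves (1 - z) c + z t C (D c) = y for \<open>c\<close>, with
        \<open>D c\<close> replaced by its only possible value \<open>h\<close>.\<close>
      define c where "c = (\<lambda>k. (1 / (1 - z)) * (y k - z * of_real t * C h k))"
      have c: "c \<in> ell2 K"
        unfolding c_def by (intro ell2_scale ell2_diff y analysis_ell2)
      have "D c = (1 / (1 - z)) *\<^sub>C (D y - (z * of_real t) *\<^sub>C S h)"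
        unfolding c_def
        by (subst synthesis_scale)
          (simp_all add: synthesis_diff[OF y ell2_scale[OF analysis_ell2]]
            synthesis_scale[OF analysis_ell2] frame_operator_def ell2_scale ell2_diff y analysis_ell2)
      also have "\<dots> = h"
        using z unfolding h[symmetric] U_eq by (simp add: scaleC_scaleC)
      finally have Dc: "D c = h" .
      have "(\<lambda>k. c k - z * V c k) = y"
        unfolding V'[OF c] Dc using z by (simp add: c_def)
      with c show ?thesis by blast
    qed
  qed
qed

text \<open>The limit of the averages is identified entrywise: each unit sequence splits into a part
  in the range of \<open>C\<close> and a part in the kernel of \<open>D\<close>, and on both the
  averages are explicit.\<close>

theorem gram_dual_mem: "gram K \<psi> \<psi>' \<in> \<A>"
proof -
  obtain t r where t: "0 < t" and r: "0 < r" "r < 1"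
    and contr: "\<And>f. norm (f - t *\<^sub>R S f) \<le> r * norm f"
    by (rule frame_operator_contraction) blast
  \<comment> \<open>The midpoint of 1 and 1 / r: \<open>\<rho> > 1\<close> removes the kernel part
    in the limit, and \<open>q < 1\<close> controls the range part.\<close>
  define \<rho> where "\<rho> = (1 + 1 / r) / 2"
  define q where "q = \<rho> * r"
  have "q = (1 + r) / 2" using r by (simp add: \<rho>_def q_def field_simps)
  then have q: "0 < q" "q < 1" using r by auto
  have \<rho>: "1 < \<rho>" using r by (simp add: \<rho>_def field_simps)
  define R where "R = (\<lambda>k l. mat_id K k l - of_real t * gram K \<psi> \<psi> k l)"
  have R: "R \<in> \<A>" unfolding R_def by (intro diff_mem id_mem scale_mem localized)
  have R_vec: "mat_vec K R c = (\<lambda>k. c k - of_real t * C (D c) k)" if "c \<in> ell2 K" for c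
    unfolding R_def using that
    by (subst mat_vec_mat_diff)
      (auto simp: id_mem scale_mem localized mat_vec_mat_scale mat_vec_gram mat_vec_id ell2_iff)
  have bij: "bij_betw (\<lambda>c k. c k - z * mat_vec K R c k) (ell2 K) (ell2 K)" if "cmod z = \<rho>" for z
  proof (rule bij_resolvent[OF t contr])
    show "z \<noteq> 1" using that \<rho> by auto
  qed (use R_vec that q r in \<open>auto simp: q_def\<close>)
  obtain X Q where X: "\<And>m. X m \<in> \<A>" and Q: "Q \<in> \<A>" "\<And>k l. (\<lambda>m. X m k l) \<longlonglongrightarrow> Q k l"
    and X_inv: "\<And>m c. c \<in> ell2 K \<Longrightarrow>
      mat_vec K (X m) (\<lambda>k. c k - \<rho> ^ (2 ^ m) * (mat_vec K R ^^ (2 ^ m)) c k) = c"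
    by (rule dyadic_resolvents[OF R _ bij]) (use \<rho> in auto)
  define U where "U f = f - t *\<^sub>R S f" for f
  have U_diff: "U (f - g) = U f - U g" for f g
    by (simp add: U_def frame_operator_diff scaleR_diff_right)
  have Un_diff: "(U ^^ n) (f - g) = (U ^^ n) f - (U ^^ n) g" for n f g
    by (induction n) (auto simp: U_diff)
  have Un_norm: "norm ((U ^^ n) f) \<le> r ^ n * norm f" for n f
  proof (induction n)
    case (Suc n)
    have "norm ((U ^^ Suc n) f) \<le> r * norm ((U ^^ n) f)"
      using contr by (simp add: U_def)
    also have "\<dots> \<le> r * (r ^ n * norm f)" using Suc r by (intro mult_left_mono) auto
    finally show ?case by (simp add: mult.assoc)
  qed simp
  have R_C: "(mat_vec K R ^^ n) (C f) = C ((U ^^ n) f)" for n f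
    by (induction n)
      (auto simp: R_vec analysis_ell2 U_def analysis_diff analysis_scale frame_operator_def
        simp flip: scaleC_of_real)
  have Q_eq: "Q k l = gram K \<psi> \<psi>' k l" if l: "l \<in> K" and k: "k \<in> K" for k l
  proof -
    \<comment> \<open>\<open>C h\<close> is the orthogonal projection of the unit sequence onto the
      range of \<open>C\<close>; the remainder \<open>e\<close> is annihilated by \<open>D\<close>
      and hence fixed by \<open>R\<close>.\<close>
    define h where "h = inv S (\<psi> l)"
    define e where "e = (\<lambda>k. unit_seq l k - C h k)"
    have e: "e \<in> ell2 K"
      unfolding e_def by (intro ell2_diff analysis_ell2 fin_seqs_ell2 unit_seq_fin l)
    have De: "D e = 0"
      unfolding e_def using l
      by (simp add: synthesis_diff analysis_ell2 fin_seqs_ell2 unit_seq_fin synthesis_unit_seq h_def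
          flip: frame_operator_def)
    have Re: "(mat_vec K R ^^ n) e = e" for n
      by (induction n) (auto simp: R_vec e De analysis_def)
    \<comment> \<open>The preimage of \<open>C h\<close> under 1 - rho^N R^N is \<open>C g\<close>,
      where \<open>g\<close> solves the corresponding equation for \<open>U\<close> in the Hilbert
      space. Its distance from \<open>h\<close> is of order q^N.\<close>
    have "\<exists>g. g - \<rho> ^ (2 ^ m) *\<^sub>R (U ^^ (2 ^ m)) g = h \<and> norm (g - h) \<le> q ^ (2 ^ m) * (norm h / (1 - q))" for m
    proof -
      define N :: nat where "N = 2 ^ m"
      have N: "N > 0" by (simp add: N_def)
      have bound: "norm (\<rho> ^ N *\<^sub>R (U ^^ N) f) \<le> q ^ N * norm f" for f
      proof -
        have "norm (\<rho> ^ N *\<^sub>R (U ^^ N) f) \<le> \<rho> ^ N * (r ^ N * norm f)"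
          using \<rho> Un_norm by (auto intro!: mult_left_mono)
        then show ?thesis by (simp add: q_def power_mult_distrib mult.assoc)
      qed
      have qN: "q ^ N < 1" "q ^ N \<le> q"
        using q N power_decreasing[of 1 N q] by (auto simp: power_less_one_iff)
      obtain g where g: "g - \<rho> ^ N *\<^sub>R (U ^^ N) g = h"
        using contraction_fixed_point[of "q ^ N" "\<lambda>f. \<rho> ^ N *\<^sub>R (U ^^ N) f" h] bound qN q
        by (auto simp: Un_diff scaleR_diff_right)
      have gh: "norm (g - h) \<le> q ^ N * norm g"
        using bound[of g] by (simp flip: g)
      have "norm g \<le> norm h + norm (g - h)"
        by (metis norm_triangle_sub)
      also have "norm (g - h) \<le> q * norm g"
        using gh qN(2) by (meson mult_right_mono norm_ge_zero order_trans)
      finally have "norm g \<le> norm h / (1 - q)"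
        using q by (simp add: field_simps)
      then have "norm (g - h) \<le> q ^ N * (norm h / (1 - q))"
        using gh q by (meson mult_left_mono order_trans zero_le_power less_imp_le)
      with g show ?thesis unfolding N_def by blast
    qed
    then obtain g where g: "\<And>m. g m - \<rho> ^ (2 ^ m) *\<^sub>R (U ^^ (2 ^ m)) (g m) = h"
      "\<And>m. norm (g m - h) \<le> q ^ (2 ^ m) * (norm h / (1 - q))"
      by metis
    have filt: "filterlim (\<lambda>m::nat. (2::nat) ^ m) at_top sequentially"
      by (rule filterlim_subseq) (simp add: strict_mono_def)
    have "(\<lambda>m. q ^ (2 ^ m)) \<longlonglongrightarrow> 0"
      by (rule filterlim_compose[OF LIMSEQ_power_zero filt]) (use q in auto)
    then have "(\<lambda>m. q ^ (2 ^ m) * (norm h / (1 - q))) \<longlonglongrightarrow> 0"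
      by (rule tendsto_mult_left_zero)
    then have "(\<lambda>m. g m - h) \<longlonglongrightarrow> 0"
      by (rule Lim_null_comparison[rotated]) (use g(2) in simp)
    then have "(\<lambda>m. cinner (g m - h) (\<psi> k)) \<longlonglongrightarrow> cinner 0 (\<psi> k)"
      by (rule bounded_linear.tendsto[OF bounded_linear_cinner_left])
    then have g_lim: "(\<lambda>m. C (g m) k) \<longlonglongrightarrow> C h k"
      using k by (simp add: analysis_def cinner_diff_left LIM_zero_iff)
    have \<rho>_gt: "1 < \<rho> ^ (2 ^ m)" for m :: nat
      using \<rho> by (simp add: one_less_power)
    \<comment> \<open>The average sends \<open>C h\<close> to \<open>C (g m)\<close> and divides the
      fixed vector \<open>e\<close> by 1 - rho^N.\<close>
    have X_l: "X m k l = C (g m) k + e k / (1 - \<rho> ^ (2 ^ m))" for m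
    proof -
      let ?a = "1 - complex_of_real \<rho> ^ (2 ^ m)"
      have a: "?a \<noteq> 0"
        using \<rho>_gt[of m] by (metis eq_iff_diff_eq_0 less_irrefl of_real_1 of_real_eq_iff of_real_power)
      have "(\<lambda>k. C (g m) k - \<rho> ^ (2 ^ m) * (mat_vec K R ^^ (2 ^ m)) (C (g m)) k) = C h"
        unfolding R_C g(1)[of m, symmetric]
        by (simp add: analysis_diff analysis_scale flip: scaleC_of_real)
      then have 1: "mat_vec K (X m) (C h) = C (g m)"
        using X_inv[OF analysis_ell2, of m "g m"] by simp
      have "(\<lambda>k. e k - \<rho> ^ (2 ^ m) * (mat_vec K R ^^ (2 ^ m)) e k) = (\<lambda>k. ?a * e k)"
        unfolding Re by (simp add: algebra_simps)
      then have "(\<lambda>k. ?a * mat_vec K (X m) e k) = e"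
        using X_inv[OF e, of m] mat_vec_scale[of K "X m" ?a e] by simp
      then have 2: "mat_vec K (X m) e k = e k / ?a"
        using a by (metis nonzero_mult_div_cancel_left)
      have "(\<lambda>k. X m k l) = mat_vec K (X m) (\<lambda>k. C h k + e k)"
        using column[OF X l] by (simp add: e_def)
      also have "\<dots> = (\<lambda>k. C (g m) k + mat_vec K (X m) e k)"
        using mat_vec_add[OF X analysis_ell2 e] 1 by simp
      finally show ?thesis using 2 by (auto dest: fun_cong[of _ _ k])
    qed
    have "filterlim (\<lambda>n. \<rho> ^ n) at_top sequentially"
      using \<rho> by real_asymp
    then have "filterlim (\<lambda>m. \<rho> ^ (2 ^ m)) at_top sequentially"
      by (rule filterlim_compose[OF _ filt])
    then have "filterlim (\<lambda>m. -1 + \<rho> ^ (2 ^ m)) at_top sequentially"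
      by (intro filterlim_tendsto_add_at_top) auto
    then have "(\<lambda>m. inverse (-1 + \<rho> ^ (2 ^ m))) \<longlonglongrightarrow> 0"
      by (rule tendsto_inverse_0_at_top)
    then have "(\<lambda>m. - e k * of_real (inverse (-1 + \<rho> ^ (2 ^ m)))) \<longlonglongrightarrow> - e k * of_real 0"
      by (intro tendsto_intros)
    moreover have "- e k * of_real (inverse (-1 + \<rho> ^ (2 ^ m))) = e k / (1 - \<rho> ^ (2 ^ m))" for m
    proof -
      have "-1 + \<rho> ^ (2 ^ m) = - (1 - \<rho> ^ (2 ^ m))" by simp
      then show ?thesis by (simp only: inverse_minus_eq of_real_minus) (simp add: divide_inverse)
    qed
    ultimately have "(\<lambda>m. X m k l) \<longlonglongrightarrow> C h k + 0"
      unfolding X_l using g_lim by (intro tendsto_add) auto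
    then have "Q k l = C h k"
      using LIMSEQ_unique[OF Q(2)[of k l]] by simp
    then show ?thesis using k l
      by (simp add: gram_def analysis_def h_def dual_frame_def)
  qed
  have "Q = gram K \<psi> \<psi>'"
  proof (intro ext)
    show "Q k l = gram K \<psi> \<psi>' k l" for k l
      using Q_eq zero_outside[OF Q(1), of k l] by (auto simp: gram_def)
  qed
  then show ?thesis using Q(1) by simp
qed

text \<open>With \<open>P = G\<^bsub>\<psi>,\<psi>'\<^esub>\<close>, the projection onto the range of \<open>C\<close>, the matrix \<open>G\<^bsub>\<psi>\<^esub> + 1 - P\<close> is
  invertible with inverse \<open>G\<^bsub>\<psi>'\<^esub> + 1 - P\<close>.\<close>

theorem gram_dual_dual_mem: "gram K \<psi>' \<psi>' \<in> \<A>"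
proof -
  define P where "P = gram K \<psi>' \<psi>"
  have P: "P \<in> \<A>" using gram_dual_mem by (simp add: P_def gram_dual_commute)
  \<comment> \<open>G vanishes on the kernel of \<open>D\<close>, where 1 - P is the identity, so
    adding it repairs the failure of invertibility and inverse closedness applies.\<close>
  define E where "E = (\<lambda>k l. gram K \<psi> \<psi> k l + (mat_id K k l - P k l))"
  have E: "E \<in> \<A>" unfolding E_def by (intro add_mem diff_mem id_mem P localized)
  have E_vec: "mat_vec K E c = (\<lambda>k. C (D c) k + (c k - C (inv S (D c)) k))" if "c \<in> ell2 K" for c
    unfolding E_def P_def using that P
    by (subst mat_vec_mat_add)
      (auto simp: id_mem localized diff_mem mat_vec_mat_diff mat_vec_gram mat_vec_id ell2_iff
        analysis_dual P_def)
  have D_E: "D (mat_vec K E c) = S (D c)" if "c \<in> ell2 K" for c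
    unfolding E_vec[OF that] using that
    by (simp add: synthesis_add synthesis_diff ell2_diff analysis_ell2 flip: frame_operator_def)
  define W where "W y = (\<lambda>k. C (inv S (inv S (D y))) k + (y k - C (inv S (D y)) k))" for y
  have W: "W y \<in> ell2 K" if "y \<in> ell2 K" for y
    unfolding W_def by (intro ell2_add ell2_diff that analysis_ell2)
  have E_W: "mat_vec K E (W y) = y" if "y \<in> ell2 K" for y
  proof -
    have "D (W y) = inv S (D y)"
      unfolding W_def using that
      by (simp add: synthesis_add synthesis_diff ell2_diff analysis_ell2 flip: frame_operator_def)
    then show ?thesis
      by (simp add: E_vec W that) (simp add: W_def)
  qed
  have W_E: "W (mat_vec K E c) = c" if "c \<in> ell2 K" for c
    unfolding W_def D_E[OF that] by (simp add: E_vec that)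
  have "bij_betw (mat_vec K E) (ell2 K) (ell2 K)"
    by (rule bij_betwI[where g = W]) (auto simp: W E_W W_E mat_vec_ell2 E)
  then obtain B where B: "B \<in> \<A>" "\<And>c. c \<in> ell2 K \<Longrightarrow> mat_vec K B (mat_vec K E c) = c"
    using inverse_closed[OF E] by blast
  have "gram K \<psi>' \<psi>' = (\<lambda>k l. B k l - (mat_id K k l - P k l))"
  proof (intro ext)
    fix k l
    show "gram K \<psi>' \<psi>' k l = B k l - (mat_id K k l - P k l)"
    proof (cases "k \<in> K \<and> l \<in> K")
      case False
      then show ?thesis
        using zero_outside[OF B(1), of k l] zero_outside[OF P, of k l] zero_outside[OF id_mem, of k l]
        by (auto simp: gram_def)
    next
      case True
      have u: "unit_seq l \<in> ell2 K" using True by (simp add: fin_seqs_ell2 unit_seq_fin)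
      \<comment> \<open>\<open>B\<close> is given as a left inverse of \<open>E\<close> only;
        evaluating it on \<open>E\<close> applied to \<open>W\<close> identifies it with the
        explicit inverse.\<close>
      have "mat_vec K B (unit_seq l) = W (unit_seq l)"
        using B(2)[OF W[OF u]] E_W[OF u] by simp
      then have "B k l = W (unit_seq l) k"
        using column[OF B(1), of l] True by (auto dest: fun_cong[of _ _ k])
      then show ?thesis
        using True
        by (simp add: W_def synthesis_unit_seq gram_def analysis_def dual_frame_def P_def mat_id_def
            unit_seq_def inv_frame_operator_self_adjoint)
    qed
  qed
  then show ?thesis using B(1) P by (simp add: diff_mem id_mem)
qed

end

section \<open>Weighted sequence spaces\<close>

text \<open>Coefficients may vanish, so the endpoint 0 has to be included; there the inequality
  reduces to s^r \<le> s for 0 < s < 1.\<close>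

lemma powr_convex_nonneg: "1 \<le> r \<Longrightarrow> convex_on {0..} (\<lambda>x::real. x powr r)"
proof (rule convex_onI)
  fix t x y :: real
  assume r: "1 \<le> r" and t: "0 < t" "t < 1" and xy: "x \<in> {0..}" "y \<in> {0..}"
  have scale: "(s * u) powr r \<le> s * u powr r" if "0 < s" "s < 1" "0 \<le> u" for s u :: real
  proof -
    have "s powr r \<le> s powr 1" using that r by (intro powr_mono') auto
    then show ?thesis using that by (simp add: powr_mult mult_right_mono)
  qed
  show "((1 - t) *\<^sub>R x + t *\<^sub>R y) powr r \<le> (1 - t) * x powr r + t * y powr r"
  proof (cases "x = 0 \<or> y = 0")
    case True
    then show ?thesis using scale[of t y] scale[of "1 - t" x] t xy r by auto
  next
    case False
    then show ?thesis
      using convex_onD[OF powr_convex[OF r], of t x y] t xy by auto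
  qed
qed auto

locale lp_space =
  fixes K :: "'k set" and p :: ennreal and w :: "'k \<Rightarrow> real"
  assumes p: "1 \<le> p" and w: "weight_on K w"
begin

abbreviation "E \<equiv> ell K p w"
abbreviation "N \<equiv> ell_norm K p w"
abbreviation "r \<equiv> enn2real p"

text \<open>Membership together with a norm bound, phrased through entries and finite subsets. In
  this form it survives entrywise limits, and estimates need not handle infinite sums.\<close>

definition bounded_by :: "('k \<Rightarrow> complex) \<Rightarrow> real \<Rightarrow> bool"
  where "bounded_by c M \<longleftrightarrow> c \<in> seqs_on K \<and> 0 \<le> M \<and>
    (if p = \<infinity> then \<forall>k\<in>K. w k * cmod (c k) \<le> M
     else \<forall>F. finite F \<and> F \<subseteq> K \<longrightarrow> (\<Sum>k\<in>F. (w k * cmod (c k)) powr r) \<le> M powr r)"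

lemma w_pos: "k \<in> K \<Longrightarrow> 0 < w k"
  using w by (simp add: weight_on_def)

lemma r_ge_1: "p \<noteq> \<infinity> \<Longrightarrow> 1 \<le> r"
  using p by (cases p) auto

lemma powr_r_inverse: "p \<noteq> \<infinity> \<Longrightarrow> 0 \<le> x \<Longrightarrow> (x powr r) powr (1 / r) = x"
  using r_ge_1 by (simp add: powr_powr)

lemma powr_inverse_r: "p \<noteq> \<infinity> \<Longrightarrow> 0 \<le> x \<Longrightarrow> (x powr (1 / r)) powr r = x"
  using r_ge_1 by (simp add: powr_powr)

lemma norm_nonneg: "c \<in> E \<Longrightarrow> 0 \<le> N c"
  by (auto simp: ell_def ell_norm_def intro!: cSup_upper)

lemma bounded_by_iff: "bounded_by c M \<longleftrightarrow> c \<in> E \<and> N c \<le> M"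
proof (cases "p = \<infinity>")
  case True
  show ?thesis
  proof
    assume "bounded_by c M"
    then show "c \<in> E \<and> N c \<le> M"
      using True unfolding bounded_by_def ell_def ell_norm_def by (auto intro!: cSup_least)
  next
    assume *: "c \<in> E \<and> N c \<le> M"
    then have bdd: "bdd_above (insert 0 ((\<lambda>k. w k * cmod (c k)) ` K))"
      using True by (auto simp: ell_def)
    have "w k * cmod (c k) \<le> N c" if "k \<in> K" for k
      unfolding ell_norm_def using True bdd that by (auto intro: cSup_upper)
    then show "bounded_by c M"
      using True * norm_nonneg[of c] unfolding bounded_by_def ell_def by force
  qed
next
  case False
  define g where "g k = (w k * cmod (c k)) powr r" for k
  have N: "N c = infsum g K powr (1 / r)" using False by (simp add: ell_norm_def g_def[abs_def])
  have E: "c \<in> E \<longleftrightarrow> c \<in> seqs_on K \<and> g summable_on K"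
    using False by (simp add: ell_def g_def[abs_def])
  have g: "0 \<le> g k" for k by (simp add: g_def)
  have r: "1 \<le> r" using r_ge_1[OF False] .
  show ?thesis
  proof
    assume *: "bounded_by c M"
    then have fin: "sum g F \<le> M powr r" if "finite F" "F \<subseteq> K" for F
      using False that by (auto simp: bounded_by_def g_def)
    have sm: "g summable_on K"
      using fin g by (intro nonneg_bdd_above_summable_on) (auto simp: bdd_above_def)
    then have "infsum g K \<le> M powr r"
      using fin by (intro infsum_le_finite_sums) auto
    then have "N c \<le> (M powr r) powr (1 / r)"
      unfolding N using g r by (intro powr_mono2 infsum_nonneg) auto
    also have "\<dots> = M" using * False by (intro powr_r_inverse) (auto simp: bounded_by_def)
    finally show "c \<in> E \<and> N c \<le> M" using sm * E by (auto simp: bounded_by_def)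
  next
    assume *: "c \<in> E \<and> N c \<le> M"
    have "sum g F \<le> M powr r" if "finite F" "F \<subseteq> K" for F
    proof -
      have "sum g F \<le> infsum g K" using * E g that by (intro finite_sum_le_infsum) auto
      also have "\<dots> = (N c) powr r"
        unfolding N using g by (intro powr_inverse_r[symmetric] False infsum_nonneg) auto
      also have "\<dots> \<le> M powr r"
        using * norm_nonneg[of c] r by (intro powr_mono2) auto
      finally show ?thesis .
    qed
    then show "bounded_by c M"
      using False * norm_nonneg[of c] E by (auto simp: bounded_by_def g_def)
  qed
qed

lemma bounded_by_norm: "c \<in> E \<Longrightarrow> bounded_by c (N c)"
  by (simp add: bounded_by_iff)

lemma entry_le: "bounded_by c M \<Longrightarrow> k \<in> K \<Longrightarrow> w k * cmod (c k) \<le> M"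
proof (cases "p = \<infinity>")
  case False
  assume *: "bounded_by c M" and k: "k \<in> K"
  then have "(\<Sum>k\<in>{k}. (w k * cmod (c k)) powr r) \<le> M powr r"
    using False unfolding bounded_by_def by (metis empty_subsetI finite.emptyI finite.insertI insert_subset)
  then have a: "(w k * cmod (c k)) powr r \<le> M powr r" by simp
  have "((w k * cmod (c k)) powr r) powr (1 / r) \<le> (M powr r) powr (1 / r)"
    by (rule powr_mono2) (use a r_ge_1[OF False] in auto)
  moreover have "0 \<le> w k * cmod (c k)" using w_pos[OF k] by simp
  moreover have "0 \<le> M" using * by (simp add: bounded_by_def)
  ultimately show ?thesis by (simp only: powr_r_inverse[OF False])
next
  case True
  assume "bounded_by c M" "k \<in> K"
  then show ?thesis unfolding bounded_by_def using True by simp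
qed

lemma bounded_by_scale:
  assumes "bounded_by c M"
  shows "bounded_by (\<lambda>k. a * c k) (cmod a * M)"
proof -
  have "(\<Sum>k\<in>F. (w k * cmod (a * c k)) powr r) \<le> (cmod a * M) powr r"
    if "p \<noteq> \<infinity>" "finite F" "F \<subseteq> K" for F
  proof -
    have "(\<Sum>k\<in>F. (w k * cmod (a * c k)) powr r) = cmod a powr r * (\<Sum>k\<in>F. (w k * cmod (c k)) powr r)"
      unfolding sum_distrib_left
    proof (intro sum.cong refl)
      fix k assume "k \<in> F"
      then have "0 \<le> w k" using that w_pos by force
      then show "(w k * cmod (a * c k)) powr r = cmod a powr r * (w k * cmod (c k)) powr r"
        by (simp add: norm_mult mult.left_commute[of "w k"] powr_mult)
    qed
    also have "\<dots> \<le> cmod a powr r * M powr r"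
      using assms that by (intro mult_left_mono) (auto simp: bounded_by_def)
    finally show ?thesis using assms by (simp add: powr_mult bounded_by_def)
  qed
  moreover have "w k * cmod (a * c k) \<le> cmod a * M" if "k \<in> K" for k
    using mult_left_mono[OF entry_le[OF assms that], of "cmod a"] by (simp add: norm_mult mult_ac)
  ultimately show ?thesis
    using assms by (auto simp: bounded_by_def seqs_on_def)
qed

text \<open>Minkowski's inequality by convexity: the sum divided by M + L is a convex combination of
  c / M and d / L with weights M / (M + L) and L / (M + L). The radii are positive so that they can
  be divided by.\<close>

lemma bounded_by_add_pos:
  assumes c: "bounded_by c M" and d: "bounded_by d L" and pos: "0 < M" "0 < L"
  shows "bounded_by (\<lambda>k. c k + d k) (M + L)"
proof -
  have tri: "w k * cmod (c k + d k) \<le> w k * cmod (c k) + w k * cmod (d k)" if "k \<in> K" for k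
    using mult_left_mono[OF norm_triangle_ineq[of "c k" "d k"], of "w k"] w_pos[OF that]
    by (simp add: distrib_left)
  have "(\<Sum>k\<in>F. (w k * cmod (c k + d k)) powr r) \<le> (M + L) powr r"
    if "p \<noteq> \<infinity>" and F: "finite F" "F \<subseteq> K" for F
  proof -
    have r: "1 \<le> r" using r_ge_1 that by simp
    define t where "t = L / (M + L)"
    have t: "0 < t" "t < 1" "1 - t = M / (M + L)"
      using pos by (auto simp: t_def divide_simps)
    define x y where "x k = w k * cmod (c k)" and "y k = w k * cmod (d k)" for k
    have summand: "(w k * cmod (c k + d k)) powr r \<le>
        (M + L) powr r * ((1 - t) * (x k powr r / M powr r) + t * (y k powr r / L powr r))"
      if k: "k \<in> F" for k
    proof -
      have kK: "k \<in> K" using k F by auto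
      have nn: "0 \<le> x k" "0 \<le> y k" using w_pos[OF kK] by (auto simp: x_def y_def)
      have "(w k * cmod (c k + d k)) powr r \<le> (x k + y k) powr r"
        using tri[OF kK] w_pos[OF kK] r by (intro powr_mono2) (auto simp: x_def y_def)
      also have "x k + y k = (M + L) * ((1 - t) *\<^sub>R (x k / M) + t *\<^sub>R (y k / L))"
      proof -
        have "(M + L) * ((M / (M + L)) * (x k / M)) = x k" "(M + L) * ((L / (M + L)) * (y k / L)) = y k"
          using pos by auto
        then show ?thesis unfolding t(3) real_scaleR_def distrib_left by (simp add: t_def)
      qed
      also have "\<dots> powr r = (M + L) powr r * ((1 - t) *\<^sub>R (x k / M) + t *\<^sub>R (y k / L)) powr r"
        by (rule powr_mult)
      also have "\<dots> \<le> (M + L) powr r * ((1 - t) * (x k / M) powr r + t * (y k / L) powr r)"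
        using convex_onD[OF powr_convex_nonneg[OF r], of t "x k / M" "y k / L"] t nn pos
        by (intro mult_left_mono) auto
      finally show ?thesis using nn pos by (simp add: powr_divide)
    qed
    have "(\<Sum>k\<in>F. (w k * cmod (c k + d k)) powr r) \<le>
        (\<Sum>k\<in>F. (M + L) powr r * ((1 - t) * (x k powr r / M powr r) + t * (y k powr r / L powr r)))"
      by (intro sum_mono summand)
    also have "\<dots> = (M + L) powr r *
        ((1 - t) * ((\<Sum>k\<in>F. x k powr r) / M powr r) + t * ((\<Sum>k\<in>F. y k powr r) / L powr r))"
      by (simp add: sum_distrib_left sum_divide_distrib sum.distrib distrib_left)
    also have "\<dots> \<le> (M + L) powr r * ((1 - t) * 1 + t * 1)"
      using c d t pos F \<open>p \<noteq> \<infinity>\<close>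
      by (intro mult_left_mono add_mono) (auto simp: bounded_by_def x_def y_def)
    finally show ?thesis by simp
  qed
  moreover have "w k * cmod (c k + d k) \<le> M + L" if "k \<in> K" for k
    using tri[OF that] entry_le[OF c that] entry_le[OF d that] by simp
  ultimately show ?thesis
    using c d by (auto simp: bounded_by_def seqs_on_def)
qed

lemma bounded_by_mono: "bounded_by c M \<Longrightarrow> M \<le> L \<Longrightarrow> bounded_by c L"
  by (auto simp: bounded_by_iff)

lemma bounded_by_add:
  assumes c: "bounded_by c M" and d: "bounded_by d L"
  shows "bounded_by (\<lambda>k. c k + d k) (M + L)"
proof -
  \<comment> \<open>Enlarging both radii by \<open>e\<close> makes them positive; the surplus is
    removed in the norm afterwards.\<close>
  have *: "bounded_by (\<lambda>k. c k + d k) ((M + e) + (L + e))" if "0 < e" for e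
    using c d that
    by (intro bounded_by_add_pos bounded_by_mono[OF c] bounded_by_mono[OF d])
      (auto simp: bounded_by_def)
  have "N (\<lambda>k. c k + d k) \<le> M + L"
  proof (rule field_le_epsilon)
    fix e :: real assume "0 < e"
    then show "N (\<lambda>k. c k + d k) \<le> M + L + e"
      using *[of "e / 2"] by (simp add: bounded_by_iff)
  qed
  then show ?thesis using *[of 1] by (simp add: bounded_by_iff)
qed

lemma bounded_by_diff:
  assumes "bounded_by c M" "bounded_by d L"
  shows "bounded_by (\<lambda>k. c k - d k) (M + L)"
  using bounded_by_add[OF assms(1) bounded_by_scale[OF assms(2), of "-1"]] by simp

lemma ell_add: "c \<in> E \<Longrightarrow> d \<in> E \<Longrightarrow> (\<lambda>k. c k + d k) \<in> E"
  using bounded_by_add[of c "N c" d "N d"] by (auto simp: bounded_by_iff)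

lemma ell_diff: "c \<in> E \<Longrightarrow> d \<in> E \<Longrightarrow> (\<lambda>k. c k - d k) \<in> E"
  using bounded_by_diff[of c "N c" d "N d"] by (auto simp: bounded_by_iff)

lemma ell_scale: "c \<in> E \<Longrightarrow> (\<lambda>k. a * c k) \<in> E"
  using bounded_by_scale[of c "N c" a] by (auto simp: bounded_by_iff)

lemma norm_scale_le: "c \<in> E \<Longrightarrow> N (\<lambda>k. a * c k) \<le> cmod a * N c"
  using bounded_by_scale[of c "N c" a] by (auto simp: bounded_by_iff)

lemma norm_triangle: "c \<in> E \<Longrightarrow> d \<in> E \<Longrightarrow> N (\<lambda>k. c k + d k) \<le> N c + N d"
  using bounded_by_add[of c "N c" d "N d"] by (auto simp: bounded_by_iff)

lemma norm_minus_commute: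
  assumes "c \<in> E" "d \<in> E"
  shows "N (\<lambda>k. c k - d k) = N (\<lambda>k. d k - c k)"
  using norm_scale_le[OF ell_diff[OF assms], of "-1"] norm_scale_le[OF ell_diff[OF assms(2,1)], of "-1"]
  by simp

lemma norm_triangle_diff:
  assumes "c \<in> E" "d \<in> E" "e \<in> E"
  shows "N (\<lambda>k. c k - e k) \<le> N (\<lambda>k. c k - d k) + N (\<lambda>k. d k - e k)"
  using norm_triangle[OF ell_diff[OF assms(1,2)] ell_diff[OF assms(2,3)]] by simp

lemma norm_triangle_sub: "c \<in> E \<Longrightarrow> d \<in> E \<Longrightarrow> N c \<le> N d + N (\<lambda>k. c k - d k)"
  using norm_triangle[OF _ ell_diff, of d c d] by simp

lemma entry_le_norm: "c \<in> E \<Longrightarrow> k \<in> K \<Longrightarrow> w k * cmod (c k) \<le> N c"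
  by (rule entry_le[OF bounded_by_norm])

lemma entry_tendsto_0:
  assumes "\<And>n. x n \<in> E" "((\<lambda>n. N (x n)) \<longlongrightarrow> 0) F"
  shows "((\<lambda>n. x n k) \<longlongrightarrow> 0) F"
proof (cases "k \<in> K")
  case True
  have "((\<lambda>n. N (x n) / w k) \<longlongrightarrow> 0) F"
    using tendsto_divide[OF assms(2) tendsto_const[of "w k"]] w_pos[OF True] by simp
  then show ?thesis
  proof (rule Lim_null_comparison[rotated])
    show "\<forall>\<^sub>F n in F. cmod (x n k) \<le> N (x n) / w k"
      using entry_le_norm[OF assms(1) True] w_pos[OF True] by (simp add: field_simps)
  qed
next
  case False
  then have "x n k = 0" for n using assms(1) by (auto simp: ell_def seqs_on_def)
  then show ?thesis by simp
qed

lemma norm_tendsto: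
  assumes "\<And>n. x n \<in> E" "c \<in> E" "((\<lambda>n. N (\<lambda>k. x n k - c k)) \<longlongrightarrow> 0) F"
  shows "((\<lambda>n. N (x n)) \<longlongrightarrow> N c) F"
proof -
  have "\<bar>N (x n) - N c\<bar> \<le> N (\<lambda>k. x n k - c k)" for n
    using norm_triangle_sub[OF assms(1,2), of n] norm_triangle_sub[OF assms(2,1), of n]
      norm_minus_commute[OF assms(2,1), of n] by simp
  then have "((\<lambda>n. N (x n) - N c) \<longlongrightarrow> 0) F"
    by (intro Lim_null_comparison[OF _ assms(3)]) auto
  then show ?thesis by (simp add: LIM_zero_iff)
qed

text \<open>A form of Fatou's lemma for arbitrary filters. It is the substitute for norm convergence
  when p = \<infinity>.\<close>

lemma bounded_by_limit:
  assumes F: "F \<noteq> bot" and bd: "\<forall>\<^sub>F n in F. bounded_by (x n) M"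
    and c: "c \<in> seqs_on K" "\<And>k. k \<in> K \<Longrightarrow> ((\<lambda>n. x n k) \<longlongrightarrow> c k) F"
  shows "bounded_by c M"
proof -
  have M: "0 \<le> M"
    using eventually_happens[OF bd] F by (auto simp: bounded_by_def)
  have "w k * cmod (c k) \<le> M" if "k \<in> K" for k
  proof (rule tendsto_upperbound[OF _ _ F])
    show "((\<lambda>n. w k * cmod (x n k)) \<longlongrightarrow> w k * cmod (c k)) F"
      by (intro tendsto_intros c that)
  qed (use bd entry_le that in \<open>auto elim: eventually_mono\<close>)
  moreover have "(\<Sum>k\<in>S. (w k * cmod (c k)) powr r) \<le> M powr r"
    if "p \<noteq> \<infinity>" "finite S" "S \<subseteq> K" for S
  proof (rule tendsto_upperbound[OF _ _ F])
    show "((\<lambda>n. \<Sum>k\<in>S. (w k * cmod (x n k)) powr r) \<longlongrightarrow> (\<Sum>k\<in>S. (w k * cmod (c k)) powr r)) F"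
      using r_ge_1[OF that(1)] that w_pos
      by (intro tendsto_sum tendsto_powr' tendsto_intros c) (auto simp: subset_iff less_imp_le)
    show "\<forall>\<^sub>F n in F. (\<Sum>k\<in>S. (w k * cmod (x n k)) powr r) \<le> M powr r"
      using bd by eventually_elim (use that in \<open>auto simp: bounded_by_def\<close>)
  qed
  ultimately show ?thesis using c M by (auto simp: bounded_by_def)
qed

text \<open>Entries converge because the norm controls them; the Fatou property then turns Cauchy
  estimates between terms into estimates against the entrywise limit.\<close>

lemma complete:
  assumes x: "\<And>n. x n \<in> E"
    and cauchy: "\<And>e. 0 < e \<Longrightarrow> \<exists>n0. \<forall>m\<ge>n0. \<forall>n\<ge>n0. N (\<lambda>k. x m k - x n k) < e"
  shows "\<exists>c\<in>E. (\<lambda>n. N (\<lambda>k. x n k - c k)) \<longlonglongrightarrow> 0"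
proof -
  have "convergent (\<lambda>n. x n k)" if k: "k \<in> K" for k
  proof -
    have "Cauchy (\<lambda>n. x n k)"
    proof (rule CauchyI)
      fix e :: real assume e: "0 < e"
      then obtain n0 where n0: "\<And>m n. m \<ge> n0 \<Longrightarrow> n \<ge> n0 \<Longrightarrow> N (\<lambda>k. x m k - x n k) < w k * e"
        using cauchy[of "w k * e"] w_pos[OF k] by auto
      show "\<exists>n0. \<forall>m\<ge>n0. \<forall>n\<ge>n0. cmod (x m k - x n k) < e"
      proof (intro exI allI impI)
        fix m n assume "m \<ge> n0" "n \<ge> n0"
        then have "w k * cmod (x m k - x n k) < w k * e"
          using entry_le_norm[OF ell_diff[OF x x] k, of m n] n0[of m n] by simp
        then show "cmod (x m k - x n k) < e" using w_pos[OF k] by simp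
      qed
    qed
    then show ?thesis by (simp add: Cauchy_convergent_iff)
  qed
  define c where "c k = (if k \<in> K then lim (\<lambda>n. x n k) else 0)" for k
  have c: "c \<in> seqs_on K" "\<And>k. k \<in> K \<Longrightarrow> (\<lambda>n. x n k) \<longlonglongrightarrow> c k"
    using \<open>\<And>k. k \<in> K \<Longrightarrow> convergent (\<lambda>n. x n k)\<close>
    by (auto simp: c_def seqs_on_def convergent_LIMSEQ_iff)
  have bd: "bounded_by (\<lambda>k. x m k - c k) e"
    if "\<And>n. n \<ge> n0 \<Longrightarrow> N (\<lambda>k. x m k - x n k) < e" for m n0 e
  proof (rule bounded_by_limit[where F = sequentially and x = "\<lambda>n k. x m k - x n k"])
    show "\<forall>\<^sub>F n in sequentially. bounded_by (\<lambda>k. x m k - x n k) e"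
      using that x
      by (auto simp: bounded_by_iff eventually_sequentially intro!: ell_diff less_imp_le exI[of _ n0])
    show "(\<lambda>k. x m k - c k) \<in> seqs_on K"
      using x[of m] c(1) by (auto simp: ell_def seqs_on_def)
  qed (auto intro!: tendsto_intros c)
  obtain n1 where "\<And>n. n \<ge> n1 \<Longrightarrow> N (\<lambda>k. x n1 k - x n k) < 1"
    using cauchy[of 1] by auto
  then have "(\<lambda>k. x n1 k - c k) \<in> E" using bd by (auto simp: bounded_by_iff)
  then have cE: "c \<in> E" using ell_diff[OF x[of n1], of "\<lambda>k. x n1 k - c k"] by simp
  have "(\<lambda>n. N (\<lambda>k. x n k - c k)) \<longlonglongrightarrow> 0"
  proof (rule LIMSEQ_I)
    fix e :: real assume e: "0 < e"
    then obtain n0 where n0: "\<And>m n. m \<ge> n0 \<Longrightarrow> n \<ge> n0 \<Longrightarrow> N (\<lambda>k. x m k - x n k) < e / 2"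
      using cauchy[of "e / 2"] by auto
    have "norm (N (\<lambda>k. x m k - c k) - 0) < e" if "m \<ge> n0" for m
      using bd[of n0 m "e / 2"] n0 that e norm_nonneg[OF ell_diff[OF x cE], of m]
      by (auto simp: bounded_by_iff)
    then show "\<exists>n0. \<forall>m\<ge>n0. norm (N (\<lambda>k. x m k - c k) - 0) < e" by blast
  qed
  with cE show ?thesis by blast
qed

section \<open>Truncation to subsets of the index set\<close>

definition restrict_seq :: "'k set \<Rightarrow> ('k \<Rightarrow> complex) \<Rightarrow> 'k \<Rightarrow> complex"
  where "restrict_seq F c k = (if k \<in> F then c k else 0)"

lemma bounded_by_domain:
  assumes c: "bounded_by c M" and dc: "\<And>k. cmod (d k) \<le> cmod (c k)"
  shows "bounded_by d M"
proof -
  have le: "w k * cmod (d k) \<le> w k * cmod (c k)" if "k \<in> K" for k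
    using w_pos[OF that] dc by simp
  have "(\<Sum>k\<in>F. (w k * cmod (d k)) powr r) \<le> M powr r" if "p \<noteq> \<infinity>" "finite F" "F \<subseteq> K" for F
  proof -
    have "(\<Sum>k\<in>F. (w k * cmod (d k)) powr r) \<le> (\<Sum>k\<in>F. (w k * cmod (c k)) powr r)"
    proof (intro sum_mono powr_mono2)
      fix k assume "k \<in> F"
      then have "k \<in> K" using that by auto
      then show "0 \<le> w k * cmod (d k)" "w k * cmod (d k) \<le> w k * cmod (c k)"
        using w_pos[of k] le by auto
    qed (use r_ge_1 that in auto)
    also have "\<dots> \<le> M powr r" using c that by (auto simp: bounded_by_def)
    finally show ?thesis .
  qed
  moreover have "w k * cmod (d k) \<le> M" if "k \<in> K" for k
    using le[OF that] entry_le[OF c that] by simp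
  moreover have "d \<in> seqs_on K"
    unfolding seqs_on_def
  proof (intro CollectI allI impI)
    show "d k = 0" if "k \<notin> K" for k
      using dc[of k] c that by (simp add: bounded_by_def seqs_on_def)
  qed
  ultimately show ?thesis using c by (simp add: bounded_by_def)
qed

lemma restrict_bounded_by: "bounded_by c M \<Longrightarrow> bounded_by (restrict_seq F c) M"
  by (rule bounded_by_domain) (auto simp: restrict_seq_def)

lemma restrict_ell: "c \<in> E \<Longrightarrow> restrict_seq F c \<in> E"
  using restrict_bounded_by[OF bounded_by_norm] by (simp add: bounded_by_iff)

lemma restrict_tendsto_entry:
  assumes "k \<in> K"
  shows "((\<lambda>F. restrict_seq F c k) \<longlongrightarrow> c k) (finite_subsets_at_top K)"
proof (rule tendsto_eventually)
  show "\<forall>\<^sub>F F in finite_subsets_at_top K. restrict_seq F c k = c k"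
    using assms unfolding eventually_finite_subsets_at_top
    by (intro exI[of _ "{k}"]) (auto simp: restrict_seq_def)
qed

text \<open>For p = \<infinity> this can fail, which is why synthesis is then treated with bounded
  entrywise and weak-* limits.\<close>

lemma restrict_tendsto:
  assumes c: "c \<in> E" and fin: "p \<noteq> \<infinity>"
  shows "((\<lambda>F. N (\<lambda>k. restrict_seq F c k - c k)) \<longlongrightarrow> 0) (finite_subsets_at_top K)"
proof -
  define g where "g k = (w k * cmod (c k)) powr r" for k
  have sm: "g summable_on K" using c fin by (simp add: ell_def g_def[abs_def])
  have "((\<lambda>F. sum g F) \<longlongrightarrow> infsum g K) (finite_subsets_at_top K)"
    by (rule infsum_tendsto[OF sm])
  then have "((\<lambda>F. infsum g K - sum g F) \<longlongrightarrow> infsum g K - infsum g K) (finite_subsets_at_top K)"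
    by (intro tendsto_intros)
  then have lim: "((\<lambda>F. infsum g K - sum g F) \<longlongrightarrow> 0) (finite_subsets_at_top K)"
    by simp
  have lim_powr: "((\<lambda>F. (infsum g K - sum g F) powr (1 / r)) \<longlongrightarrow> 0) (finite_subsets_at_top K)"
  proof (rule tendsto_zero_powrI[OF lim tendsto_const])
    show "\<forall>\<^sub>F F in finite_subsets_at_top K. 0 \<le> infsum g K - sum g F"
      using finite_sum_le_infsum[OF sm] by (intro eventually_finite_subsets_at_top_weakI) (auto simp: g_def)
    show "0 < 1 / r" using r_ge_1[OF fin] by simp
  qed
  have eq: "N (\<lambda>k. restrict_seq F c k - c k) = (infsum g K - sum g F) powr (1 / r)"
    if F: "finite F" "F \<subseteq> K" for F
  proof -
    have "(\<Sum>\<^sub>\<infinity>k\<in>K. (w k * cmod (restrict_seq F c k - c k)) powr r) = infsum g (K - F)"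
      by (rule infsum_cong_neutral) (auto simp: restrict_seq_def g_def)
    also have "\<dots> = infsum g K - infsum g F"
      using F sm by (intro infsum_Diff) auto
    finally show ?thesis using F fin by (simp add: ell_norm_def)
  qed
  show ?thesis
    by (rule Lim_transform_eventually[OF lim_powr])
      (rule eventually_finite_subsets_at_top_weakI, simp only: eq)
qed

lemma fin_seqs_ell:
  assumes "c \<in> fin_seqs K"
  shows "c \<in> E"
proof -
  have fin: "finite {k. c k \<noteq> 0}" and c: "c \<in> seqs_on K" using assms by (auto simp: fin_seqs_def)
  show ?thesis
  proof (cases "p = \<infinity>")
    case True
    have "(\<lambda>k. w k * cmod (c k)) ` K \<subseteq> insert 0 ((\<lambda>k. w k * cmod (c k)) ` {k. c k \<noteq> 0})" by auto
    then have "finite ((\<lambda>k. w k * cmod (c k)) ` K)"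
      using fin by (meson finite_imageI finite_insert finite_subset)
    then show ?thesis using True c by (simp add: ell_def)
  next
    case False
    have "(\<lambda>k. (w k * cmod (c k)) powr r) summable_on K"
      by (rule finite_nonzero_values_imp_summable_on) (auto intro: finite_subset[OF _ fin])
    then show ?thesis using False c by (simp add: ell_def)
  qed
qed

end

section \<open>Schur's test\<close>

text \<open>Dominated convergence for unconditional sums along an arbitrary filter, as needed for
  the net of finite subsets. The Weierstrass test makes the partial sums converge uniformly, which
  permits the exchange of limits.\<close>

lemma tendsto_infsum_dominated:
  fixes f :: "'n \<Rightarrow> 'a \<Rightarrow> 'b::banach" and g :: "'a \<Rightarrow> real"
  assumes g: "g summable_on A" and le: "\<And>n x. x \<in> A \<Longrightarrow> norm (f n x) \<le> g x"
    and lim: "\<And>x. x \<in> A \<Longrightarrow> ((\<lambda>n. f n x) \<longlongrightarrow> l x) F"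
  shows "((\<lambda>n. infsum (f n) A) \<longlongrightarrow> infsum l A) F"
proof (cases "F = bot")
  case False
  have l: "l summable_on A"
  proof -
    have "norm (l x) \<le> g x" if "x \<in> A" for x
      by (rule tendsto_upperbound[OF tendsto_norm[OF lim[OF that]] _ False]) (use le that in auto)
    then have "(\<lambda>x. norm (l x)) summable_on A"
      by (intro summable_on_comparison_test[OF g]) auto
    then show ?thesis by (rule abs_summable_summable)
  qed
  show ?thesis
  proof (rule swap_uniform_limit'[where F = "finite_subsets_at_top A" and S = UNIV])
    show "uniform_limit UNIV (\<lambda>X n. \<Sum>x\<in>X. f n x) (\<lambda>n. infsum (f n) A) (finite_subsets_at_top A)"
      by (rule Weierstrass_m_test_general[OF _ g]) (use le in auto)
    show "\<forall>\<^sub>F X in finite_subsets_at_top A. ((\<lambda>n. \<Sum>x\<in>X. f n x) \<longlongrightarrow> (\<Sum>x\<in>X. l x)) F"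
      by (intro eventually_finite_subsets_at_top_weakI tendsto_sum lim) auto
    show "((\<lambda>X. \<Sum>x\<in>X. l x) \<longlongrightarrow> infsum l A) (finite_subsets_at_top A)"
      by (rule infsum_tendsto[OF l])
  qed auto
qed simp

text \<open>The conditions of Schur's test for the matrix conjugated by the weight. They do not
  involve the exponent, and passing to the adjoint and the reciprocal weight merely exchanges rows
  and columns.\<close>

definition schur_bounded :: "'k set \<Rightarrow> ('k \<Rightarrow> real) \<Rightarrow> ('k \<Rightarrow> 'k \<Rightarrow> complex) \<Rightarrow> real \<Rightarrow> bool"
  where "schur_bounded K w A B \<longleftrightarrow> 0 \<le> B \<and>
    (\<forall>k\<in>K. \<forall>F. finite F \<and> F \<subseteq> K \<longrightarrow> (\<Sum>l\<in>F. w k * cmod (A k l) / w l) \<le> B) \<and>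
    (\<forall>l\<in>K. \<forall>F. finite F \<and> F \<subseteq> K \<longrightarrow> (\<Sum>k\<in>F. w k * cmod (A k l) / w l) \<le> B)"

text \<open>\<open>M / w l\<close> majorizes the entries of every sequence of norm at most
  \<open>M\<close>, so the first series is the dominating one in later limits.\<close>

lemma schur_row_summable:
  assumes A: "schur_bounded K w A B" and k: "k \<in> K" and w: "\<And>k. k \<in> K \<Longrightarrow> 0 < w k"
  shows "(\<lambda>l. cmod (A k l) * (M / w l)) summable_on K"
    and "w k * (\<Sum>\<^sub>\<infinity>l\<in>K. cmod (A k l) / w l) \<le> B"
proof -
  have fin: "(\<Sum>l\<in>F. cmod (A k l) / w l) \<le> B / w k" if "finite F" "F \<subseteq> K" for F
  proof -
    have "w k * (\<Sum>l\<in>F. cmod (A k l) / w l) \<le> B"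
      using A k that by (simp add: schur_bounded_def sum_distrib_left)
    then show ?thesis using w[OF k] by (simp add: field_simps)
  qed
  have sm: "(\<lambda>l. cmod (A k l) / w l) summable_on K"
    using fin w by (intro nonneg_bdd_above_summable_on)
      (auto simp: bdd_above_def less_imp_le intro!: divide_nonneg_nonneg)
  then show "(\<lambda>l. cmod (A k l) * (M / w l)) summable_on K"
    using summable_on_cmult_right[OF sm, of M] by (simp add: mult_ac)
  have "(\<Sum>\<^sub>\<infinity>l\<in>K. cmod (A k l) / w l) \<le> B / w k"
    using sm fin by (intro infsum_le_finite_sums) auto
  then show "w k * (\<Sum>\<^sub>\<infinity>l\<in>K. cmod (A k l) / w l) \<le> B"
    using w[OF k] by (simp add: field_simps)
qed

text \<open>Jensen's inequality for weights of total mass at most \<open>B\<close> instead of 1;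
  normalizing by the actual mass costs the factor B^(r-1). In Schur's test it plays the part of
  Hoelder's inequality.\<close>

lemma weighted_jensen:
  fixes b x :: "'a \<Rightarrow> real"
  assumes "finite F" and b: "\<And>l. l \<in> F \<Longrightarrow> 0 \<le> b l" "sum b F \<le> B" and x: "\<And>l. l \<in> F \<Longrightarrow> 0 \<le> x l"
    and r: "1 \<le> r"
  shows "(\<Sum>l\<in>F. b l * x l) powr r \<le> B powr (r - 1) * (\<Sum>l\<in>F. b l * x l powr r)"
proof (cases "sum b F = 0")
  case True
  then have "b l = 0" if "l \<in> F" for l
    using b that \<open>finite F\<close> by (simp add: sum_nonneg_eq_0_iff)
  then show ?thesis by simp
next
  case False
  define s where "s = sum b F"
  have s: "0 < s" "s \<le> B" using False b sum_nonneg[of F b] by (auto simp: s_def less_le)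
  have nn: "0 \<le> (\<Sum>l\<in>F. b l / s * x l)" using b x s by (intro sum_nonneg) auto
  have "(\<Sum>l\<in>F. b l / s * x l) powr r \<le> (\<Sum>l\<in>F. b l / s * x l powr r)"
  proof -
    have "F \<noteq> {}" using False by auto
    moreover have "(\<Sum>l\<in>F. b l / s) = 1"
      using s by (simp add: s_def flip: sum_divide_distrib)
    ultimately show ?thesis
      using convex_on_sum[OF \<open>finite F\<close> _ powr_convex_nonneg[OF r], of "\<lambda>l. b l / s" x] b x s by simp
  qed
  then have "s powr r * (\<Sum>l\<in>F. b l / s * x l) powr r \<le> s powr r * (\<Sum>l\<in>F. b l / s * x l powr r)"
    by (intro mult_left_mono) auto
  moreover have "(\<Sum>l\<in>F. b l * x l) = s * (\<Sum>l\<in>F. b l / s * x l)"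
    using s by (simp add: sum_distrib_left)
  then have "(\<Sum>l\<in>F. b l * x l) powr r = s powr r * (\<Sum>l\<in>F. b l / s * x l) powr r"
    by (simp only: powr_mult)
  moreover have "s powr r * (\<Sum>l\<in>F. b l / s * x l powr r) = s powr (r - 1) * (\<Sum>l\<in>F. b l * x l powr r)"
    using s by (simp add: powr_diff sum_distrib_left)
  moreover have "s powr (r - 1) * (\<Sum>l\<in>F. b l * x l powr r) \<le> B powr (r - 1) * (\<Sum>l\<in>F. b l * x l powr r)"
    using s r b by (intro mult_right_mono powr_mono2 sum_nonneg) auto
  ultimately show ?thesis by linarith
qed

context lp_space
begin

lemma cmod_le_weight: "bounded_by c M \<Longrightarrow> l \<in> K \<Longrightarrow> cmod (c l) \<le> M / w l"
  using entry_le[of c M l] w_pos[of l] by (simp add: field_simps)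

lemma schur_summable:
  assumes A: "schur_bounded K w A B" and c: "bounded_by c M" and k: "k \<in> K"
  shows "(\<lambda>l. cmod (A k l) * cmod (c l)) summable_on K" "(\<lambda>l. A k l * c l) summable_on K"
proof -
  show *: "(\<lambda>l. cmod (A k l) * cmod (c l)) summable_on K"
    by (rule summable_on_comparison_test[OF schur_row_summable(1)[OF A k w_pos, of M]])
      (use cmod_le_weight[OF c] in \<open>auto intro!: mult_left_mono simp del: times_divide_eq_right\<close>)
  then show "(\<lambda>l. A k l * c l) summable_on K"
    by - (rule abs_summable_summable, simp add: norm_mult)
qed

text \<open>Bounded entrywise convergence is preserved by the matrix. Unlike approximation in norm
  by finite sequences, this is available for p = \<infinity> as well.\<close>

lemma mat_vec_tendsto:
  assumes A: "schur_bounded K w A B" and c: "\<And>n. bounded_by (c n) M"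
    and lim: "\<And>l. l \<in> K \<Longrightarrow> ((\<lambda>n. c n l) \<longlongrightarrow> d l) F"
  shows "((\<lambda>n. mat_vec K A (c n) k) \<longlongrightarrow> mat_vec K A d k) F"
proof (cases "k \<in> K")
  case k: True
  have "((\<lambda>n. \<Sum>\<^sub>\<infinity>l\<in>K. A k l * c n l) \<longlongrightarrow> (\<Sum>\<^sub>\<infinity>l\<in>K. A k l * d l)) F"
  proof (rule tendsto_infsum_dominated[OF schur_row_summable(1)[OF A k w_pos, of M]])
    show "cmod (A k l * c n l) \<le> cmod (A k l) * (M / w l)" if "l \<in> K" for n l
      using cmod_le_weight[OF c that] by (simp add: norm_mult mult_left_mono del: times_divide_eq_right)
  qed (auto intro!: tendsto_intros lim)
  then show ?thesis using k by (simp add: mat_vec_def)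
qed (simp add: mat_vec_def)

lemma restrict_fin: "finite F \<Longrightarrow> c \<in> seqs_on K \<Longrightarrow> restrict_seq F c \<in> fin_seqs K"
  by (auto simp: fin_seqs_def restrict_seq_def seqs_on_def)

text \<open>For finite p, Jensen's inequality in each row uses the row sums and costs B^(r-1);
  summing over the rows uses the column sums and costs one more factor B.\<close>

lemma schur_test_finite:
  assumes A: "schur_bounded K w A B" and c: "bounded_by c M" and G: "finite G" "G \<subseteq> K"
  shows "bounded_by (\<lambda>k. if k \<in> K then \<Sum>l\<in>G. A k l * c l else 0) (B * M)"
proof -
  have B: "0 \<le> B" and M: "0 \<le> M" using A c by (auto simp: schur_bounded_def bounded_by_def)
  define b where "b k l = w k * cmod (A k l) / w l" for k l
  define x where "x l = w l * cmod (c l)" for l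
  have b: "0 \<le> b k l" and x: "0 \<le> x l" if "k \<in> K" "l \<in> K" for k l
    using w_pos[OF that(1)] w_pos[OF that(2)] by (auto simp: b_def x_def)
  have rows: "(\<Sum>l\<in>F. b k l) \<le> B" and cols: "(\<Sum>l\<in>F. b l k) \<le> B"
    if "k \<in> K" "finite F" "F \<subseteq> K" for k F
    using A that by (auto simp: schur_bounded_def b_def)
  have le: "w k * cmod (\<Sum>l\<in>G. A k l * c l) \<le> (\<Sum>l\<in>G. b k l * x l)" if k: "k \<in> K" for k
  proof -
    have "w k * cmod (\<Sum>l\<in>G. A k l * c l) \<le> w k * (\<Sum>l\<in>G. cmod (A k l) * cmod (c l))"
      using w_pos[OF k] by (intro mult_left_mono sum_norm_le) (auto simp: norm_mult)
    also have "\<dots> = (\<Sum>l\<in>G. b k l * x l)"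
      unfolding sum_distrib_left
    proof (intro sum.cong refl)
      fix l assume "l \<in> G"
      then have "w l \<noteq> 0" using w_pos[of l] G by auto
      then show "w k * (cmod (A k l) * cmod (c l)) = b k l * x l" by (simp add: b_def x_def)
    qed
    finally show ?thesis .
  qed
  show ?thesis
  proof (cases "p = \<infinity>")
    case True
    have "w k * cmod (\<Sum>l\<in>G. A k l * c l) \<le> B * M" if k: "k \<in> K" for k
    proof -
      have "(\<Sum>l\<in>G. b k l * x l) \<le> (\<Sum>l\<in>G. b k l * M)"
        using entry_le[OF c] b k G by (intro sum_mono mult_left_mono) (auto simp: x_def)
      also have "\<dots> \<le> B * M"
        using rows[OF k G] M by (simp flip: sum_distrib_right add: mult_right_mono)
      finally show ?thesis using le[OF k] by simp
    qed
    then show ?thesis using True B M unfolding bounded_by_def by (auto simp: seqs_on_def)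
  next
    case False
    have r: "1 \<le> r" by (rule r_ge_1[OF False])
    have "(\<Sum>k\<in>F. (w k * cmod (\<Sum>l\<in>G. A k l * c l)) powr r) \<le> (B * M) powr r"
      if F: "finite F" "F \<subseteq> K" for F
    proof -
      have "(\<Sum>k\<in>F. (w k * cmod (\<Sum>l\<in>G. A k l * c l)) powr r)
          \<le> (\<Sum>k\<in>F. B powr (r - 1) * (\<Sum>l\<in>G. b k l * x l powr r))"
      proof (rule sum_mono)
        fix k assume "k \<in> F"
        then have k: "k \<in> K" using F by auto
        have "(w k * cmod (\<Sum>l\<in>G. A k l * c l)) powr r \<le> (\<Sum>l\<in>G. b k l * x l) powr r"
          using le[OF k] w_pos[OF k] r by (intro powr_mono2) auto
        also have "\<dots> \<le> B powr (r - 1) * (\<Sum>l\<in>G. b k l * x l powr r)"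
          using G b[OF k] x rows[OF k G] r by (intro weighted_jensen) auto
        finally show "(w k * cmod (\<Sum>l\<in>G. A k l * c l)) powr r
            \<le> B powr (r - 1) * (\<Sum>l\<in>G. b k l * x l powr r)" .
      qed
      also have "\<dots> = B powr (r - 1) * (\<Sum>l\<in>G. (\<Sum>k\<in>F. b k l) * x l powr r)"
        unfolding sum_distrib_left sum_distrib_right by (rule sum.swap)
      also have "\<dots> \<le> B powr (r - 1) * (\<Sum>l\<in>G. B * x l powr r)"
        using cols F G by (intro mult_left_mono sum_mono mult_right_mono) auto
      also have "\<dots> = B powr (r - 1) * B * (\<Sum>l\<in>G. x l powr r)"
        by (simp add: sum_distrib_left mult.assoc)
      also have "B powr (r - 1) * B = B powr r"
        using B r by (cases "B = 0") (auto simp: powr_diff)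
      also have "B powr r * (\<Sum>l\<in>G. x l powr r) \<le> B powr r * M powr r"
        using c G False by (intro mult_left_mono) (auto simp: bounded_by_def x_def)
      finally show ?thesis using B M by (simp add: powr_mult)
    qed
    then have "(\<Sum>k\<in>F. (w k * cmod (if k \<in> K then \<Sum>l\<in>G. A k l * c l else 0)) powr r) \<le> (B * M) powr r"
      if "finite F" "F \<subseteq> K" for F
      using that by (auto simp: subset_iff cong: sum.cong)
    then show ?thesis using False B M unfolding bounded_by_def by (auto simp: seqs_on_def)
  qed
qed

theorem schur_test:
  assumes A: "schur_bounded K w A B" and c: "bounded_by c M"
  shows "bounded_by (mat_vec K A c) (B * M)"
proof (rule bounded_by_limit[where F = "finite_subsets_at_top K"])
  show "\<forall>\<^sub>F F in finite_subsets_at_top K. bounded_by (\<lambda>k. if k \<in> K then \<Sum>l\<in>F. A k l * c l else 0) (B * M)"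
    by (intro eventually_finite_subsets_at_top_weakI schur_test_finite[OF A c])
  show "((\<lambda>F. if k \<in> K then \<Sum>l\<in>F. A k l * c l else 0) \<longlongrightarrow> mat_vec K A c k) (finite_subsets_at_top K)"
    if "k \<in> K" for k
    using infsum_tendsto[OF schur_summable(2)[OF A c that]] that by (simp add: mat_vec_def)
qed (auto simp: mat_vec_def seqs_on_def)

lemma mat_vec_ell: "schur_bounded K w A B \<Longrightarrow> c \<in> E \<Longrightarrow> mat_vec K A c \<in> E"
  using schur_test[OF _ bounded_by_norm] by (auto simp: bounded_by_iff)

lemma mat_vec_norm: "schur_bounded K w A B \<Longrightarrow> c \<in> E \<Longrightarrow> N (mat_vec K A c) \<le> B * N c"
  using schur_test[OF _ bounded_by_norm] by (auto simp: bounded_by_iff)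

lemma schur_mat_vec_diff:
  assumes A: "schur_bounded K w A B" and c: "c \<in> E" "d \<in> E"
  shows "mat_vec K A (\<lambda>k. c k - d k) = (\<lambda>k. mat_vec K A c k - mat_vec K A d k)"
proof
  fix k
  show "mat_vec K A (\<lambda>k. c k - d k) k = mat_vec K A c k - mat_vec K A d k"
  proof (cases "k \<in> K")
    case True
    have "(\<lambda>l. A k l * c l) summable_on K" "(\<lambda>l. A k l * d l) summable_on K"
      using schur_summable[OF A bounded_by_norm] c True by auto
    then have "(\<Sum>\<^sub>\<infinity>l\<in>K. A k l * c l + (- (A k l * d l))) =
        (\<Sum>\<^sub>\<infinity>l\<in>K. A k l * c l) + (\<Sum>\<^sub>\<infinity>l\<in>K. - (A k l * d l))"
      by (intro infsum_add) (auto simp: summable_on_uminus)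
    then show ?thesis using True by (simp add: mat_vec_def right_diff_distrib infsum_uminus)
  qed (simp add: mat_vec_def)
qed

text \<open>Fubini's theorem for the double sum. The inner absolute sums are at most
  \<open>B' * M / w m\<close>, which is again a majorant that the rows of \<open>A\<close> can
  sum.\<close>

lemma schur_mat_vec_assoc:
  assumes A: "schur_bounded K w A B" and A': "schur_bounded K w A' B'" and c: "c \<in> E"
  shows "mat_vec K A (mat_vec K A' c) = mat_vec K (mat_mult K A A') c"
proof
  fix k
  show "mat_vec K A (mat_vec K A' c) k = mat_vec K (mat_mult K A A') c k"
  proof (cases "k \<in> K")
    case k: True
    define M where "M = N c"
    have c: "bounded_by c M" using c by (simp add: M_def bounded_by_norm)
    have M: "0 \<le> M" using c by (simp add: bounded_by_def)
    have row: "(\<lambda>l. cmod (A' m l * c l)) summable_on K" if "m \<in> K" for m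
      using schur_summable(1)[OF A' c that] by (simp add: norm_mult)
    have row_le: "(\<Sum>\<^sub>\<infinity>l\<in>K. cmod (A' m l * c l)) \<le> (B' * M) / w m" if m: "m \<in> K" for m
    proof -
      have "(\<Sum>\<^sub>\<infinity>l\<in>K. cmod (A' m l * c l)) \<le> (\<Sum>\<^sub>\<infinity>l\<in>K. M * (cmod (A' m l) / w l))"
      proof (rule infsum_mono[OF row[OF m]])
        show "(\<lambda>l. M * (cmod (A' m l) / w l)) summable_on K"
          using schur_row_summable(1)[OF A' m w_pos, of M] by (simp add: mult.commute)
        show "cmod (A' m l * c l) \<le> M * (cmod (A' m l) / w l)" if "l \<in> K" for l
          using mult_left_mono[OF cmod_le_weight[OF c that], of "cmod (A' m l)"]
          by (simp add: norm_mult mult.commute)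
      qed
      also have "\<dots> = M * (\<Sum>\<^sub>\<infinity>l\<in>K. cmod (A' m l) / w l)" by (rule infsum_cmult_right')
      also have "\<dots> \<le> M * (B' / w m)"
        using schur_row_summable(2)[OF A' m w_pos] w_pos[OF m] M
        by (intro mult_left_mono) (auto simp: field_simps)
      finally show ?thesis by (simp add: mult_ac)
    qed
    have "(\<lambda>(m, l). cmod (A k m * (A' m l * c l))) summable_on K \<times> K"
    proof (rule summable_on_SigmaI)
      show "((\<lambda>l. case (m, l) of (m, l) \<Rightarrow> cmod (A k m * (A' m l * c l))) has_sum
          (cmod (A k m) * (\<Sum>\<^sub>\<infinity>l\<in>K. cmod (A' m l * c l)))) K" if "m \<in> K" for m
        using has_sum_cmult_right[OF has_sum_infsum[OF row[OF that]]] by (simp add: norm_mult)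
      show "(\<lambda>m. cmod (A k m) * (\<Sum>\<^sub>\<infinity>l\<in>K. cmod (A' m l * c l))) summable_on K"
      proof (rule summable_on_comparison_test[OF schur_row_summable(1)[OF A k w_pos, of "B' * M"]])
        show "cmod (A k m) * (\<Sum>\<^sub>\<infinity>l\<in>K. cmod (A' m l * c l)) \<le> cmod (A k m) * (B' * M / w m)"
          if "m \<in> K" for m
          using row_le[OF that] by (intro mult_left_mono) auto
      qed (auto intro!: mult_nonneg_nonneg infsum_nonneg)
    qed auto
    then have sm: "(\<lambda>(m, l). A k m * (A' m l * c l)) summable_on K \<times> K"
      by - (rule abs_summable_summable, simp add: case_prod_unfold)
    have "mat_vec K A (mat_vec K A' c) k = (\<Sum>\<^sub>\<infinity>m\<in>K. \<Sum>\<^sub>\<infinity>l\<in>K. A k m * (A' m l * c l))"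
      using k by (auto simp: mat_vec_def infsum_cmult_right' intro!: infsum_cong)
    also have "\<dots> = (\<Sum>\<^sub>\<infinity>l\<in>K. \<Sum>\<^sub>\<infinity>m\<in>K. A k m * (A' m l * c l))"
      by (rule infsum_swap_banach[OF sm])
    also have "\<dots> = mat_vec K (mat_mult K A A') c k"
      using k by (simp add: mat_vec_def mat_mult_def infsum_cmult_left' mult.assoc[symmetric])
    finally show ?thesis .
  qed (simp add: mat_vec_def)
qed

end

section \<open>Schur bounds from admissibility\<close>

context solid_spectral_matrix_algebra
begin

lemma abs_mem: "A \<in> \<A> \<Longrightarrow> (\<lambda>k l. of_real (cmod (A k l))) \<in> \<A>"
  by (rule solid[THEN conjunct1, of A]) (use mats in \<open>auto simp: mats_on_def\<close>)

text \<open>Solidity puts the matrix of absolute values into the algebra, so no cancellation can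
  hide large entries. At exponent 1 its norm on a unit sequence is a weighted absolute column sum;
  at exponent \<infinity> its values on the reciprocal weight are the absolute row sums.\<close>

lemma admissible_schur_bounded:
  assumes w: "admissible K \<A> w" and A: "A \<in> \<A>"
  shows "\<exists>B. schur_bounded K w A B"
proof -
  have w_pos: "0 < w k" if "k \<in> K" for k
    using w that by (auto simp: admissible_def weight_on_def)
  let ?A = "\<lambda>k l. complex_of_real (cmod (A k l))"
  interpret one: lp_space K 1 w
    by unfold_locales (use w in \<open>auto simp: admissible_def\<close>)
  interpret top: lp_space K \<infinity> w
    by unfold_locales (use w in \<open>auto simp: admissible_def\<close>)
  have bounded: "mat_bounded K 1 w ?A" "mat_bounded K \<infinity> w ?A"
    using w abs_mem[OF A] one.p top.p by (auto simp: admissible_def)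
  obtain B1 where B1: "\<And>c. c \<in> ell K 1 w \<Longrightarrow>
      mat_vec K ?A c \<in> ell K 1 w \<and> ell_norm K 1 w (mat_vec K ?A c) \<le> B1 * ell_norm K 1 w c"
    using bounded(1) unfolding mat_bounded_def by blast
  obtain B2 where B2: "\<And>c. c \<in> ell K \<infinity> w \<Longrightarrow> (\<forall>k\<in>K. (\<lambda>l. ?A k l * c l) summable_on K) \<and>
      mat_vec K ?A c \<in> ell K \<infinity> w \<and> ell_norm K \<infinity> w (mat_vec K ?A c) \<le> B2 * ell_norm K \<infinity> w c"
    using bounded(2) unfolding mat_bounded_def by blast
  \<comment> \<open>The constants from \<open>mat_bounded\<close> carry no sign, hence the maximum
    with 0 and the absolute values.\<close>
  define B where "B = max 0 (max B1 (\<bar>B2\<bar> * \<bar>1\<bar>))"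
  have cols: "(\<Sum>k\<in>F. w k * cmod (A k l) / w l) \<le> B" if l: "l \<in> K" and F: "finite F" "F \<subseteq> K" for l F
  proof -
    have u: "unit_seq l \<in> ell K 1 w" by (rule one.fin_seqs_ell[OF unit_seq_fin[OF l]])
    have "ell_norm K 1 w (unit_seq l) \<le> w l"
    proof -
      have "(\<Sum>\<^sub>\<infinity>k\<in>K. w k * cmod (unit_seq l k)) = (\<Sum>\<^sub>\<infinity>k\<in>{l}. w k * cmod (unit_seq l k))"
        using l by (intro infsum_cong_neutral) (auto simp: unit_seq_def)
      moreover have "(\<Sum>\<^sub>\<infinity>k\<in>K. (w k * cmod (unit_seq l k)) powr 1) = (\<Sum>\<^sub>\<infinity>k\<in>K. w k * cmod (unit_seq l k))"
        using w_pos by (intro infsum_cong) (simp add: less_imp_le)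
      ultimately show ?thesis using w_pos[OF l] by (simp add: ell_norm_def unit_seq_def)
    qed
    then have "B1 * ell_norm K 1 w (unit_seq l) \<le> B * w l"
      using one.norm_nonneg[OF u] by (intro mult_mono) (auto simp: B_def)
    then have "one.bounded_by (mat_vec K ?A (unit_seq l)) (B * w l)"
      using B1[OF u] by (auto simp: one.bounded_by_iff)
    moreover have nn: "\<bar>B * w l\<bar> = B * w l"
      using w_pos[OF l] by (simp add: B_def)
    ultimately have "(\<Sum>k\<in>F. \<bar>w k * cmod (A k l)\<bar>) \<le> B * w l"
      using F unfolding one.bounded_by_def column[OF abs_mem[OF A] l] by (simp add: nn)
    moreover have "(\<Sum>k\<in>F. \<bar>w k * cmod (A k l)\<bar>) = (\<Sum>k\<in>F. w k * cmod (A k l))"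
      using F w_pos by (intro sum.cong refl) (auto simp: subset_iff less_imp_le)
    ultimately show ?thesis
      using w_pos[OF l] by (simp add: field_simps flip: sum_divide_distrib)
  qed
  have rows: "(\<Sum>l\<in>F. w k * cmod (A k l) / w l) \<le> B" if k: "k \<in> K" and F: "finite F" "F \<subseteq> K" for k F
  proof -
    \<comment> \<open>The extremal sequence of the unit ball at exponent \<infinity> for a matrix
      with nonnegative entries.\<close>
    define c where "c l = (if l \<in> K then complex_of_real (1 / w l) else 0)" for l
    have "top.bounded_by c 1"
      unfolding top.bounded_by_def by (auto simp: c_def seqs_on_def norm_divide dest!: w_pos)
    then have c: "c \<in> ell K \<infinity> w" "ell_norm K \<infinity> w c \<le> 1"
      unfolding top.bounded_by_iff by auto
    have sm: "(\<lambda>l. ?A k l * c l) summable_on K" using B2[OF c(1)] k by auto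
    have "B2 * ell_norm K \<infinity> w c \<le> \<bar>B2\<bar> * \<bar>1\<bar>"
      using c(2) top.norm_nonneg[OF c(1)] by (intro mult_mono) auto
    then have le: "ell_norm K \<infinity> w (mat_vec K ?A c) \<le> B"
      using B2[OF c(1)] by (auto simp: B_def)
    have "(\<lambda>l. complex_of_real (cmod (A k l) / w l)) summable_on K"
      by (rule summable_on_cong[THEN iffD1, OF _ sm]) (auto simp: c_def)
    then have sm': "(\<lambda>l. cmod (A k l) / w l) summable_on K"
      using summable_on_Re by fastforce
    have "mat_vec K ?A c k = (\<Sum>\<^sub>\<infinity>l\<in>K. complex_of_real (cmod (A k l) / w l))"
      unfolding mat_vec_def using k by (auto simp: c_def intro!: infsum_cong)
    also have "\<dots> = of_real (\<Sum>\<^sub>\<infinity>l\<in>K. cmod (A k l) / w l)"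
      using has_sum_of_real[OF has_sum_infsum[OF sm']] by (rule infsumI)
    finally have "(\<Sum>\<^sub>\<infinity>l\<in>K. cmod (A k l) / w l) \<le> cmod (mat_vec K ?A c k)" by simp
    then have "w k * (\<Sum>\<^sub>\<infinity>l\<in>K. cmod (A k l) / w l) \<le> B"
      using top.entry_le_norm[of "mat_vec K ?A c" k] B2[OF c(1)] k le w_pos[OF k]
      by (smt (verit) mult_left_mono)
    moreover have "(\<Sum>l\<in>F. cmod (A k l) / w l) \<le> (\<Sum>\<^sub>\<infinity>l\<in>K. cmod (A k l) / w l)"
      using F sm' w_pos by (intro finite_sum_le_infsum) (auto simp: less_imp_le)
    ultimately have "w k * (\<Sum>l\<in>F. cmod (A k l) / w l) \<le> B"
      using w_pos[OF k] by (smt (verit) mult_left_mono)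
    then show ?thesis by (simp add: sum_distrib_left)
  qed
  have "schur_bounded K w A B"
    using rows cols by (auto simp: schur_bounded_def B_def)
  then show ?thesis ..
qed

end

section \<open>Coorbit spaces\<close>

lemma fin_seqs_add: "c \<in> fin_seqs K \<Longrightarrow> d \<in> fin_seqs K \<Longrightarrow> (\<lambda>k. c k + d k) \<in> fin_seqs K"
  by (auto simp: fin_seqs_def seqs_on_def
      intro: finite_subset[of _ "{k. c k \<noteq> 0} \<union> {k. d k \<noteq> 0}"])

lemma fin_seqs_scale: "c \<in> fin_seqs K \<Longrightarrow> (\<lambda>k. a * c k) \<in> fin_seqs K"
  by (auto simp: fin_seqs_def seqs_on_def intro: finite_subset[of _ "{k. c k \<noteq> 0}"])

context frame
begin

abbreviation "C' \<equiv> analysis K \<psi>'"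

lemma synthesis_fin_seqs:
  assumes "c \<in> fin_seqs K"
  shows "D c = (\<Sum>k\<in>{k. c k \<noteq> 0}. c k *\<^sub>C \<psi> k)"
proof -
  have "D c = (\<Sum>\<^sub>\<infinity>k\<in>{k. c k \<noteq> 0}. c k *\<^sub>C \<psi> k)"
    unfolding synthesis_def using assms
    by (intro infsum_cong_neutral) (auto simp: fin_seqs_def seqs_on_def)
  then show ?thesis using assms by (simp add: fin_seqs_def)
qed

lemma H00_eq: "H00 K \<psi> = D ` fin_seqs K"
  by (auto simp: H00_def synthesis_fin_seqs image_iff)

lemma H00_add: "f \<in> H00 K \<psi> \<Longrightarrow> g \<in> H00 K \<psi> \<Longrightarrow> f + g \<in> H00 K \<psi>"
  unfolding H00_eq by (auto simp: image_iff synthesis_add[symmetric] fin_seqs_ell2 intro: fin_seqs_add)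

lemma H00_scale: "f \<in> H00 K \<psi> \<Longrightarrow> a *\<^sub>C f \<in> H00 K \<psi>"
  unfolding H00_eq by (auto simp: image_iff synthesis_scale[symmetric] fin_seqs_ell2 intro: fin_seqs_scale)

lemma C'_add: "C' (f + g) = (\<lambda>k. C' f k + C' g k)"
  by (auto simp: analysis_def cinner_add_left)

lemma C'_diff: "C' (f - g) = (\<lambda>k. C' f k - C' g k)"
  by (auto simp: analysis_def cinner_diff_left)

lemma C'_scale: "C' (a *\<^sub>C f) = (\<lambda>k. a * C' f k)"
  by (auto simp: analysis_def cinner_scaleC_left)

end

text \<open>Coefficients of a representing sequence, before \<open>rep\<close> chooses a
  representative of its class.\<close>

definition limit_coef ::
    "'k set \<Rightarrow> ('k \<Rightarrow> 'h::chilbert_space) \<Rightarrow> (nat \<Rightarrow> 'h) \<Rightarrow> 'k \<Rightarrow> complex"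
  where "limit_coef K \<psi> f k = (if k \<in> K then lim (\<lambda>n. cinner (f n) (dual_frame K \<psi> k)) else 0)"

lemma coef_rep: "coef K \<psi> F = limit_coef K \<psi> (rep F)"
  by (simp add: fun_eq_iff coef_def limit_coef_def)

text \<open>Schur bounds for three Gram matrices stand in for the algebra. They are stable under
  adjoints, so the locale can also be instantiated for the dual space, with reciprocal weight and
  another exponent.\<close>

locale coorbit_space = lp_space K p w + frame K \<psi>
  for K :: "'k set" and p w and \<psi> :: "'k \<Rightarrow> 'h::chilbert_space" +
  assumes K: "countable K"
    and schur_projection: "\<exists>B. schur_bounded K w (gram K \<psi>' \<psi>) B"
    and schur_gram: "\<exists>B. schur_bounded K w (gram K \<psi> \<psi>) B"
    and schur_gram_dual: "\<exists>B. schur_bounded K w (gram K \<psi>' \<psi>') B"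
begin

abbreviation "P \<equiv> gram K \<psi>' \<psi>"
abbreviation "H \<equiv> coorbit K \<psi> p w"
abbreviation "\<S> \<equiv> coorbit_seqs K \<psi> p w"
abbreviation "\<R> \<equiv> coorbit_rel K \<psi> p w"

definition V :: "('k \<Rightarrow> complex) set"
  where "V = {c \<in> E. mat_vec K P c = c}"

lemma P_C': "mat_vec K P (C' h) = C' h"
  by (rule mat_vec_gram_analysis_dual)

lemma H00_coefs: "f \<in> H00 K \<psi> \<Longrightarrow> C' f \<in> E"
  unfolding H00_eq using schur_projection mat_vec_ell[OF _ fin_seqs_ell]
  by (auto simp: mat_vec_gram[symmetric] fin_seqs_ell2)

text \<open>\<open>P\<close> reproduces the dual coefficients of Hilbert space vectors, and this
  property passes to bounded entrywise limits.\<close>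

lemma V_limit:
  assumes "\<And>n. bounded_by (C' (f n)) M" "\<And>k. (\<lambda>n. C' (f n) k) \<longlonglongrightarrow> c k"
  shows "c \<in> V"
proof -
  have "c k = 0" if "k \<notin> K" for k
    using LIMSEQ_unique[OF assms(2)[of k], of 0] that by (simp add: analysis_def)
  then have "bounded_by c M"
    using assms by (intro bounded_by_limit[where F = sequentially and x = "\<lambda>n. C' (f n)"])
      (auto simp: seqs_on_def)
  then have E: "c \<in> E" by (simp add: bounded_by_iff)
  obtain B where B: "schur_bounded K w P B" using schur_projection by blast
  have "mat_vec K P c k = c k" for k
  proof (rule LIMSEQ_unique)
    show "(\<lambda>n. mat_vec K P (C' (f n)) k) \<longlonglongrightarrow> mat_vec K P c k"
      by (rule mat_vec_tendsto[OF B assms])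
    show "(\<lambda>n. mat_vec K P (C' (f n)) k) \<longlonglongrightarrow> c k"
      by (simp add: P_C' assms)
  qed
  with E show ?thesis by (auto simp: V_def)
qed

lemma limit_coef_eqI:
  assumes "\<And>k. (\<lambda>n. C' (f n) k) \<longlonglongrightarrow> c k"
  shows "limit_coef K \<psi> f = c"
proof
  fix k
  show "limit_coef K \<psi> f k = c k"
  proof (cases "k \<in> K")
    case True
    then show ?thesis using assms[of k] by (simp add: limit_coef_def analysis_def limI)
  next
    case False
    then show ?thesis using LIMSEQ_unique[OF assms[of k], of 0] by (simp add: limit_coef_def analysis_def)
  qed
qed

lemma entry_limit:
  assumes "\<And>n. C' (f n) \<in> E" "c \<in> E" "(\<lambda>n. N (\<lambda>k. C' (f n) k - c k)) \<longlonglongrightarrow> 0"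
  shows "(\<lambda>n. C' (f n) k) \<longlonglongrightarrow> c k"
proof -
  have "(\<lambda>n. C' (f n) k - c k) \<longlonglongrightarrow> 0"
    using entry_tendsto_0[of "\<lambda>n k. C' (f n) k - c k"] assms ell_diff by blast
  then show ?thesis by (simp add: LIM_zero_iff)
qed

text \<open>Both constructions, by Cauchy sequences for finite p and by bounded entrywise
  convergence for p = \<infinity>, lead to bounded sequences of coefficients with an entrywise
  limit; the rest is common.\<close>

lemma seqsD:
  assumes f: "f \<in> \<S>"
  shows "C' (f n) \<in> E" and "limit_coef K \<psi> f \<in> V"
    and "(\<lambda>n. C' (f n) k) \<longlonglongrightarrow> limit_coef K \<psi> f k"
    and "p \<noteq> \<infinity> \<Longrightarrow> (\<lambda>n. N (\<lambda>k. C' (f n) k - limit_coef K \<psi> f k)) \<longlonglongrightarrow> 0"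
proof -
  have coefs: "C' (f n) \<in> E" for n
    using f H00_coefs unfolding coorbit_seqs_def by (auto split: if_splits)
  have "\<exists>M c. (\<forall>n. bounded_by (C' (f n)) M) \<and> (\<forall>k. (\<lambda>n. C' (f n) k) \<longlonglongrightarrow> c k) \<and>
      (p \<noteq> \<infinity> \<longrightarrow> (\<lambda>n. N (\<lambda>k. C' (f n) k - c k)) \<longlonglongrightarrow> 0)"
  proof (cases "p = \<infinity>")
    case True
    obtain M where "\<And>n. N (C' (f n)) \<le> M"
      using f True unfolding coorbit_seqs_def bdd_above_def by auto
    moreover have "(\<lambda>n. C' (f n) k) \<longlonglongrightarrow> limit_coef K \<psi> f k" for k
      using f True unfolding coorbit_seqs_def
      by (cases "k \<in> K") (auto simp: analysis_def limit_coef_def convergent_LIMSEQ_iff)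
    ultimately show ?thesis using coefs True unfolding bounded_by_iff by blast
  next
    case False
    have "\<exists>c\<in>E. (\<lambda>n. N (\<lambda>k. C' (f n) k - c k)) \<longlonglongrightarrow> 0"
      using f False by (intro complete coefs) (auto simp: coorbit_seqs_def C'_diff)
    then obtain c where c: "c \<in> E" "(\<lambda>n. N (\<lambda>k. C' (f n) k - c k)) \<longlonglongrightarrow> 0" by blast
    have "(\<lambda>n. N (C' (f n))) \<longlonglongrightarrow> N c" by (rule norm_tendsto[OF coefs c])
    then have "Bseq (\<lambda>n. N (C' (f n)))" by (intro convergent_imp_Bseq convergentI)
    then obtain M where M: "\<And>n. norm (N (C' (f n))) \<le> M" by (rule BseqE) blast
    have "N (C' (f n)) \<le> M" for n using M[of n] by simp
    then show ?thesis using c coefs entry_limit[OF coefs c] unfolding bounded_by_iff by blast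
  qed
  then obtain M c where bd: "\<And>n. bounded_by (C' (f n)) M" and lim: "\<And>k. (\<lambda>n. C' (f n) k) \<longlonglongrightarrow> c k"
    and nrm: "p \<noteq> \<infinity> \<longrightarrow> (\<lambda>n. N (\<lambda>k. C' (f n) k - c k)) \<longlonglongrightarrow> 0"
    by blast
  have c: "limit_coef K \<psi> f = c" by (rule limit_coef_eqI[OF lim])
  show "C' (f n) \<in> E" by (rule coefs)
  show "limit_coef K \<psi> f \<in> V" unfolding c by (rule V_limit[OF bd lim])
  show "(\<lambda>n. C' (f n) k) \<longlonglongrightarrow> limit_coef K \<psi> f k" unfolding c by (rule lim)
  show "p \<noteq> \<infinity> \<Longrightarrow> (\<lambda>n. N (\<lambda>k. C' (f n) k - limit_coef K \<psi> f k)) \<longlonglongrightarrow> 0"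
    unfolding c using nrm by blast
qed

lemma seqsI_finite:
  assumes p: "p \<noteq> \<infinity>" and f: "\<And>n. f n \<in> H00 K \<psi>" and c: "c \<in> E"
    and lim: "(\<lambda>n. N (\<lambda>k. C' (f n) k - c k)) \<longlonglongrightarrow> 0"
  shows "f \<in> \<S>" and "limit_coef K \<psi> f = c"
proof -
  have coefs: "C' (f n) \<in> E" for n by (rule H00_coefs[OF f])
  have "\<exists>n0. \<forall>m\<ge>n0. \<forall>n\<ge>n0. N (C' (f m - f n)) < e" if "0 < e" for e
  proof -
    have "\<forall>\<^sub>F n in sequentially. N (\<lambda>k. C' (f n) k - c k) < e / 2"
      using lim that by (intro order_tendstoD) auto
    then obtain n0 where n0: "\<And>n. n \<ge> n0 \<Longrightarrow> N (\<lambda>k. C' (f n) k - c k) < e / 2"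
      by (auto simp: eventually_sequentially)
    have "N (C' (f m - f n)) < e" if "m \<ge> n0" "n \<ge> n0" for m n
      using norm_triangle_diff[OF coefs c coefs, of m n] norm_minus_commute[OF c coefs, of n]
        n0[OF that(1)] n0[OF that(2)] by (simp add: C'_diff)
    then show ?thesis by blast
  qed
  then show "f \<in> \<S>" using p f unfolding coorbit_seqs_def by simp
  show "limit_coef K \<psi> f = c" by (intro limit_coef_eqI entry_limit coefs c lim)
qed

text \<open>A common description of the two equivalence relations, from which well-definedness and
  injectivity of the coefficient map are immediate. For finite p it rests on norm convergence of the
  coefficients to their limit.\<close>

lemma rel_iff: "(f, g) \<in> \<R> \<longleftrightarrow> f \<in> \<S> \<and> g \<in> \<S> \<and> limit_coef K \<psi> f = limit_coef K \<psi> g"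
proof -
  have "(f, g) \<in> \<R> \<longleftrightarrow> limit_coef K \<psi> f = limit_coef K \<psi> g" if f: "f \<in> \<S>" and g: "g \<in> \<S>"
  proof (cases "p = \<infinity>")
    case True
    have zero: "limit_coef K \<psi> f k = limit_coef K \<psi> g k" if "k \<notin> K" for k
      using that by (simp add: limit_coef_def)
    have lim: "(\<lambda>n. cinner (f n - g n) (\<psi>' k)) \<longlonglongrightarrow> limit_coef K \<psi> f k - limit_coef K \<psi> g k"
      if "k \<in> K" for k
      using tendsto_diff[OF seqsD(3)[OF f, of k] seqsD(3)[OF g, of k]] that
      by (simp add: analysis_def cinner_diff_left)
    have "(\<lambda>n. cinner (f n - g n) (\<psi>' k)) \<longlonglongrightarrow> 0 \<longleftrightarrow> limit_coef K \<psi> f k = limit_coef K \<psi> g k"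
      if "k \<in> K" for k
      using lim[OF that] LIMSEQ_unique[OF lim[OF that], of 0] by auto
    then have "(\<forall>k\<in>K. (\<lambda>n. cinner (f n - g n) (\<psi>' k)) \<longlonglongrightarrow> 0) \<longleftrightarrow> limit_coef K \<psi> f = limit_coef K \<psi> g"
      using zero by (auto simp: fun_eq_iff)
    then show ?thesis using f g True unfolding coorbit_rel_def by simp
  next
    case False
    have E: "limit_coef K \<psi> f \<in> E" "limit_coef K \<psi> g \<in> E"
      using seqsD(2) f g by (auto simp: V_def)
    have "(\<lambda>n. N (C' (f n - g n))) \<longlonglongrightarrow> 0 \<longleftrightarrow> limit_coef K \<psi> f = limit_coef K \<psi> g"
    proof
      assume "(\<lambda>n. N (C' (f n - g n))) \<longlonglongrightarrow> 0"
      then have "(\<lambda>n. C' (f n) k - C' (g n) k) \<longlonglongrightarrow> 0" for k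
        using entry_tendsto_0[of "\<lambda>n k. C' (f n) k - C' (g n) k"] ell_diff[OF seqsD(1)[OF f] seqsD(1)[OF g]]
        by (simp add: C'_diff)
      then have "limit_coef K \<psi> f k - limit_coef K \<psi> g k = 0" for k
        using tendsto_diff[OF seqsD(3)[OF f, of k] seqsD(3)[OF g, of k]] LIMSEQ_unique by blast
      then show "limit_coef K \<psi> f = limit_coef K \<psi> g" by auto
    next
      assume eq: "limit_coef K \<psi> f = limit_coef K \<psi> g"
      define u where "u n = N (\<lambda>k. C' (f n) k - limit_coef K \<psi> f k) + N (\<lambda>k. C' (g n) k - limit_coef K \<psi> g k)" for n
      have u0: "u \<longlonglongrightarrow> 0"
        unfolding u_def using False by (intro tendsto_add_zero seqsD f g) auto
      have le: "norm (N (C' (f n - g n))) \<le> u n" for n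
        using norm_triangle_diff[OF seqsD(1)[OF f] E(1) seqsD(1)[OF g], of n n]
          norm_minus_commute[OF E(2) seqsD(1)[OF g], of n]
          norm_nonneg[OF ell_diff[OF seqsD(1)[OF f] seqsD(1)[OF g]], of n n]
        by (simp add: u_def eq C'_diff)
      show "(\<lambda>n. N (C' (f n - g n))) \<longlonglongrightarrow> 0"
        by (rule Lim_null_comparison[OF always_eventually[OF allI[OF le]] u0])
    qed
    then show ?thesis using f g False unfolding coorbit_rel_def by simp
  qed
  moreover have "f \<in> \<S> \<and> g \<in> \<S>" if "(f, g) \<in> \<R>"
    using that unfolding coorbit_rel_def by auto
  ultimately show ?thesis by blast
qed

lemma class_coef:
  assumes "f \<in> \<S>"
  shows "\<R> `` {f} \<in> H" and "coef K \<psi> (\<R> `` {f}) = limit_coef K \<psi> f"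
proof -
  show "\<R> `` {f} \<in> H" using assms unfolding coorbit_def by (rule quotientI)
  have "f \<in> \<R> `` {f}" using assms by (simp add: rel_iff)
  then have "rep (\<R> `` {f}) \<in> \<R> `` {f}"
    unfolding rep_def by (rule someI[of "\<lambda>g. g \<in> \<R> `` {f}"])
  then show "coef K \<psi> (\<R> `` {f}) = limit_coef K \<psi> f"
    by (simp add: coef_rep rel_iff)
qed

lemma coorbitE:
  assumes "F \<in> H"
  obtains f where "f \<in> \<S>" "F = \<R> `` {f}" "coef K \<psi> F = limit_coef K \<psi> f"
  using assms class_coef unfolding coorbit_def by (auto elim!: quotientE)

lemma rep_seqs:
  assumes "F \<in> H"
  shows "rep F \<in> \<S>"
proof -
  obtain f where f: "f \<in> \<S>" "F = \<R> `` {f}" using coorbitE[OF assms] by blast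
  then have "f \<in> F" by (simp add: rel_iff)
  then have "rep F \<in> F" unfolding rep_def by (rule someI[of "\<lambda>f. f \<in> F"])
  then show ?thesis using f(2) by (simp add: rel_iff)
qed

lemma coef_V: "F \<in> H \<Longrightarrow> coef K \<psi> F \<in> V"
  unfolding coef_rep by (intro seqsD rep_seqs)

lemma coef_E: "F \<in> H \<Longrightarrow> coef K \<psi> F \<in> E"
  using coef_V by (simp add: V_def)

lemma inj_on_coef: "inj_on (coef K \<psi>) H"
proof (rule inj_onI)
  fix F G assume F: "F \<in> H" and G: "G \<in> H" and eq: "coef K \<psi> F = coef K \<psi> G"
  obtain f where f: "f \<in> \<S>" "F = \<R> `` {f}" "coef K \<psi> F = limit_coef K \<psi> f" by (rule coorbitE[OF F])
  obtain g where g: "g \<in> \<S>" "G = \<R> `` {g}" "coef K \<psi> G = limit_coef K \<psi> g" by (rule coorbitE[OF G])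
  have "(f, h) \<in> \<R> \<longleftrightarrow> (g, h) \<in> \<R>" for h
    using f g eq by (simp add: rel_iff)
  then show "F = G" using f g by auto
qed

text \<open>Countability enters here: elements of the spaces are represented by sequences, so the
  net of finite subsets has to be replaced by a sequence.\<close>

lemma exhausting_sequence:
  obtains X :: "nat \<Rightarrow> 'k set" where "\<And>n. finite (X n)" "\<And>n. X n \<subseteq> K"
    "filterlim X (finite_subsets_at_top K) sequentially"
proof (cases "K = {}")
  case True
  then show thesis
    by (intro that[of "\<lambda>_. {}"]) (auto simp: filterlim_finite_subsets_at_top)
next
  case False
  define X where "X n = from_nat_into K ` {..n}" for n
  show thesis
  proof (rule that[of X])
    show "X n \<subseteq> K" for n using from_nat_into[OF False] by (auto simp: X_def)
    then show "filterlim X (finite_subsets_at_top K) sequentially"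
    proof (intro filterlim_finite_subsets_at_top[THEN iffD2] allI impI)
      fix Y assume Y: "finite Y \<and> Y \<subseteq> K"
      have "Y \<subseteq> from_nat_into K ` UNIV"
        using Y range_from_nat_into[OF False K] by simp
      then obtain I where I: "finite I" "Y = from_nat_into K ` I"
        using Y by (meson finite_subset_image)
      obtain n0 where "I \<subseteq> {..n0}" using I(1) finite_nat_iff_bounded_le by blast
      then have "Y \<subseteq> X n" if "n \<ge> n0" for n
        unfolding X_def I(2) using that by force
      then show "\<forall>\<^sub>F n in sequentially. finite (X n) \<and> Y \<subseteq> X n \<and> X n \<subseteq> K"
        using \<open>\<And>n. X n \<subseteq> K\<close> by (auto simp: X_def eventually_sequentially)
    qed
  qed (simp add: X_def)
qed

text \<open>A preimage of \<open>c\<close> is represented by syntheses of truncations of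
  \<open>c\<close>. They lie in \<open>H00\<close>, and their coefficients are \<open>P\<close>
  applied to the truncations; these converge to \<open>mat_vec K P c = c\<close>, in norm for finite
  p and boundedly entrywise for p = \<infinity>.\<close>

lemma V_subset: "V \<subseteq> coef K \<psi> ` H"
proof
  fix c assume "c \<in> V"
  then have c: "c \<in> E" "mat_vec K P c = c" by (auto simp: V_def)
  have c_seq: "c \<in> seqs_on K" using c by (simp add: ell_def)
  obtain B where B: "schur_bounded K w P B" using schur_projection by blast
  obtain X :: "nat \<Rightarrow> 'k set" where X: "\<And>n. finite (X n)" "\<And>n. X n \<subseteq> K"
    "filterlim X (finite_subsets_at_top K) sequentially"
    by (rule exhausting_sequence) blast
  define f where "f n = D (restrict_seq (X n) c)" for n
  have fin: "restrict_seq (X n) c \<in> fin_seqs K" for n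
    by (rule restrict_fin[OF X(1) c_seq])
  have f_H00: "f n \<in> H00 K \<psi>" for n unfolding H00_eq f_def using fin by blast
  have Cf: "C' (f n) = mat_vec K P (restrict_seq (X n) c)" for n
    unfolding f_def by (rule mat_vec_gram[symmetric]) (rule fin_seqs_ell2[OF fin])
  have rb: "bounded_by (restrict_seq (X n) c) (N c)" for n
    by (rule restrict_bounded_by[OF bounded_by_norm[OF c(1)]])
  have lim: "(\<lambda>n. C' (f n) k) \<longlonglongrightarrow> c k" for k
  proof -
    have "(\<lambda>n. mat_vec K P (restrict_seq (X n) c) k) \<longlonglongrightarrow> mat_vec K P c k"
      by (rule mat_vec_tendsto[OF B rb]) (rule filterlim_compose[OF restrict_tendsto_entry X(3)])
    then show ?thesis by (simp add: Cf c)
  qed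
  have bd: "bounded_by (C' (f n)) (B * N c)" for n
    unfolding Cf by (rule schur_test[OF B rb])
  have "f \<in> \<S> \<and> limit_coef K \<psi> f = c"
  proof (cases "p = \<infinity>")
    case True
    have "convergent (\<lambda>n. cinner (f n) (\<psi>' k))" if "k \<in> K" for k
      using convergentI[OF lim[of k]] that by (simp add: analysis_def)
    moreover have "C' (f n) \<in> ell K \<infinity> w" "ell_norm K \<infinity> w (C' (f n)) \<le> B * N c" for n
      using bd[of n, unfolded bounded_by_iff] True by auto
    ultimately have "f \<in> \<S>"
      unfolding coorbit_seqs_def if_P[OF True] by (auto intro!: bdd_aboveI2)
    then show ?thesis using limit_coef_eqI[OF lim] by simp
  next
    case False
    have "(\<lambda>n. N (\<lambda>k. C' (f n) k - c k)) \<longlonglongrightarrow> 0"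
    proof (rule Lim_null_comparison)
      have "(\<lambda>n. N (\<lambda>k. restrict_seq (X n) c k - c k)) \<longlonglongrightarrow> 0"
        by (rule filterlim_compose[OF restrict_tendsto[OF c(1) False] X(3)])
      then show "(\<lambda>n. B * N (\<lambda>k. restrict_seq (X n) c k - c k)) \<longlonglongrightarrow> 0"
        by (rule tendsto_mult_right_zero)
      have "norm (N (\<lambda>k. C' (f n) k - c k)) \<le> B * N (\<lambda>k. restrict_seq (X n) c k - c k)" for n
      proof -
        have r: "restrict_seq (X n) c \<in> E" by (rule restrict_ell[OF c(1)])
        have "(\<lambda>k. C' (f n) k - c k) = mat_vec K P (\<lambda>k. restrict_seq (X n) c k - c k)"
          unfolding schur_mat_vec_diff[OF B r c(1)] by (simp add: Cf c)
        then show ?thesis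
          using mat_vec_norm[OF B ell_diff[OF r c(1)]] norm_nonneg[OF mat_vec_ell[OF B ell_diff[OF r c(1)]]]
          by simp
      qed
      then show "\<forall>\<^sub>F n in sequentially. norm (N (\<lambda>k. C' (f n) k - c k)) \<le> B * N (\<lambda>k. restrict_seq (X n) c k - c k)"
        by simp
    qed
    then show ?thesis using seqsI_finite[where f = f, OF False f_H00 c(1)] by blast
  qed
  then show "c \<in> coef K \<psi> ` H" using class_coef[of f] by (metis image_eqI)
qed

theorem bij_coef: "bij_betw (coef K \<psi>) H V"
  using inj_on_coef V_subset coef_V by (auto simp: bij_betw_def)

lemma coorbit_norm_eq:
  assumes F: "F \<in> H"
  shows "coorbit_norm K \<psi> p w F = N (coef K \<psi> F)"
proof (cases "p = \<infinity>")
  case True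
  then show ?thesis unfolding coorbit_norm_def by simp
next
  case False
  have "(\<lambda>n. N (C' (rep F n))) \<longlonglongrightarrow> N (coef K \<psi> F)"
    using seqsD[OF rep_seqs[OF F]] False coef_E[OF F] unfolding coef_rep
    by (intro norm_tendsto) auto
  then show ?thesis unfolding coorbit_norm_def using False by (simp add: limI)
qed

text \<open>Serves the difference in the norm convergence that defines synthesis for finite
  exponents; there \<open>H00\<close> and norm limits are stable under sums.\<close>

lemma coorbit_add:
  assumes p: "p \<noteq> \<infinity>" and F: "F \<in> H" and G: "G \<in> H"
  shows "coorbit_add K \<psi> p w F G \<in> H"
    and "coef K \<psi> (coorbit_add K \<psi> p w F G) = (\<lambda>k. coef K \<psi> F k + coef K \<psi> G k)"
proof -
  note f = seqsD[OF rep_seqs[OF F], folded coef_rep] and g = seqsD[OF rep_seqs[OF G], folded coef_rep]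
  have H00: "rep F n \<in> H00 K \<psi>" "rep G n \<in> H00 K \<psi>" for n
    using rep_seqs[OF F] rep_seqs[OF G] p unfolding coorbit_seqs_def by auto
  define u where "u n = N (\<lambda>k. C' (rep F n) k - coef K \<psi> F k) + N (\<lambda>k. C' (rep G n) k - coef K \<psi> G k)" for n
  have sub: "(\<lambda>k. C' (rep F n) k - coef K \<psi> F k) \<in> E" "(\<lambda>k. C' (rep G n) k - coef K \<psi> G k) \<in> E" for n
    using f(1) g(1) coef_E F G by (auto intro: ell_diff)
  have eq: "(\<lambda>k. C' (rep F n + rep G n) k - (coef K \<psi> F k + coef K \<psi> G k)) =
      (\<lambda>k. (C' (rep F n) k - coef K \<psi> F k) + (C' (rep G n) k - coef K \<psi> G k))" for n
    by (simp add: C'_add algebra_simps)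
  have u0: "u \<longlonglongrightarrow> 0" unfolding u_def using p by (intro tendsto_add_zero f g)
  have le: "norm (N (\<lambda>k. C' (rep F n + rep G n) k - (coef K \<psi> F k + coef K \<psi> G k))) \<le> u n" for n
    unfolding eq using norm_triangle[OF sub, of n n] norm_nonneg[OF ell_add[OF sub], of n n] by (simp add: u_def)
  have "(\<lambda>n. N (\<lambda>k. C' (rep F n + rep G n) k - (coef K \<psi> F k + coef K \<psi> G k))) \<longlonglongrightarrow> 0"
    by (rule Lim_null_comparison[OF always_eventually[OF allI[OF le]] u0])
  then have "(\<lambda>n. rep F n + rep G n) \<in> \<S>"
      "limit_coef K \<psi> (\<lambda>n. rep F n + rep G n) = (\<lambda>k. coef K \<psi> F k + coef K \<psi> G k)"
    by (rule seqsI_finite[OF p, rotated 2]; intro H00_add H00 ell_add coef_E F G)+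
  then show "coorbit_add K \<psi> p w F G \<in> H"
    "coef K \<psi> (coorbit_add K \<psi> p w F G) = (\<lambda>k. coef K \<psi> F k + coef K \<psi> G k)"
    using class_coef unfolding coorbit_add_def by auto
qed

lemma coorbit_scale:
  assumes p: "p \<noteq> \<infinity>" and F: "F \<in> H"
  shows "coorbit_scale K \<psi> p w a F \<in> H"
    and "coef K \<psi> (coorbit_scale K \<psi> p w a F) = (\<lambda>k. a * coef K \<psi> F k)"
proof -
  note f = seqsD[OF rep_seqs[OF F], folded coef_rep]
  have H00: "rep F n \<in> H00 K \<psi>" for n
    using rep_seqs[OF F] p unfolding coorbit_seqs_def by auto
  have sub: "(\<lambda>k. C' (rep F n) k - coef K \<psi> F k) \<in> E" for n
    using f(1) coef_E F by (auto intro: ell_diff)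
  have eq: "(\<lambda>k. C' (a *\<^sub>C rep F n) k - a * coef K \<psi> F k) =
      (\<lambda>k. a * (C' (rep F n) k - coef K \<psi> F k))" for n
    by (simp add: C'_scale algebra_simps)
  have "(\<lambda>n. N (\<lambda>k. C' (a *\<^sub>C rep F n) k - a * coef K \<psi> F k)) \<longlonglongrightarrow> 0"
  proof (rule Lim_null_comparison)
    show "(\<lambda>n. cmod a * N (\<lambda>k. C' (rep F n) k - coef K \<psi> F k)) \<longlonglongrightarrow> 0"
      using f(4) p by (intro tendsto_mult_right_zero)
    show "\<forall>\<^sub>F n in sequentially. norm (N (\<lambda>k. C' (a *\<^sub>C rep F n) k - a * coef K \<psi> F k))
        \<le> cmod a * N (\<lambda>k. C' (rep F n) k - coef K \<psi> F k)"
      unfolding eq using norm_scale_le[OF sub] norm_nonneg[OF ell_scale[OF sub]] by simp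
  qed
  then have "(\<lambda>n. a *\<^sub>C rep F n) \<in> \<S>"
      "limit_coef K \<psi> (\<lambda>n. a *\<^sub>C rep F n) = (\<lambda>k. a * coef K \<psi> F k)"
    by (rule seqsI_finite[OF p, rotated 2]; intro H00_scale H00 ell_scale coef_E F)+
  then show "coorbit_scale K \<psi> p w a F \<in> H"
    "coef K \<psi> (coorbit_scale K \<psi> p w a F) = (\<lambda>k. a * coef K \<psi> F k)"
    using class_coef unfolding coorbit_scale_def by auto
qed

lemma coorbit_diff_norm:
  assumes "p \<noteq> \<infinity>" "F \<in> H" "G \<in> H"
  shows "coorbit_norm K \<psi> p w (coorbit_diff K \<psi> p w F G) = N (\<lambda>k. coef K \<psi> F k - coef K \<psi> G k)"
  using coorbit_add[OF assms(1,2) coorbit_scale(1)[OF assms(1,3)]] coorbit_scale[OF assms(1,3)]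
  by (simp add: coorbit_diff_def coorbit_norm_eq)

section \<open>Embedding, analysis and synthesis in terms of coefficients\<close>

lemma coorbit_embed:
  assumes "C' h \<in> E"
  shows "coorbit_embed K \<psi> p w h \<in> H" and "coef K \<psi> (coorbit_embed K \<psi> p w h) = C' h"
proof -
  have "C' h \<in> V" using assms by (simp add: V_def P_C')
  then obtain F where "F \<in> H" "coef K \<psi> F = C' h" using V_subset by force
  then have "\<exists>!F. F \<in> H \<and> coef K \<psi> F = C' h"
    using inj_onD[OF inj_on_coef] by (intro ex1I[of _ F]) auto
  then have "coorbit_embed K \<psi> p w h \<in> H \<and> coef K \<psi> (coorbit_embed K \<psi> p w h) = C' h"
    unfolding coorbit_embed_def by (rule theI')
  then show "coorbit_embed K \<psi> p w h \<in> H" "coef K \<psi> (coorbit_embed K \<psi> p w h) = C' h" by auto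
qed

text \<open>The Gram matrix in the pairing turns the dual coefficients of \<open>h\<close> into its
  coefficients with respect to \<open>\<psi>\<close>. For \<open>h\<close> a vector of a second
  frame the sum is a row of a cross-Gram matrix applied to the coefficients.\<close>

lemma pairing_embed:
  assumes "C' h \<in> E"
  shows "pairing K \<psi> F (coorbit_embed K \<psi> p w h) = (\<Sum>\<^sub>\<infinity>j\<in>K. cinner (\<psi> j) h * coef K \<psi> F j)"
  unfolding pairing_def coorbit_embed(2)[OF assms] mat_vec_gram_analysis_dual
  by (intro infsum_cong) (simp add: analysis_def cinner_commute[symmetric])

lemma column_ell:
  assumes "schur_bounded K w (gram K \<psi>' \<xi>) B" "l \<in> K"
  shows "C' (\<xi> l) \<in> E"
  using mat_vec_ell[OF assms(1) fin_seqs_ell[OF unit_seq_fin[OF assms(2)]]]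
    mat_vec_unit_seq[OF assms(2) gram_mats, of \<psi>' \<xi>] gram_column[OF assms(2), of \<psi>' \<xi>] by simp

lemma schur_adjoint:
  "schur_bounded K w (gram K \<xi> \<eta>) B \<Longrightarrow> schur_bounded K (\<lambda>k. 1 / w k) (gram K \<eta> \<xi>) B"
  unfolding gram_adjoint[of K \<xi> \<eta>, symmetric]
  by (auto simp: schur_bounded_def mat_adj_def mult.commute)

lemma reciprocal: "1 \<le> q \<Longrightarrow> coorbit_space K q (\<lambda>k. 1 / w k) \<psi>"
proof
  show "\<exists>B. schur_bounded K (\<lambda>k. 1 / w k) (gram K \<psi>' \<psi>) B"
    using schur_projection schur_adjoint by (metis gram_dual_commute)
  show "\<exists>B. schur_bounded K (\<lambda>k. 1 / w k) (gram K \<psi> \<psi>) B"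
    "\<exists>B. schur_bounded K (\<lambda>k. 1 / w k) (gram K \<psi>' \<psi>') B"
    using schur_gram schur_gram_dual schur_adjoint by blast+
qed (use K w is_frame in \<open>auto simp: weight_on_def\<close>)

text \<open>The bound for \<open>gram K \<xi> \<psi>'\<close> passes to its adjoint with the
  reciprocal weight, whose columns are the coefficients of the vectors \<open>\<xi> k\<close>. These
  vectors therefore embed into the dual space, and the pairing can be evaluated.\<close>

theorem coorbit_analysis_eq:
  assumes "schur_bounded K w (gram K \<xi> \<psi>') B"
  shows "coorbit_analysis K \<psi> p w \<xi> F = mat_vec K (gram K \<xi> \<psi>) (coef K \<psi> F)"
proof
  fix k
  have "inverse (conj_exp p) \<le> 1"
    using conj_exp[OF p] by (metis le_iff_add add.commute)
  then have "1 \<le> conj_exp p"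
    by (cases "conj_exp p" rule: ennreal_cases; cases "conj_exp p = 0")
      (auto simp: inverse_ennreal less_le inverse_le_1_iff top_unique simp flip: ennreal_1)
  then interpret dual: coorbit_space K "conj_exp p" "\<lambda>k. 1 / w k" \<psi> by (rule reciprocal)
  show "coorbit_analysis K \<psi> p w \<xi> F k = mat_vec K (gram K \<xi> \<psi>) (coef K \<psi> F) k"
  proof (cases "k \<in> K")
    case True
    have "C' (\<xi> k) \<in> dual.E"
      by (rule dual.column_ell[OF schur_adjoint[OF assms] True])
    then show ?thesis using True
      by (auto simp: coorbit_analysis_def dual.pairing_embed mat_vec_def gram_def intro!: infsum_cong)
  qed (simp add: coorbit_analysis_def mat_vec_def)
qed

text \<open>Pairing with the embedded vector \<open>\<psi>' k\<close> reads off coefficient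
  \<open>k\<close>, because \<open>P\<close> reproduces coefficients. This makes weak-* limits
  unique.\<close>

lemma weak_star_separates:
  assumes F: "F \<in> H" and G: "G \<in> H"
    and eq: "\<And>U. U \<in> coorbit K \<psi> 1 (\<lambda>k. 1 / w k) \<Longrightarrow> pairing K \<psi> F U = pairing K \<psi> G U"
  shows "F = G"
proof -
  interpret dual: coorbit_space K 1 "\<lambda>k. 1 / w k" \<psi> by (rule reciprocal) simp
  obtain B where B: "schur_bounded K w (gram K \<psi>' \<psi>') B" using schur_gram_dual by blast
  have *: "pairing K \<psi> F' (coorbit_embed K \<psi> 1 (\<lambda>k. 1 / w k) (\<psi>' k)) = coef K \<psi> F' k"
    if "F' \<in> H" "k \<in> K" for F' k
  proof -
    have "(\<Sum>\<^sub>\<infinity>j\<in>K. cinner (\<psi> j) (\<psi>' k) * coef K \<psi> F' j) = mat_vec K P (coef K \<psi> F') k"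
      using that by (auto simp: mat_vec_def gram_def intro!: infsum_cong)
    then show ?thesis
      using coef_V[OF that(1)] dual.pairing_embed[OF dual.column_ell[OF schur_adjoint[OF B] that(2)]]
      by (simp add: V_def)
  qed
  have "coef K \<psi> F k = coef K \<psi> G k" for k
  proof (cases "k \<in> K")
    case True
    then show ?thesis
      using *[OF F True] *[OF G True] eq dual.coorbit_embed(1)[OF dual.column_ell[OF schur_adjoint[OF B] True]]
      by simp
  qed (simp add: coef_def)
  then show ?thesis using inj_on_coef F G by (auto simp: inj_on_def fun_eq_iff)
qed

text \<open>The definite description requires existence and uniqueness of the limit. With G the
  cross-Gram matrix of \<open>\<psi>'\<close> and \<open>\<xi>\<close>, the limit is the class with
  coefficients G c; it exists because P G = G puts G c into \<open>V\<close>.\<close>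

theorem coorbit_synthesis:
  assumes B: "schur_bounded K w (gram K \<psi>' \<xi>) B" and c: "c \<in> E"
  shows "coorbit_synthesis K \<psi> p w \<xi> c \<in> H"
    and "coef K \<psi> (coorbit_synthesis K \<psi> p w \<xi> c) = mat_vec K (gram K \<psi>' \<xi>) c"
proof -
  define a where "a = mat_vec K (gram K \<psi>' \<xi>) c"
  obtain BP where BP: "schur_bounded K w P BP" using schur_projection by blast
  have "mat_vec K P a = a"
    unfolding a_def schur_mat_vec_assoc[OF BP B c] gram_mult ..
  then have "a \<in> V" using mat_vec_ell[OF B c] by (simp add: V_def a_def)
  then obtain F where F: "F \<in> H" "coef K \<psi> F = a" using V_subset by blast
  define e where "e S = coorbit_embed K \<psi> p w (\<Sum>k\<in>S. c k *\<^sub>C \<xi> k)" for S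
  have e: "e S \<in> H" "coef K \<psi> (e S) = mat_vec K (gram K \<psi>' \<xi>) (restrict_seq S c)"
    if S: "finite S" "S \<subseteq> K" for S
  proof -
    have "C' (\<Sum>k\<in>S. c k *\<^sub>C \<xi> k) = mat_vec K (gram K \<psi>' \<xi>) (restrict_seq S c)"
    proof
      fix k
      have "(\<Sum>\<^sub>\<infinity>l\<in>K. gram K \<psi>' \<xi> k l * restrict_seq S c l) = (\<Sum>\<^sub>\<infinity>l\<in>S. gram K \<psi>' \<xi> k l * c l)"
        using S by (intro infsum_cong_neutral) (auto simp: restrict_seq_def)
      also have "\<dots> = (\<Sum>l\<in>S. gram K \<psi>' \<xi> k l * c l)" using S by simp
      also have "\<dots> = C' (\<Sum>k\<in>S. c k *\<^sub>C \<xi> k) k"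
        using S by (auto simp: analysis_def gram_def cinner_sum_left cinner_scaleC_left mult.commute intro!: sum.cong)
      finally show "C' (\<Sum>k\<in>S. c k *\<^sub>C \<xi> k) k = mat_vec K (gram K \<psi>' \<xi>) (restrict_seq S c) k"
        by (simp add: mat_vec_def analysis_def)
    qed
    then show "e S \<in> H" "coef K \<psi> (e S) = mat_vec K (gram K \<psi>' \<xi>) (restrict_seq S c)"
      using coorbit_embed mat_vec_ell[OF B restrict_ell[OF c]] unfolding e_def by metis+
  qed
  define conv where "conv F \<longleftrightarrow> (if p = \<infinity> then
      \<forall>G\<in>coorbit K \<psi> 1 (\<lambda>j. 1 / w j).
        ((\<lambda>S. pairing K \<psi> (e S) G) \<longlongrightarrow> pairing K \<psi> F G) (finite_subsets_at_top K)
      else ((\<lambda>S. coorbit_norm K \<psi> p w (coorbit_diff K \<psi> p w F (e S))) \<longlongrightarrow> 0) (finite_subsets_at_top K))" for F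
  have "conv F \<and> (\<forall>G\<in>H. conv G \<longrightarrow> G = F)"
  proof (cases "p = \<infinity>")
    case True
    interpret dual: coorbit_space K 1 "\<lambda>k. 1 / w k" \<psi> by (rule reciprocal) simp
    have conv_F: "((\<lambda>S. pairing K \<psi> (e S) G) \<longlongrightarrow> pairing K \<psi> F G) (finite_subsets_at_top K)"
      if G: "G \<in> coorbit K \<psi> 1 (\<lambda>j. 1 / w j)" for G
    proof -
      define g where "g = mat_vec K (gram K \<psi> \<psi>) (coef K \<psi> G)"
      have "g \<in> dual.E"
        using dual.schur_gram dual.mat_vec_ell dual.coef_E[OF G] unfolding g_def by blast
      then have "(\<lambda>k. \<bar>1 / w k * cmod (g k)\<bar>) summable_on K"
        by (simp add: ell_def)
      \<comment> \<open>The dominating series: entry \<open>k\<close> of the coefficients of a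
        partial sum is at most B (N c) / w k, uniformly in the finite set, and \<open>g\<close> lies
        in ell^1 with weight 1 / w.\<close>
      then have sm: "(\<lambda>k. (B * N c) * \<bar>1 / w k * cmod (g k)\<bar>) summable_on K"
        by (rule summable_on_cmult_right)
      let ?a = "\<lambda>S. mat_vec K (gram K \<psi>' \<xi>) (restrict_seq S c)"
      have "((\<lambda>S. \<Sum>\<^sub>\<infinity>k\<in>K. ?a S k * cnj (g k)) \<longlongrightarrow> (\<Sum>\<^sub>\<infinity>k\<in>K. a k * cnj (g k))) (finite_subsets_at_top K)"
      proof (rule tendsto_infsum_dominated[OF sm])
        show "cmod (?a S k * cnj (g k)) \<le> (B * N c) * \<bar>1 / w k * cmod (g k)\<bar>" if "k \<in> K" for S k
        proof -
          have "bounded_by (?a S) (B * N c)"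
            by (rule schur_test[OF B restrict_bounded_by[OF bounded_by_norm[OF c]]])
          then have "cmod (?a S k) * cmod (g k) \<le> (B * N c) / w k * cmod (g k)"
            using cmod_le_weight that by (intro mult_right_mono) auto
          then show ?thesis using w_pos[OF that] by (simp add: norm_mult)
        qed
        show "((\<lambda>S. ?a S k * cnj (g k)) \<longlongrightarrow> a k * cnj (g k)) (finite_subsets_at_top K)" for k
          unfolding a_def
          by (intro tendsto_mult_right mat_vec_tendsto[OF B restrict_bounded_by[OF bounded_by_norm[OF c]]]
              restrict_tendsto_entry)
      qed
      then have "((\<lambda>S. \<Sum>\<^sub>\<infinity>k\<in>K. ?a S k * cnj (g k)) \<longlongrightarrow> pairing K \<psi> F G) (finite_subsets_at_top K)"
        by (simp add: pairing_def F g_def)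
      then show ?thesis
        by (rule Lim_transform_eventually)
          (intro eventually_finite_subsets_at_top_weakI, simp add: pairing_def e g_def)
    qed
    moreover have "G = F" if "G \<in> H" "conv G" for G
    proof (rule weak_star_separates[OF that(1) F(1)])
      fix U assume U: "U \<in> coorbit K \<psi> 1 (\<lambda>k. 1 / w k)"
      then have "((\<lambda>S. pairing K \<psi> (e S) U) \<longlongrightarrow> pairing K \<psi> G U) (finite_subsets_at_top K)"
        using that(2) True unfolding conv_def by auto
      then show "pairing K \<psi> G U = pairing K \<psi> F U"
        using tendsto_unique[OF finite_subsets_at_top_neq_bot _ conv_F[OF U]] by simp
    qed
    ultimately show ?thesis using True unfolding conv_def by simp
  next
    case False
    have conv_iff: "conv G \<longleftrightarrow>
        ((\<lambda>S. N (\<lambda>k. coef K \<psi> G k - mat_vec K (gram K \<psi>' \<xi>) (restrict_seq S c) k)) \<longlongrightarrow> 0) (finite_subsets_at_top K)"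
      if "G \<in> H" for G
      unfolding conv_def using False
      by (auto intro!: tendsto_cong eventually_finite_subsets_at_top_weakI
          simp: coorbit_diff_norm[OF False that e(1)] e(2))
    have "conv F"
      unfolding conv_iff[OF F(1)]
    proof (rule Lim_null_comparison)
      show "((\<lambda>S. B * N (\<lambda>k. restrict_seq S c k - c k)) \<longlongrightarrow> 0) (finite_subsets_at_top K)"
        by (rule tendsto_mult_right_zero[OF restrict_tendsto[OF c False]])
      show "\<forall>\<^sub>F S in finite_subsets_at_top K.
          norm (N (\<lambda>k. coef K \<psi> F k - mat_vec K (gram K \<psi>' \<xi>) (restrict_seq S c) k))
          \<le> B * N (\<lambda>k. restrict_seq S c k - c k)"
      proof (intro always_eventually allI)
        fix S
        have r: "restrict_seq S c \<in> E" by (rule restrict_ell[OF c])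
        have "(\<lambda>k. coef K \<psi> F k - mat_vec K (gram K \<psi>' \<xi>) (restrict_seq S c) k) =
            mat_vec K (gram K \<psi>' \<xi>) (\<lambda>k. c k - restrict_seq S c k)"
          unfolding schur_mat_vec_diff[OF B c r] F(2) a_def ..
        then show "norm (N (\<lambda>k. coef K \<psi> F k - mat_vec K (gram K \<psi>' \<xi>) (restrict_seq S c) k))
          \<le> B * N (\<lambda>k. restrict_seq S c k - c k)"
          using mat_vec_norm[OF B ell_diff[OF c r]] norm_nonneg[OF mat_vec_ell[OF B ell_diff[OF c r]]]
            norm_minus_commute[OF c r] by simp
      qed
    qed
    moreover have "G = F" if G: "G \<in> H" "conv G" for G
    proof -
      let ?a = "\<lambda>S. mat_vec K (gram K \<psi>' \<xi>) (restrict_seq S c)"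
      have lim: "((\<lambda>S. ?a S k) \<longlongrightarrow> coef K \<psi> G' k) (finite_subsets_at_top K)" if "G' \<in> H" "conv G'" for G' k
      proof -
        have "((\<lambda>S. coef K \<psi> G' k - ?a S k) \<longlongrightarrow> 0) (finite_subsets_at_top K)"
          using that(2) unfolding conv_iff[OF that(1)]
          by (rule entry_tendsto_0[rotated]) (intro ell_diff coef_E that mat_vec_ell[OF B] restrict_ell c)
        then have "((\<lambda>S. coef K \<psi> G' k - (coef K \<psi> G' k - ?a S k)) \<longlongrightarrow> coef K \<psi> G' k - 0) (finite_subsets_at_top K)"
          by (intro tendsto_intros)
        then show ?thesis by simp
      qed
      have "coef K \<psi> G k = coef K \<psi> F k" for k
        by (rule tendsto_unique[OF finite_subsets_at_top_neq_bot lim[OF G] lim[OF F(1) \<open>conv F\<close>]])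
      then show ?thesis using inj_on_coef F G by (auto simp: inj_on_def fun_eq_iff)
    qed
    ultimately show ?thesis by blast
  qed
  then have "(THE F. F \<in> H \<and> conv F) = F"
    using F(1) by (intro the_equality) blast+
  then have "coorbit_synthesis K \<psi> p w \<xi> c = F"
    unfolding coorbit_synthesis_def conv_def e_def .
  then show "coorbit_synthesis K \<psi> p w \<xi> c \<in> H"
    "coef K \<psi> (coorbit_synthesis K \<psi> p w \<xi> c) = mat_vec K (gram K \<psi>' \<xi>) c"
    using F by (auto simp: a_def)
qed

end

section \<open>Galerkin operators\<close>

lemma mat_mult_adjoint: "mat_adj (mat_mult K A B) = mat_mult K (mat_adj B) (mat_adj A)"
  by (simp add: fun_eq_iff mat_adj_def mat_mult_def mult.commute flip: infsum_cnj)

text \<open>The product formula with the roles of \<open>\<psi>\<close> and \<open>\<psi>'\<close>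
  exchanged. Taking adjoints avoids identifying the dual of the dual frame with the frame.\<close>

lemma (in frame) gram_mult_dual: "mat_mult K (gram K \<xi> \<psi>') (gram K \<psi> \<eta>) = gram K \<xi> \<eta>"
proof -
  have "mat_adj (mat_mult K (gram K \<eta> \<psi>) (gram K \<psi>' \<xi>)) = mat_adj (gram K \<eta> \<xi>)"
    by (simp only: gram_mult)
  then show ?thesis by (simp only: mat_mult_adjoint gram_adjoint)
qed

context coorbit_space
begin

text \<open>On \<open>V\<close> the Gram matrices of \<open>\<psi>\<close> and of
  \<open>\<psi>'\<close> are inverse to each other, since both products are
  \<open>P\<close>.\<close>

lemma coorbit_ran_self: "coorbit_ran K \<psi> p w \<psi> = V"
proof -
  obtain B where B: "schur_bounded K w P B" using schur_projection by blast
  obtain BG where BG: "schur_bounded K w (gram K \<psi> \<psi>) BG" using schur_gram by blast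
  obtain BD where BD: "schur_bounded K w (gram K \<psi>' \<psi>') BD" using schur_gram_dual by blast
  have "schur_bounded K w (gram K \<psi> \<psi>') B" using B by (simp add: gram_dual_commute)
  then have "coorbit_analysis K \<psi> p w \<psi> = mat_vec K (gram K \<psi> \<psi>) \<circ> coef K \<psi>"
    by (auto simp: coorbit_analysis_eq)
  then have ran: "coorbit_ran K \<psi> p w \<psi> = mat_vec K (gram K \<psi> \<psi>) ` V"
    using bij_betw_imp_surj_on[OF bij_coef] by (simp only: coorbit_ran_def image_comp[symmetric])
  show ?thesis
    unfolding ran
  proof (intro equalityI subsetI)
    fix c assume "c \<in> mat_vec K (gram K \<psi> \<psi>) ` V"
    then obtain a where a: "a \<in> E" "c = mat_vec K (gram K \<psi> \<psi>) a" by (auto simp: V_def)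
    have "mat_mult K P (gram K \<psi> \<psi>) = gram K \<psi> \<psi>"
      unfolding gram_dual_commute[symmetric] by (rule gram_mult_dual)
    then show "c \<in> V"
      using a schur_mat_vec_assoc[OF B BG a(1)] mat_vec_ell[OF BG a(1)] by (simp add: V_def)
  next
    fix c assume "c \<in> V"
    then have c: "c \<in> E" "mat_vec K P c = c" by (auto simp: V_def)
    define a where "a = mat_vec K (gram K \<psi>' \<psi>') c"
    have "a \<in> V"
      using schur_mat_vec_assoc[OF B BD c(1)] mat_vec_ell[OF BD c(1)] by (simp add: V_def a_def gram_mult)
    moreover have "mat_vec K (gram K \<psi> \<psi>) a = c"
      unfolding a_def schur_mat_vec_assoc[OF BG BD c(1)] gram_mult gram_dual_commute by (rule c)
    ultimately show "c \<in> mat_vec K (gram K \<psi> \<psi>) ` V" by force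
  qed
qed

text \<open>In coefficients, synthesis with \<open>\<psi>\<close> is multiplication by
  \<open>P\<close>, which is the identity on \<open>V\<close>.\<close>

lemma bij_synthesis: "bij_betw (coorbit_synthesis K \<psi> p w \<psi>) V H"
  and synthesis_coef: "F \<in> H \<Longrightarrow> coorbit_synthesis K \<psi> p w \<psi> (coef K \<psi> F) = F"
proof -
  obtain B where B: "schur_bounded K w P B" using schur_projection by blast
  have *: "coorbit_synthesis K \<psi> p w \<psi> c \<in> H \<and> coef K \<psi> (coorbit_synthesis K \<psi> p w \<psi> c) = c"
    if "c \<in> V" for c
    using coorbit_synthesis[OF B, of c] that by (auto simp: V_def)
  show left: "coorbit_synthesis K \<psi> p w \<psi> (coef K \<psi> F) = F" if "F \<in> H" for F
    using *[OF coef_V[OF that]] inj_onD[OF inj_on_coef] that by blast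
  show "bij_betw (coorbit_synthesis K \<psi> p w \<psi>) V H"
    by (rule bij_betwI[where g = "coef K \<psi>"]) (use * left coef_V in auto)
qed

text \<open>Multiplication by \<open>P\<close> again; for this reason analysis with the dual frame
  appears in the matrix of the inverse.\<close>

lemma analysis_dual_eq_coef:
  assumes "F \<in> H"
  shows "coorbit_analysis K \<psi> p w \<psi>' F = coef K \<psi> F"
  using schur_gram_dual coorbit_analysis_eq[of \<psi>'] coef_V[OF assms] by (auto simp: V_def)

text \<open>In coefficients the composition is a product of two cross-Gram matrices through
  \<open>\<phi>\<close> and its dual, which the product formula for \<open>\<phi>\<close> collapses
  to \<open>P\<close>.\<close>

lemma synthesis_dual_analysis:
  assumes "is_frame K \<phi>"
    and "schur_bounded K w (gram K \<phi> \<psi>) B" "schur_bounded K w (gram K \<phi> \<psi>') B'"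
    and "schur_bounded K w (gram K \<psi>' (dual_frame K \<phi>)) B''"
    and F: "F \<in> H"
  shows "coorbit_synthesis K \<psi> p w (dual_frame K \<phi>) (coorbit_analysis K \<psi> p w \<phi> F) = F"
proof -
  interpret \<phi>: frame K \<phi> by unfold_locales fact
  have "coef K \<psi> (coorbit_synthesis K \<psi> p w (dual_frame K \<phi>) (coorbit_analysis K \<psi> p w \<phi> F)) =
      mat_vec K (mat_mult K (gram K \<psi>' (dual_frame K \<phi>)) (gram K \<phi> \<psi>)) (coef K \<psi> F)"
    unfolding coorbit_analysis_eq[OF assms(3)] schur_mat_vec_assoc[OF assms(4,2) coef_E[OF F], symmetric]
    by (intro coorbit_synthesis(2)[OF assms(4)] mat_vec_ell[OF assms(2)] coef_E F)
  also have "\<dots> = coef K \<psi> F"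
    unfolding \<phi>.gram_mult_dual using coef_V[OF F] by (simp add: V_def)
  finally show ?thesis
    unfolding coorbit_analysis_eq[OF assms(3)]
    by (rule inj_onD[OF inj_on_coef _ coorbit_synthesis(1)[OF assms(4) mat_vec_ell[OF assms(2) coef_E[OF F]]] F])
qed

end

lemma (in localized_frame) coorbit_space_admissible:
  assumes "countable K" "1 \<le> p" "admissible K \<A> w"
  shows "coorbit_space K p w \<psi>"
proof
  show "weight_on K w" using assms(3) by (simp add: admissible_def)
  show "\<exists>B. schur_bounded K w (gram K \<psi>' \<psi>) B"
    using admissible_schur_bounded[OF assms(3) gram_dual_mem] by (simp add: gram_dual_commute)
qed (use assms admissible_schur_bounded localized gram_dual_dual_mem in auto)

theorem lemma11:
  fixes K :: "(real^'d) set"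
    and \<A> :: "(real^'d \<Rightarrow> real^'d \<Rightarrow> complex) set"
    and nrm :: "(real^'d \<Rightarrow> real^'d \<Rightarrow> complex) \<Rightarrow> real"
    and \<Phi> \<Psi> :: "real^'d \<Rightarrow> 'h::chilbert_space"
    and w\<^sub>1 w\<^sub>2 :: "real^'d \<Rightarrow> real"
    and p :: ennreal
    and T :: "(nat \<Rightarrow> 'h) set \<Rightarrow> (nat \<Rightarrow> 'h) set"
  assumes "countable K" and "uniform_discrete K"
    and "separable_space (euclidean :: 'h topology)"
    and "solid_spectral_matrix_algebra K \<A> nrm"
    and "is_frame K \<Phi>" and "localized K \<A> \<Phi>"
    and "is_frame K \<Psi>" and "localized K \<A> \<Psi>"
    and "mutually_localized K \<A> \<Phi> \<Psi>"
    and "admissible K \<A> w\<^sub>1" and "admissible K \<A> w\<^sub>2"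
    and "1 \<le> p"
    and "coorbit_bounded_linear K \<Psi> p w\<^sub>1 p w\<^sub>2 T"
  shows "(bij_betw T (coorbit K \<Psi> p w\<^sub>1) (coorbit K \<Psi> p w\<^sub>2) \<longleftrightarrow>
      bij_betw (galerkin K \<Psi> p w\<^sub>1 p w\<^sub>2 \<Phi> \<Psi> T)
        (coorbit_ran K \<Psi> p w\<^sub>1 \<Psi>) (coorbit_ran K \<Psi> p w\<^sub>2 \<Phi>)) \<and>
    (bij_betw T (coorbit K \<Psi> p w\<^sub>1) (coorbit K \<Psi> p w\<^sub>2) \<longrightarrow>
      (\<forall>c\<in>coorbit_ran K \<Psi> p w\<^sub>2 \<Phi>.
        inv_into (coorbit_ran K \<Psi> p w\<^sub>1 \<Psi>) (galerkin K \<Psi> p w\<^sub>1 p w\<^sub>2 \<Phi> \<Psi> T) c =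
        galerkin K \<Psi> p w\<^sub>2 p w\<^sub>1 (dual_frame K \<Psi>) (dual_frame K \<Phi>)
          (inv_into (coorbit K \<Psi> p w\<^sub>1) T) c))"
proof -
  have frames: "is_frame K \<Phi>" "is_frame K \<Psi>" and K: "countable K" and p: "1 \<le> p"
    and w: "admissible K \<A> w\<^sub>1" "admissible K \<A> w\<^sub>2"
    by fact+
  have algebra: "solid_spectral_matrix_algebra K \<A> nrm" by fact
  have grams: "gram K \<Phi> \<Phi> \<in> \<A>" "gram K \<Psi> \<Psi> \<in> \<A>" "gram K \<Phi> \<Psi> \<in> \<A>"
    using assms by (simp_all add: localized_def mutually_localized_def)
  interpret \<Psi>: localized_frame K \<A> nrm \<Psi>
    by (intro localized_frame.intro algebra frame.intro localized_frame_axioms.intro frames grams)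
  interpret \<Phi>: localized_frame K \<A> nrm \<Phi>
    by (intro localized_frame.intro algebra frame.intro localized_frame_axioms.intro frames grams)
  interpret H1: coorbit_space K p w\<^sub>1 \<Psi> by (rule \<Psi>.coorbit_space_admissible[OF K p w(1)])
  interpret H2: coorbit_space K p w\<^sub>2 \<Psi> by (rule \<Psi>.coorbit_space_admissible[OF K p w(2)])
  define C where "C = coorbit_analysis K \<Psi> p w\<^sub>2 \<Phi>"
  define D where "D = coorbit_synthesis K \<Psi> p w\<^sub>1 \<Psi>"
  define D' where "D' = coorbit_synthesis K \<Psi> p w\<^sub>2 (dual_frame K \<Phi>)"
  define M where "M = galerkin K \<Psi> p w\<^sub>1 p w\<^sub>2 \<Phi> \<Psi> T"
  have M: "M = C \<circ> (T \<circ> D)"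
    by (simp add: M_def galerkin_def C_def D_def comp_assoc)
  \<comment> \<open>Localization is carried along products: through \<Psi> to its dual, then by
    adjoints and through \<Phi> to the dual of \<Phi>.\<close>
  have mem: "gram K \<Phi> (dual_frame K \<Psi>) \<in> \<A>"
    by (rule \<Psi>.gram_mem_via_dual[OF grams(3) \<Psi>.gram_dual_dual_mem])
  have "gram K (dual_frame K \<Psi>) \<Phi> \<in> \<A>"
    using \<Psi>.adj_mem[OF mem] by (simp add: gram_adjoint)
  then have mem': "gram K (dual_frame K \<Psi>) (dual_frame K \<Phi>) \<in> \<A>"
    by (rule \<Phi>.gram_mem_via_dual[OF _ \<Phi>.gram_dual_dual_mem])
  have D'_C: "D' (C F) = F" if F: "F \<in> H2.H" for F
  proof -
    obtain B B' B'' where B: "schur_bounded K w\<^sub>2 (gram K \<Phi> \<Psi>) B"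
      "schur_bounded K w\<^sub>2 (gram K \<Phi> (dual_frame K \<Psi>)) B'"
      "schur_bounded K w\<^sub>2 (gram K (dual_frame K \<Psi>) (dual_frame K \<Phi>)) B''"
      using \<Psi>.admissible_schur_bounded[OF w(2)] grams(3) mem mem' by metis
    show ?thesis
      unfolding C_def D'_def by (rule H2.synthesis_dual_analysis[OF frames(1) B F])
  qed
  have T: "T ` H1.H \<subseteq> H2.H"
    using assms by (auto simp: coorbit_bounded_linear_def)
  have ran1: "coorbit_ran K \<Psi> p w\<^sub>1 \<Psi> = H1.V" by (rule H1.coorbit_ran_self)
  have ran2: "coorbit_ran K \<Psi> p w\<^sub>2 \<Phi> = C ` H2.H" by (simp add: coorbit_ran_def C_def)
  have bij_C: "bij_betw C H2.H (C ` H2.H)"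
    by (rule inj_on_imp_bij_betw, rule inj_on_inverseI[where g = D'], rule D'_C)
  have bij_D: "bij_betw D H1.V H1.H" unfolding D_def by (rule H1.bij_synthesis)
  have "T ` D ` H1.V \<subseteq> H2.H" using T bij_D by (simp add: bij_betw_def)
  then have bij_iff: "bij_betw T H1.H H2.H \<longleftrightarrow> bij_betw M H1.V (C ` H2.H)"
    unfolding M bij_betw_comp_iff[OF bij_D]
    by (intro bij_betw_comp_iff2[OF bij_C]) (simp add: image_comp)
  have "inv_into H1.V M c =
      galerkin K \<Psi> p w\<^sub>2 p w\<^sub>1 (dual_frame K \<Psi>) (dual_frame K \<Phi>) (inv_into H1.H T) c"
    if bij: "bij_betw T H1.H H2.H" and c: "c \<in> C ` H2.H" for c
  proof -
    obtain G where G: "G \<in> H2.H" "c = C G" using c by blast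
    \<comment> \<open>Synthesis with \<Psi> turns the coefficients of \<open>F\<close> back into
      \<open>F\<close>, so \<open>M\<close> maps them to \<open>c\<close>. On the other side
      \<open>D'\<close> recovers \<open>G\<close> from \<open>c\<close>, and analysis with the dual
      of \<Psi> returns these same coefficients.\<close>
    define F where "F = inv_into H1.H T G"
    have F: "F \<in> H1.H" "T F = G"
      using bij G(1) by (auto simp: F_def bij_betw_def inv_into_into f_inv_into_f)
    have "M (coef K \<Psi> F) = c"
      using F G by (simp add: M D_def H1.synthesis_coef)
    moreover have "inj_on M H1.V" using bij bij_iff by (simp add: bij_betw_def)
    ultimately have "inv_into H1.V M c = coef K \<Psi> F"
      using H1.coef_V[OF F(1)] by (intro inv_into_f_eq)
    moreover have "galerkin K \<Psi> p w\<^sub>2 p w\<^sub>1 (dual_frame K \<Psi>) (dual_frame K \<Phi>) (inv_into H1.H T) c =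
        coorbit_analysis K \<Psi> p w\<^sub>1 (dual_frame K \<Psi>) (inv_into H1.H T (D' c))"
      by (simp add: galerkin_def D'_def)
    ultimately show ?thesis
      using D'_C[OF G(1)] H1.analysis_dual_eq_coef[OF F(1)] by (simp add: G(2) F_def)
  qed
  then show ?thesis
    using bij_iff unfolding ran1 ran2 M_def by blast
qed

end
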